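(* Let $\Gamma$, $H_0=\Delta+W$, $d$, $\mathcal C$, $V_c$, the guided potential $Q$, and the guided bands be as in the context, and let $H=H_0-Q$. Let $\mathcal C_{\mathfrak m}$ be the graph with vertex set $V_c$ obtained from $\mathcal C$ by deleting all bridges, let $\Delta_{\mathfrak m}$ be its Laplacian $(\Delta_{\mathfrak m}f)(v)=\sum_{(v,u)\text{ oriented edge of }\mathcal C_{\mathfrak m}}(f(v)-f(u))$ on $\ell^2(V_c)$, and let $h=\Delta_{\mathfrak m}+W-Q$ on $\ell^2(V_c)$ ($W,Q$ restricted to $V_c$). Let $\tilde\mu_1\le\tilde\mu_2\le\dots$ be the eigenvalues of $h$ below $\inf\sigma_{ess}(h)$ counted with multiplicity, and put $\mu_j=\min\{\tilde\mu_j,\inf\sigma_{ess}(h)\}$ for $j=1,\dots,p$ (with $\mu_j=\inf\sigma_{ess}(h)$ if there are fewer than $j$ such eigenvalues). Then for each $j=1,\dots,N_g$, $$\mathfrak s_j^o(H)\subset[\mu_j,\mu_j+2\beta_+],\qquad \beta_+=\max_{v\in V_c}\beta_v .$$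
   Context: Let $\tilde d\ge2$ and let $\Gamma=(V,\mathcal E)$ be a connected infinite graph (loops and multiple edges allowed) with all vertex degrees finite, embedded in $\mathbb R^{\tilde d}$, invariant under translations by linearly independent vectors $a_1,\dots,a_{\tilde d}$, with finite quotient $\Gamma/\mathbb Z^{\tilde d}$; coordinates are taken w.r.t. the basis $a_1,\dots,a_{\tilde d}$ and a fixed origin. $\mathcal A$ is the set of oriented edges (each unoriented edge, including each loop, gives two); $(u,v)$ is an oriented edge from $u$ to $v$. $(\Delta f)(v)=\sum_{(v,u)\in\mathcal A}(f(v)-f(u))$ on $\ell^2(V)$. $W:V\to\mathbb R$ with $W(v+a_s)=W(v)$ for all $s\le\tilde d$; $H_0=\Delta+W$, normalized (standing assumption) so that $\inf\sigma(H_0)=0$. Fix an integer $1\le d<\tilde d$. $V_c=V\cap([0,1)^d\times\mathbb R^{\tilde d-d})$; each $v\in V$ is uniquely $v=v_0+[v]$, $v_0\in V_c$, $[v]\in\mathbb Z^d$ meaning $v-v_0=\sum_{s=1}^d n_sa_s$, $[v]=(n_1,\dots,n_d)$. The index of $\mathbf e=(u,v)\in\mathcal A$ is $\tau(\mathbf e)=[v]-[u]$. The cylinder $\mathcal C=\Gamma/\mathbb Z^d$ ($\mathbb Z^d$ acting by translations by $a_1,\dots,a_d$) has vertex set $V_c$ and oriented edge set $\mathcal A_c=\mathcal A/\mathbb Z^d$, each edge carrying the (well-defined) index of its representatives. Bridges are edges with nonzero index; $\beta_v$ is the number of oriented bridges of $\mathcal C$ starting at $v\in V_c$. A guided potential is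 $Q:V\to[0,\infty)$ with $Q(v+a_s)=Q(v)$ for $s=1,\dots,d$ and $\{v\in V_c:Q(v)\ne0\}=\{v_1,\dots,v_p\}$ finite. For $\vartheta\in\mathbb T^d=\mathbb R^d/(2\pi\mathbb Z)^d$ the fiber operator on $\ell^2(V_c)$ is $H(\vartheta)=\Delta(\vartheta)+W-Q$, with $(\Delta(\vartheta)f)(v)=\sum_{\mathbf e=(v,u)\in\mathcal A_c}(f(v)-e^{i\langle\tau(\mathbf e),\vartheta\rangle}f(u))$. Let $\lambda_1(\vartheta)\le\dots\le\lambda_{N_\vartheta}(\vartheta)$ be the eigenvalues of finite multiplicity of $H(\vartheta)$ (one has $N_\vartheta\le p$), $N=\max_\vartheta N_\vartheta$, and the guided bands are $\mathfrak s_j(H)=\lambda_j(\mathbb T^d)=[\lambda_j^-,\lambda_j^+]$, $j=1,\dots,N$. The guided bands below $\inf\sigma(H_0)=0$ are $\mathfrak s_j^o(H)=\mathfrak s_j(H)\cap(-\infty,0]$, for those $j=1,\dots,N_g$ for which this set is nonempty. *)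

theory Defs
  imports "HOL-Analysis.Analysis"
begin

text \<open>Points of R^dt are functions nat => real, vanishing at coordinates >= dt.
  Coordinates are w.r.t. the lattice basis a_1..a_dt, so translation by a_(s+1)
  is adding 1 to coordinate s (coordinates are indexed from 0).\<close>

type_synonym pt = "nat \<Rightarrow> real"

definition unitshift :: "nat \<Rightarrow> pt \<Rightarrow> pt" where
  "unitshift s v = v(s := v s + 1)"

definition Vcyl :: "nat \<Rightarrow> pt set \<Rightarrow> pt set" where
  "Vcyl d V = {v \<in> V. \<forall>i<d. 0 \<le> v i \<and> v i < 1}"

definition cell :: "nat \<Rightarrow> pt \<Rightarrow> (nat \<Rightarrow> int)" where
  "cell d p = (\<lambda>i. if i < d then \<lfloor>p i\<rfloor> else 0)"

definition base :: "nat \<Rightarrow> pt \<Rightarrow> pt" where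
  "base d p = (\<lambda>i. if i < d then p i - of_int \<lfloor>p i\<rfloor> else p i)"

definition tau :: "nat \<Rightarrow> ('e \<Rightarrow> pt) \<Rightarrow> ('e \<Rightarrow> pt) \<Rightarrow> 'e \<Rightarrow> (nat \<Rightarrow> int)" where
  "tau d src tgt e = (\<lambda>i. cell d (tgt e) i - cell d (src e) i)"

definition ipd :: "nat \<Rightarrow> (nat \<Rightarrow> int) \<Rightarrow> (nat \<Rightarrow> real) \<Rightarrow> real" where
  "ipd d n \<theta> = (\<Sum>i<d. of_int (n i) * \<theta> i)"

definition torus :: "nat \<Rightarrow> (nat \<Rightarrow> real) set" where
  "torus d = {\<theta>. \<forall>i. (i < d \<longrightarrow> 0 \<le> \<theta> i \<and> \<theta> i < 2 * pi) \<and> (d \<le> i \<longrightarrow> \<theta> i = 0)}"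

text \<open>number of oriented bridges of the cylinder starting at v (v in V_c)\<close>
definition beta :: "nat \<Rightarrow> ('e \<Rightarrow> pt) \<Rightarrow> ('e \<Rightarrow> pt) \<Rightarrow> pt \<Rightarrow> nat" where
  "beta d src tgt v = card {e. src e = v \<and> tau d src tgt e \<noteq> (\<lambda>_. 0)}"

definition beta_plus :: "nat \<Rightarrow> pt set \<Rightarrow> ('e \<Rightarrow> pt) \<Rightarrow> ('e \<Rightarrow> pt) \<Rightarrow> nat" where
  "beta_plus d V src tgt = Max (beta d src tgt ` Vcyl d V)"

type_synonym op = "(pt \<Rightarrow> complex) \<Rightarrow> (pt \<Rightarrow> complex)"

definition opH0 :: "pt set \<Rightarrow> ('e \<Rightarrow> pt) \<Rightarrow> ('e \<Rightarrow> pt) \<Rightarrow> (pt \<Rightarrow> real) \<Rightarrow> op" where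
  "opH0 V src tgt W f = (\<lambda>v. if v \<in> V then
      (\<Sum>e | src e = v. f v - f (tgt e)) + complex_of_real (W v) * f v else 0)"

text \<open>Fiber operator H(theta) = Delta(theta) + W - Q on l2(V_c).  The oriented edges of
  the cylinder starting at v in V_c are in bijection with the oriented edges of Gamma
  starting at v (their unique representatives starting at v); the endpoint class is
  represented by base (tgt e) in V_c.\<close>
definition opHfib :: "nat \<Rightarrow> pt set \<Rightarrow> ('e \<Rightarrow> pt) \<Rightarrow> ('e \<Rightarrow> pt) \<Rightarrow> (pt \<Rightarrow> real) \<Rightarrow> (pt \<Rightarrow> real)
    \<Rightarrow> (nat \<Rightarrow> real) \<Rightarrow> op" where
  "opHfib d V src tgt W Q \<theta> f = (\<lambda>v. if v \<in> Vcyl d V then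
      (\<Sum>e | src e = v. f v - exp (\<i> * complex_of_real (ipd d (tau d src tgt e) \<theta>)) * f (base d (tgt e)))
      + complex_of_real (W v - Q v) * f v else 0)"

definition oph :: "nat \<Rightarrow> pt set \<Rightarrow> ('e \<Rightarrow> pt) \<Rightarrow> ('e \<Rightarrow> pt) \<Rightarrow> (pt \<Rightarrow> real) \<Rightarrow> (pt \<Rightarrow> real) \<Rightarrow> op" where
  "oph d V src tgt W Q f = (\<lambda>v. if v \<in> Vcyl d V then
      (\<Sum>e | src e = v \<and> tau d src tgt e = (\<lambda>_. 0). f v - f (tgt e))
      + complex_of_real (W v - Q v) * f v else 0)"

definition l2 :: "pt set \<Rightarrow> (pt \<Rightarrow> complex) set" where
  "l2 X = {f. (\<forall>x. x \<notin> X \<longrightarrow> f x = 0) \<and> (\<lambda>x. (cmod (f x))\<^sup>2) summable_on X}"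

definition l2norm :: "pt set \<Rightarrow> (pt \<Rightarrow> complex) \<Rightarrow> real" where
  "l2norm X f = sqrt (infsum (\<lambda>x. (cmod (f x))\<^sup>2) X)"

definition in_resolvent :: "pt set \<Rightarrow> op \<Rightarrow> complex \<Rightarrow> bool" where
  "in_resolvent X A z \<longleftrightarrow> (\<exists>B.
      (\<forall>f\<in>l2 X. (\<lambda>x. A f x - z * f x) \<in> l2 X \<and> B (\<lambda>x. A f x - z * f x) = f) \<and>
      (\<forall>g\<in>l2 X. B g \<in> l2 X \<and> (\<lambda>x. A (B g) x - z * B g x) = g) \<and>
      (\<exists>C. \<forall>g\<in>l2 X. l2norm X (B g) \<le> C * l2norm X g))"

definition spectrum :: "pt set \<Rightarrow> op \<Rightarrow> complex set" where
  "spectrum X A = {z. \<not> in_resolvent X A z}"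

definition lin_indep :: "(pt \<Rightarrow> complex) list \<Rightarrow> bool" where
  "lin_indep fs \<longleftrightarrow> (\<forall>c::nat \<Rightarrow> complex.
      (\<forall>x. (\<Sum>i<length fs. c i * (fs ! i) x) = 0) \<longrightarrow> (\<forall>i<length fs. c i = 0))"

definition mult :: "pt set \<Rightarrow> op \<Rightarrow> complex \<Rightarrow> enat" where
  "mult X A z = Sup {enat n | n. \<exists>fs. length fs = n \<and> lin_indep fs \<and>
      (\<forall>f\<in>set fs. f \<in> l2 X \<and> A f = (\<lambda>x. z * f x))}"

definition disc_spectrum :: "pt set \<Rightarrow> op \<Rightarrow> complex set" where
  "disc_spectrum X A = {z \<in> spectrum X A. (\<exists>\<epsilon>>0. ball z \<epsilon> \<inter> spectrum X A = {z})
      \<and> 0 < mult X A z \<and> mult X A z < \<infinity>}"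

definition ess_spectrum :: "pt set \<Rightarrow> op \<Rightarrow> complex set" where
  "ess_spectrum X A = spectrum X A - disc_spectrum X A"

definition inf_spec :: "pt set \<Rightarrow> op \<Rightarrow> real" where
  "inf_spec X A = Inf {x::real. complex_of_real x \<in> spectrum X A}"

definition inf_ess :: "pt set \<Rightarrow> op \<Rightarrow> real" where
  "inf_ess X A = Inf {x::real. complex_of_real x \<in> ess_spectrum X A}"

definition count_below :: "pt set \<Rightarrow> op \<Rightarrow> real \<Rightarrow> enat" where
  "count_below X A t = Sup {enat n | n. \<exists>fs ls. length fs = n \<and> length ls = n \<and> lin_indep fs \<and>
      (\<forall>i<n. fs ! i \<in> l2 X \<and> A (fs ! i) = (\<lambda>x. complex_of_real (ls ! i) * (fs ! i) x) \<and> ls ! i \<le> t)}"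

definition mu :: "pt set \<Rightarrow> op \<Rightarrow> nat \<Rightarrow> real" where
  "mu X A j = Inf ({t. t < inf_ess X A \<and> enat j \<le> count_below X A t} \<union> {inf_ess X A})"

definition count_fin :: "pt set \<Rightarrow> op \<Rightarrow> real \<Rightarrow> enat" where
  "count_fin X A t = Sup {enat n | n. \<exists>fs ls. length fs = n \<and> length ls = n \<and> lin_indep fs \<and>
      (\<forall>i<n. fs ! i \<in> l2 X \<and> A (fs ! i) = (\<lambda>x. complex_of_real (ls ! i) * (fs ! i) x)
         \<and> mult X A (complex_of_real (ls ! i)) < \<infinity> \<and> ls ! i \<le> t)}"

definition num_fin :: "pt set \<Rightarrow> op \<Rightarrow> enat" where
  "num_fin X A = Sup {enat n | n. \<exists>fs ls. length fs = n \<and> length ls = n \<and> lin_indep fs \<and>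
      (\<forall>i<n. fs ! i \<in> l2 X \<and> A (fs ! i) = (\<lambda>x. complex_of_real (ls ! i) * (fs ! i) x)
         \<and> mult X A (complex_of_real (ls ! i)) < \<infinity>)}"

definition lam :: "pt set \<Rightarrow> op \<Rightarrow> nat \<Rightarrow> real" where
  "lam X A j = Inf {t. enat j \<le> count_fin X A t}"

definition guided_band :: "nat \<Rightarrow> pt set \<Rightarrow> ('e \<Rightarrow> pt) \<Rightarrow> ('e \<Rightarrow> pt) \<Rightarrow> (pt \<Rightarrow> real) \<Rightarrow> (pt \<Rightarrow> real)
    \<Rightarrow> nat \<Rightarrow> real set" where
  "guided_band d V src tgt W Q j =
     {lam (Vcyl d V) (opHfib d V src tgt W Q \<theta>) j | \<theta>.
        \<theta> \<in> torus d \<and> enat j \<le> num_fin (Vcyl d V) (opHfib d V src tgt W Q \<theta>)}"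

definition guided_band_o :: "nat \<Rightarrow> pt set \<Rightarrow> ('e \<Rightarrow> pt) \<Rightarrow> ('e \<Rightarrow> pt) \<Rightarrow> (pt \<Rightarrow> real) \<Rightarrow> (pt \<Rightarrow> real)
    \<Rightarrow> nat \<Rightarrow> real set" where
  "guided_band_o d V src tgt W Q j = guided_band d V src tgt W Q j \<inter> {..0}"

definition N_g :: "nat \<Rightarrow> pt set \<Rightarrow> ('e \<Rightarrow> pt) \<Rightarrow> ('e \<Rightarrow> pt) \<Rightarrow> (pt \<Rightarrow> real) \<Rightarrow> (pt \<Rightarrow> real) \<Rightarrow> nat" where
  "N_g d V src tgt W Q = card {j. 1 \<le> j \<and> guided_band_o d V src tgt W Q j \<noteq> {}}"

end

theory Submission
  imports Defs
begin

text \<open>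
  Deleting the bridges changes \<open>H(\<theta>)\<close> by the Laplacian of the bridges, whose quadratic form lies
  between \<open>0\<close> and \<open>2\<beta>\<^sub>+\<close>, so that \<open>h \<le> H(\<theta>) \<le> h + 2\<beta>\<^sub>+\<close>. By the min-max principle the eigenvalues below
  the essential spectrum obey the same inequalities. The min-max principle is used in the form
  that \<open>\<mu>\<^sub>j(h) < s\<close> forces a \<open>j\<close>-dimensional space on which the form of \<open>h - s\<close> is negative, and that
  such a space forces \<open>\<mu>\<^sub>j(h) \<le> s\<close>. It rests on two elementary facts: the infimum of a symmetric form on
  an invariant closed subspace belongs to the spectrum, and an isolated point of the spectrum at
  this infimum is an eigenvalue. The essential spectrum of \<open>H(\<theta>)\<close> is nonnegative because \<open>Q\<close> has finite
  rank on the cylinder and the form of \<open>H\<^sub>0(\<theta>)\<close> is a limit of averages of the nonnegative form of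
  \<open>H\<^sub>0\<close> over truncated Bloch waves.
\<close>

section \<open>Symmetric operators on real Hilbert spaces\<close>

text \<open>No spectral measure enters. For a symmetric operator \<open>z\<close> is a resolvent
  point exactly when \<open>T - z\<close> is bounded below, a condition that also makes sense on
  invariant subspaces, so every spectral statement is phrased with \<open>bounded_below_on\<close>.
  Forms of complex-linear symmetric operators are real; hence the analysis runs in a real Hilbert
  space on which complex scalars act through \<open>csc\<close>. The two inequalities differ in
  depth. \<open>lam\<close> counts all eigenvalues of finite multiplicity, also those that lie
  inside or above the essential spectrum. The bound of \<open>mu\<close> by \<open>lam\<close>
  survives this, because eigenvectors span a space with a controlled form wherever their eigenvalues
  lie. The reverse bound has to produce eigenvectors of the fiber operator. That works only below
  its essential spectrum, which is known to be nonnegative, and this is where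
  \<open>lam \<le> 0\<close> is needed. The infimum of an empty set of reals is unspecified, so the
  essential spectrum of \<open>h\<close> must also be shown to be nonempty; this follows from the
  cylinder being infinite.\<close>

definition bounded_below_on :: "'a::real_normed_vector set \<Rightarrow> ('a \<Rightarrow> 'a) \<Rightarrow> bool" where
  "bounded_below_on M T \<longleftrightarrow> (\<exists>\<delta>>0. \<forall>x\<in>M. \<delta> * norm x \<le> norm (T x))"

lemma not_bounded_below_onD:
  fixes T :: "'a::real_normed_vector \<Rightarrow> 'a"
  assumes "\<not> bounded_below_on M T" "bounded_linear T" "subspace M" "0 < \<delta>"
  obtains x where "x \<in> M" "norm x = 1" "norm (T x) < \<delta>"
proof -
  interpret T: bounded_linear T by fact
  obtain x where x: "x \<in> M" "norm (T x) < \<delta> * norm x"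
    using assms(1,4) unfolding bounded_below_on_def by (auto simp: not_le)
  have nx: "norm x > 0"
    using x T.zero by (cases "x = 0") auto
  show ?thesis
  proof (rule that)
    show "inverse (norm x) *\<^sub>R x \<in> M" using assms(3) x by (simp add: subspace_scale)
    show "norm (inverse (norm x) *\<^sub>R x) = 1" using nx by simp
    show "norm (T (inverse (norm x) *\<^sub>R x)) < \<delta>"
      using nx x by (simp add: T.scaleR field_simps)
  qed
qed

lemma subspace_closure:
  fixes S :: "'a::real_normed_vector set"
  assumes "subspace S"
  shows "subspace (closure S)"
  unfolding subspace_def
proof (intro conjI ballI allI)
  show "0 \<in> closure S" using assms closure_subset subspace_0 by blast
  show "x + y \<in> closure S" if xy: "x \<in> closure S" "y \<in> closure S" for x y
  proof -
    obtain f where "\<forall>n. f n \<in> S" "f \<longlonglongrightarrow> x"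
      using xy(1) unfolding closure_sequential by blast
    moreover obtain g where "\<forall>n. g n \<in> S" "g \<longlonglongrightarrow> y"
      using xy(2) unfolding closure_sequential by blast
    ultimately show ?thesis unfolding closure_sequential
      using assms by (intro exI[of _ "\<lambda>n. f n + g n"]) (auto intro: tendsto_add subspace_add)
  qed
  show "c *\<^sub>R x \<in> closure S" if x: "x \<in> closure S" for c x
  proof -
    obtain f where "\<forall>n. f n \<in> S" "f \<longlonglongrightarrow> x"
      using x unfolding closure_sequential by blast
    then show ?thesis unfolding closure_sequential
      using assms by (intro exI[of _ "\<lambda>n. c *\<^sub>R f n"]) (auto intro: tendsto_scaleR subspace_scale)
  qed
qed

locale symmetric_operator =
  fixes T :: "'a::real_inner \<Rightarrow> 'a"
  assumes bl: "bounded_linear T"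
    and sym: "T x \<bullet> y = x \<bullet> T y"
begin

sublocale bounded_linear T by (rule bl)

lemma shift: "symmetric_operator (\<lambda>x. T x - c *\<^sub>R x)"
  by (intro symmetric_operator.intro bounded_linear_sub bl bounded_linear_scaleR_right)
    (simp add: inner_diff_left inner_diff_right sym)

lemma square: "symmetric_operator (\<lambda>x. T (T x))"
  by (intro symmetric_operator.intro bounded_linear_compose[OF bl bl]) (simp add: sym)

text \<open>This is the operator inequality \<open>T^2 \<le> K T\<close> for a nonnegative form:
  test positivity at \<open>x - T x / K\<close> and estimate \<open>T (T x) \<bullet> T x\<close> by
  the norm bound \<open>K\<close>. It turns a small value of the form into a small vector
  \<open>T x\<close>.\<close>

lemma norm_square_le_form:
  assumes M: "T ` M \<subseteq> M" "subspace M" and pos: "\<And>x. x \<in> M \<Longrightarrow> 0 \<le> T x \<bullet> x"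
    and K: "K > 0" "\<And>x. norm (T x) \<le> norm x * K" and x: "x \<in> M"
  shows "(norm (T x))\<^sup>2 \<le> K * (T x \<bullet> x)"
proof -
  let ?y = "x - (1/K) *\<^sub>R T x"
  have "?y \<in> M" using M x by (auto intro!: subspace_diff subspace_scale)
  then have "0 \<le> T ?y \<bullet> ?y" by (rule pos)
  also have "T ?y \<bullet> ?y = T x \<bullet> x - 2/K * (T x \<bullet> T x) + 1/K^2 * (T (T x) \<bullet> T x)"
    using sym[of "T x" x] by (simp add: diff scaleR inner_diff_left inner_diff_right inner_commute
        power2_eq_square field_simps)
  finally have 1: "0 \<le> T x \<bullet> x - 2/K * (T x \<bullet> T x) + 1/K^2 * (T (T x) \<bullet> T x)" .
  have "T (T x) \<bullet> T x \<le> norm (T (T x)) * norm (T x)" by (rule norm_cauchy_schwarz)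
  also have "\<dots> \<le> (norm (T x) * K) * norm (T x)" by (intro mult_right_mono K) auto
  also have "\<dots> = K * (T x \<bullet> T x)" by (simp add: dot_square_norm power2_eq_square)
  finally have "1/K^2 * (T (T x) \<bullet> T x) \<le> 1/K^2 * (K * (T x \<bullet> T x))"
    by (intro mult_left_mono) auto
  also have "\<dots> = 1/K * (T x \<bullet> T x)" using K by (simp add: power2_eq_square)
  finally have "1/K * (T x \<bullet> T x) \<le> T x \<bullet> x" using 1 by (simp add: field_simps)
  then show ?thesis using K by (simp add: field_simps dot_square_norm)
qed

text \<open>For \<open>M = {0}\<close> there is no unit vector and the infimum has no meaning; hence
  the nonzero vector \<open>x0\<close> in \<open>rayleigh_inf_not_bounded_below\<close>.\<close>

definition rayleigh_inf :: "'a set \<Rightarrow> real" where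
  "rayleigh_inf M = Inf ((\<lambda>x. T x \<bullet> x) ` {x\<in>M. norm x = 1})"

lemma bdd_below_form: "bdd_below ((\<lambda>x. T x \<bullet> x) ` {x\<in>M. norm x = 1})"
proof -
  obtain K where K: "\<And>x. norm (T x) \<le> norm x * K" using pos_bounded by blast
  have "-K \<le> T x \<bullet> x" if "norm x = 1" for x
    using K[of x] Cauchy_Schwarz_ineq2[of "T x" x] that by simp
  then show ?thesis by (intro bdd_belowI[of _ "-K"]) auto
qed

lemma rayleigh_inf_le:
  assumes "subspace M" "x \<in> M"
  shows "rayleigh_inf M * (x \<bullet> x) \<le> T x \<bullet> x"
proof (cases "x = 0")
  case False
  let ?y = "inverse (norm x) *\<^sub>R x"
  have "rayleigh_inf M \<le> T ?y \<bullet> ?y"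
    unfolding rayleigh_inf_def using assms False
    by (intro cInf_lower bdd_below_form imageI) (auto intro: subspace_scale)
  then show ?thesis using False
    by (simp add: scaleR dot_square_norm power2_eq_square field_simps)
qed (simp add: zero)

text \<open>A near-minimizer is an approximate eigenvector: the form of \<open>T - m\<close> is
  nonnegative on \<open>M\<close>, so by \<open>norm_square_le_form\<close> a unit vector with form
  value below \<open>\<delta>^2 / K\<close> has a residual below \<open>\<delta>\<close>.\<close>

lemma rayleigh_inf_not_bounded_below:
  assumes M: "T ` M \<subseteq> M" "subspace M" and ne: "x0 \<in> M" "x0 \<noteq> 0"
  shows "\<not> bounded_below_on M (\<lambda>x. T x - rayleigh_inf M *\<^sub>R x)"
proof
  let ?m = "rayleigh_inf M"
  assume "bounded_below_on M (\<lambda>x. T x - ?m *\<^sub>R x)"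
  then obtain \<delta> where \<delta>: "\<delta> > 0" "\<And>x. x \<in> M \<Longrightarrow> \<delta> * norm x \<le> norm (T x - ?m *\<^sub>R x)"
    unfolding bounded_below_on_def by blast
  interpret S: symmetric_operator "\<lambda>x. T x - ?m *\<^sub>R x" by (rule shift)
  obtain K where K: "K > 0" "\<And>x. norm (T x - ?m *\<^sub>R x) \<le> norm x * K"
    using S.pos_bounded by blast
  have "\<exists>x\<in>M. norm x = 1 \<and> T x \<bullet> x < ?m + \<delta>\<^sup>2 / K"
  proof (rule ccontr)
    assume "\<not> ?thesis"
    moreover have "inverse (norm x0) *\<^sub>R x0 \<in> {x\<in>M. norm x = 1}" 
      using ne M by (auto intro: subspace_scale)
    ultimately have "?m + \<delta>\<^sup>2/K \<le> ?m"
      unfolding rayleigh_inf_def by (intro cInf_greatest) (auto simp: not_less)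
    then show False using \<delta> K by (simp add: field_simps)
  qed
  then obtain x where x: "x \<in> M" "norm x = 1" "T x \<bullet> x < ?m + \<delta>\<^sup>2 / K" by blast
  have "(norm (T x - ?m *\<^sub>R x))\<^sup>2 \<le> K * ((T x - ?m *\<^sub>R x) \<bullet> x)"
  proof (rule S.norm_square_le_form[OF _ M(2) _ K x(1)])
    show "(\<lambda>x. T x - ?m *\<^sub>R x) ` M \<subseteq> M" using M by (auto intro!: subspace_diff subspace_scale)
    show "0 \<le> (T x - ?m *\<^sub>R x) \<bullet> x" if "x \<in> M" for x
      using rayleigh_inf_le[OF M(2) that] by (simp add: inner_diff_left)
  qed
  also have "\<dots> < K * (\<delta>\<^sup>2 / K)" 
    using x K by (intro mult_strict_left_mono) (auto simp: inner_diff_left dot_square_norm)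
  also have "\<dots> = \<delta>\<^sup>2" using K by simp
  finally have "norm (T x - ?m *\<^sub>R x) < \<delta>"
    by (rule power_less_imp_less_base) (use \<delta> in simp)
  then show False using \<delta>(2)[OF x(1)] x by simp
qed

text \<open>Let \<open>m\<close> be the Rayleigh infimum of \<open>T^2\<close>. If
  \<open>m < c^2\<close>, then \<open>T^2 - m\<close> factors into \<open>T - \<delta>\<close> and
  \<open>T + \<delta>\<close> with \<open>\<delta> = sqrt m < c\<close>. Both factors are bounded
  below by the gap hypothesis, whereas \<open>T^2 - m\<close> is not.\<close>

lemma norm_ge_of_spectral_gap:
  assumes M: "T ` M \<subseteq> M" "subspace M" and c: "c > 0"
    and gap: "\<And>w. \<bar>w\<bar> < c \<Longrightarrow> bounded_below_on M (\<lambda>x. T x - w *\<^sub>R x)"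
    and x: "x \<in> M"
  shows "c * norm x \<le> norm (T x)"
proof (rule ccontr)
  assume neg: "\<not> ?thesis"
  then have x0: "x \<noteq> 0" using zero by auto
  interpret S: symmetric_operator "\<lambda>x. T (T x)" by (rule square)
  define m where "m = S.rayleigh_inf M"
  have TT: "T (T x) \<bullet> x = (norm (T x))\<^sup>2" for x by (simp add: sym dot_square_norm)
  have m_ge: "0 \<le> m" unfolding m_def S.rayleigh_inf_def TT
  proof (rule cInf_greatest)
    have "inverse (norm x) *\<^sub>R x \<in> {x\<in>M. norm x = 1}" 
      using x0 x M by (auto intro: subspace_scale)
    then show "(\<lambda>x. (norm (T x))\<^sup>2) ` {x \<in> M. norm x = 1} \<noteq> {}" by blast
  qed auto
  have "m * (norm x)\<^sup>2 \<le> (norm (T x))\<^sup>2"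
    using S.rayleigh_inf_le[OF M(2) x] by (simp add: TT m_def dot_square_norm)
  also have "\<dots> < (c * norm x)\<^sup>2" using neg by (intro power_strict_mono) auto
  finally have "m < c\<^sup>2" using x0 by (simp add: power_mult_distrib)
  define \<delta> where "\<delta> = sqrt m"
  have \<delta>: "0 \<le> \<delta>" "\<delta> < c" "\<delta> * \<delta> = m"
    using m_ge \<open>m < c\<^sup>2\<close> c unfolding \<delta>_def by (auto intro: real_less_lsqrt)
  obtain a where a: "a > 0" "\<And>x. x \<in> M \<Longrightarrow> a * norm x \<le> norm (T x - \<delta> *\<^sub>R x)"
    using gap[of \<delta>] \<delta> unfolding bounded_below_on_def by auto
  obtain b where b: "b > 0" "\<And>x. x \<in> M \<Longrightarrow> b * norm x \<le> norm (T x - (-\<delta>) *\<^sub>R x)"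
    using gap[of "-\<delta>"] \<delta> unfolding bounded_below_on_def by auto
  have "a * b * norm x \<le> norm (T (T x) - m *\<^sub>R x)" if "x \<in> M" for x
  proof -
    let ?y = "T x - (-\<delta>) *\<^sub>R x"
    have "?y \<in> M" using M that by (intro subspace_diff subspace_scale) auto
    then have "a * norm ?y \<le> norm (T ?y - \<delta> *\<^sub>R ?y)" by (rule a)
    also have "T ?y - \<delta> *\<^sub>R ?y = T (T x) - m *\<^sub>R x" 
      by (simp add: add scaleR algebra_simps flip: \<delta>(3))
    finally show ?thesis
      using order_trans[OF mult_left_mono[OF b(2)[OF that], of a]] a(1) by (simp add: mult.assoc)
  qed
  then have "bounded_below_on M (\<lambda>x. T (T x) - m *\<^sub>R x)"
    unfolding bounded_below_on_def using a(1) b(1) by (intro exI[of _ "a*b"]) auto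
  moreover have "(\<lambda>x. T (T x)) ` M \<subseteq> M" using M by auto
  ultimately show False
    using S.rayleigh_inf_not_bounded_below[OF _ M(2) x x0] by (simp add: m_def)
qed

end

locale symmetric_operator_hilbert = symmetric_operator T
  for T :: "'a::{real_inner,complete_space} \<Rightarrow> 'a"
begin

text \<open>The Lax-Milgram argument as a fixed point problem: \<open>x + (y - T x) / K\<close> is a
  contraction with factor \<open>sqrt (1 - a / K)\<close>, by
  \<open>norm_square_le_form\<close>.\<close>

lemma coercive_surj:
  assumes M: "T ` M \<subseteq> M" "subspace M" "closed M" and a: "a > 0"
    and coer: "\<And>x. x \<in> M \<Longrightarrow> a * (x \<bullet> x) \<le> T x \<bullet> x" and y: "y \<in> M"
  obtains x where "x \<in> M" "T x = y"
proof -
  obtain K0 where K0: "K0 > 0" "\<And>x. norm (T x) \<le> norm x * K0" using pos_bounded by blast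
  \<comment> \<open>The maximum keeps \<open>1 - a / K\<close> nonnegative even if \<open>M\<close>
    has no nonzero vector that would force \<open>a \<le> K0\<close>.\<close>
  define K where "K = max K0 a"
  have K: "K > 0" "K \<ge> a" "\<And>x. norm (T x) \<le> norm x * K"
    using K0 a order_trans[OF K0(2) mult_left_mono[of K0 K]] by (auto simp: K_def)
  define q where "q = sqrt (1 - a / K)"
  have q: "0 \<le> q" "q < 1" using K a by (auto simp: q_def field_simps)
  have pos: "0 \<le> T x \<bullet> x" if "x \<in> M" for x
    using coer[OF that] a by (meson inner_ge_zero less_imp_le mult_nonneg_nonneg order_trans)
  have contr: "norm (x - (1/K) *\<^sub>R T x) \<le> q * norm x" if x: "x \<in> M" for x
  proof -
    have "(norm (x - (1/K) *\<^sub>R T x))\<^sup>2 = x \<bullet> x - 2/K * (T x \<bullet> x) + 1/K^2 * (norm (T x))\<^sup>2"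
      by (simp add: power2_norm_eq_inner inner_diff_left inner_diff_right inner_commute)
        (simp add: power2_eq_square field_simps)
    also have "\<dots> \<le> x \<bullet> x - 2/K * (T x \<bullet> x) + 1/K^2 * (K * (T x \<bullet> x))"
      using norm_square_le_form[OF M(1,2) pos K(1,3) x] by (intro add_left_mono mult_left_mono) auto
    also have "\<dots> = x \<bullet> x - 1/K * (T x \<bullet> x)" using K by (simp add: power2_eq_square field_simps)
    also have "\<dots> \<le> x \<bullet> x - 1/K * (a * (x \<bullet> x))"
      using coer[OF x] K by (intro diff_left_mono mult_left_mono) auto
    also have "\<dots> = (q * norm x)\<^sup>2"
      using K by (simp add: q_def power_mult_distrib dot_square_norm field_simps)
    finally show ?thesis by (rule power2_le_imp_le) (use q in simp)
  qed
  have "\<exists>!x. x \<in> M \<and> x + (1/K) *\<^sub>R (y - T x) = x"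
  proof (rule Banach_fix[of M q])
    show "complete M" using M(3) by (simp add: complete_eq_closed)
    show "M \<noteq> {}" using y by auto
    show "(\<lambda>x. x + (1/K) *\<^sub>R (y - T x)) ` M \<subseteq> M"
      using M y by (auto intro!: subspace_add subspace_diff subspace_scale)
    show "dist (x + (1/K) *\<^sub>R (y - T x)) (z + (1/K) *\<^sub>R (y - T z)) \<le> q * dist x z"
      if "x \<in> M" "z \<in> M" for x z
      using contr[of "x - z"] M(2) that
      by (simp add: dist_norm subspace_diff diff algebra_simps)
  qed (use q in auto)
  then show ?thesis using that K by auto
qed

text \<open>The gap above \<open>0\<close> makes \<open>T\<close> coercive on the closure of its range, so an almost null vector \<open>x\<close> can
  be corrected by the small solution \<open>r\<close> of \<open>T r = T x\<close> in that closure.\<close>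

lemma kernel_nontrivial_of_gap:
  assumes M: "T ` M \<subseteq> M" "subspace M" "closed M" and pos: "\<And>x. x \<in> M \<Longrightarrow> 0 \<le> T x \<bullet> x"
    and \<epsilon>: "\<epsilon> > 0"
    and gap: "\<And>w. 0 < w \<Longrightarrow> w < \<epsilon> \<Longrightarrow> bounded_below_on M (\<lambda>x. T x - w *\<^sub>R x)"
    and nbb: "\<not> bounded_below_on M T"
  obtains x where "x \<in> M" "x \<noteq> 0" "T x = 0"
proof -
  \<comment> \<open>The gap \<open>(0, \<epsilon>)\<close> is the interval of radius
    \<open>c\<close> around \<open>c\<close>, so \<open>T - c\<close> has a gap symmetric about
    0.\<close>
  define c where "c = \<epsilon> / 2"
  have c: "c > 0" using \<epsilon> by (simp add: c_def)
  interpret S: symmetric_operator "\<lambda>x. T x - c *\<^sub>R x" by (rule shift)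
  have S_ge: "c * norm x \<le> norm (T x - c *\<^sub>R x)" if "x \<in> M" for x
  proof (rule S.norm_ge_of_spectral_gap[OF _ M(2) c _ that])
    show "(\<lambda>x. T x - c *\<^sub>R x) ` M \<subseteq> M" using M by (auto intro!: subspace_diff subspace_scale)
    show "bounded_below_on M (\<lambda>x. T x - c *\<^sub>R x - w *\<^sub>R x)" if "\<bar>w\<bar> < c" for w
      using gap[of "c + w"] that by (simp add: c_def algebra_simps)
  qed
  have ineq1: "2 * c * (T x \<bullet> x) \<le> T x \<bullet> T x" if "x \<in> M" for x
  proof -
    have "(c * norm x)\<^sup>2 \<le> (norm (T x - c *\<^sub>R x))\<^sup>2"
      using S_ge[OF that] c by (intro power_mono) auto
    then show ?thesis
      by (simp add: power_mult_distrib power2_norm_eq_inner inner_diff_left inner_diff_right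
          inner_commute) (simp add: power2_eq_square algebra_simps)
  qed
  have ineq2: "2 * c * (T x \<bullet> T x) \<le> T (T x) \<bullet> T x" if x: "x \<in> M" for x
  proof -
    \<comment> \<open>Positivity at this vector, combined with \<open>ineq1\<close>, moves the bound
      \<open>2 * c\<close> from \<open>x\<close> to the range vector \<open>T x\<close>, where it
      becomes coercivity.\<close>
    let ?y = "x - (1/(2*c)) *\<^sub>R T x"
    have "?y \<in> M" using M x by (auto intro!: subspace_diff subspace_scale)
    then have "0 \<le> T ?y \<bullet> ?y" by (rule pos)
    also have "T ?y \<bullet> ?y = T x \<bullet> x - 1/c * (T x \<bullet> T x) + 1/(4*c^2) * (T (T x) \<bullet> T x)"
      using sym[of "T x" x] by (simp add: diff scaleR inner_diff_left inner_diff_right inner_commute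
          power2_eq_square field_simps)
    also have "\<dots> \<le> 1/(2*c) * (T x \<bullet> T x) - 1/c * (T x \<bullet> T x) + 1/(4*c^2) * (T (T x) \<bullet> T x)"
      using ineq1[OF x] c by (simp add: field_simps)
    finally have "0 \<le> 4*c\<^sup>2 * (1/(2*c) * (T x \<bullet> T x) - 1/c * (T x \<bullet> T x) + 1/(4*c^2) * (T (T x) \<bullet> T x))"
      using c by (intro mult_nonneg_nonneg) auto
    also have "\<dots> = - 2 * c * (T x \<bullet> T x) + T (T x) \<bullet> T x"
      using c by (simp add: field_simps power2_eq_square)
    finally show ?thesis by simp
  qed
  define R where "R = closure (T ` M)"
  have R_sub: "subspace R"
    unfolding R_def using M(2) linear_axioms by (intro subspace_closure linear_subspace_image)
  have cont: "continuous_on A T" for A by (rule linear_continuous_on[OF bl])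
  have "T ` R \<subseteq> closure (T ` (T ` M))"
    unfolding R_def by (rule image_closure_subset[OF cont]) (auto intro: closure_subset[THEN subsetD])
  also have "\<dots> \<subseteq> R" unfolding R_def using M(1) by (intro closure_mono) auto
  finally have R_inv: "T ` R \<subseteq> R" .
  have R_coer: "2 * c * (x \<bullet> x) \<le> T x \<bullet> x" if "x \<in> R" for x
  proof -
    have "0 \<le> T x \<bullet> x - 2 * c * (x \<bullet> x)"
    proof (rule continuous_ge_on_closure[OF _ that[unfolded R_def]])
      show "continuous_on (closure (T ` M)) (\<lambda>x. T x \<bullet> x - 2 * c * (x \<bullet> x))"
        by (intro continuous_intros cont)
    qed (use ineq2 in auto)
    then show ?thesis by simp
  qed
  have R_M: "R \<subseteq> M" unfolding R_def using M by (simp add: closure_minimal)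
  obtain x where x: "x \<in> M" "norm x = 1" "norm (T x) < 2 * c"
    using not_bounded_below_onD[OF nbb bl M(2), of "2*c"] c by auto
  have "T x \<in> R" unfolding R_def using x(1) by (auto intro: closure_subset[THEN subsetD])
  then obtain r where r: "r \<in> R" "T r = T x"
    using coercive_surj[OF R_inv R_sub _ _ R_coer, of "T x"] c by (auto simp: R_def)
  have "2 * c * (norm r)\<^sup>2 \<le> norm (T r) * norm r"
    using R_coer[OF r(1)] norm_cauchy_schwarz[of "T r" r] by (simp add: dot_square_norm)
  \<comment> \<open>If \<open>r\<close> had norm 1, then
    \<open>2 * c \<le> norm (T r) = norm (T x) < 2 * c\<close>. As \<open>x\<close> has norm 1, the
    correction \<open>r\<close> is not all of \<open>x\<close>.\<close>
  then have "norm r \<noteq> 1" using x(3) r(2) by auto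
  then have "x - r \<noteq> 0" using x(2) by auto
  moreover have "T (x - r) = 0" using r(2) by (simp add: diff)
  moreover have "x - r \<in> M" using R_M r x M(2) by (auto intro: subspace_diff)
  ultimately show ?thesis using that by blast
qed

end

section \<open>The space of square summable functions\<close>

text \<open>One type serves all vertex sets, with \<open>l2 X\<close> as its closed subspace
  \<open>supported X\<close>. Its inner product is the real part of the Hermitian one.\<close>

typedef 'a ell2 = "{f :: 'a \<Rightarrow> complex. (\<lambda>x. (cmod (f x))\<^sup>2) summable_on UNIV}"
  morphisms fun_of ell2_of
  by (rule exI[of _ "\<lambda>_. 0"]) simp

setup_lifting type_definition_ell2

lemma square_summable_add:
  fixes f g :: "'a \<Rightarrow> complex"
  assumes "(\<lambda>x. (cmod (f x))\<^sup>2) summable_on A" "(\<lambda>x. (cmod (g x))\<^sup>2) summable_on A"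
  shows "(\<lambda>x. (cmod (f x + g x))\<^sup>2) summable_on A"
proof (rule summable_on_comparison_test)
  show "(\<lambda>x. 2 * (cmod (f x))\<^sup>2 + 2 * (cmod (g x))\<^sup>2) summable_on A"
    using assms by (intro summable_on_add summable_on_cmult_right)
  show "(cmod (f x + g x))\<^sup>2 \<le> 2 * (cmod (f x))\<^sup>2 + 2 * (cmod (g x))\<^sup>2" for x
  proof -
    have "(cmod (f x + g x))\<^sup>2 \<le> (cmod (f x) + cmod (g x))\<^sup>2"
      by (intro power_mono norm_triangle_ineq) auto
    also have "\<dots> \<le> 2 * (cmod (f x))\<^sup>2 + 2 * (cmod (g x))\<^sup>2"
      using sum_squares_bound[of "cmod (f x)" "cmod (g x)"] by (simp add: power2_sum)
    finally show ?thesis .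
  qed
qed auto

lemma square_summable_mult:
  fixes f :: "'a \<Rightarrow> complex"
  assumes "(\<lambda>x. (cmod (f x))\<^sup>2) summable_on A"
  shows "(\<lambda>x. (cmod (c * f x))\<^sup>2) summable_on A"
  using assms by (simp add: norm_mult power_mult_distrib summable_on_cmult_right)

lemma fun_of_summable: "(\<lambda>x. (cmod (fun_of f x))\<^sup>2) summable_on UNIV"
  using fun_of[of f] by (simp only: mem_Collect_eq)

lemma fun_of_summable_inner: "(\<lambda>x. fun_of f x \<bullet> fun_of g x) summable_on UNIV"
proof -
  have "(\<lambda>x. norm (fun_of f x \<bullet> fun_of g x)) summable_on UNIV"
  proof (rule summable_on_comparison_test)
    show "(\<lambda>x. (cmod (fun_of f x))\<^sup>2 + (cmod (fun_of g x))\<^sup>2) summable_on UNIV"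
      by (intro summable_on_add fun_of_summable)
    show "norm (fun_of f x \<bullet> fun_of g x) \<le> (cmod (fun_of f x))\<^sup>2 + (cmod (fun_of g x))\<^sup>2" for x
      using Cauchy_Schwarz_ineq2[of "fun_of f x" "fun_of g x"]
        sum_squares_bound[of "cmod (fun_of f x)" "cmod (fun_of g x)"]
        zero_le_power2[of "cmod (fun_of f x)"] zero_le_power2[of "cmod (fun_of g x)"]
      unfolding real_norm_def by linarith
  qed auto
  then show ?thesis by (rule abs_summable_summable)
qed

instantiation ell2 :: (type) real_inner
begin

lift_definition zero_ell2 :: "'a ell2" is "\<lambda>_. 0" by simp
lift_definition plus_ell2 :: "'a ell2 \<Rightarrow> 'a ell2 \<Rightarrow> 'a ell2" is "\<lambda>f g x. f x + g x"
  by (rule square_summable_add)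
lift_definition uminus_ell2 :: "'a ell2 \<Rightarrow> 'a ell2" is "\<lambda>f x. - f x" by simp
lift_definition scaleR_ell2 :: "real \<Rightarrow> 'a ell2 \<Rightarrow> 'a ell2" is "\<lambda>r f x. complex_of_real r * f x"
  by (rule square_summable_mult)
definition "f - g = f + (- g)" for f g :: "'a ell2"
definition "inner f g = (\<Sum>\<^sub>\<infinity>x. fun_of f x \<bullet> fun_of g x)" for f g :: "'a ell2"
definition "norm f = sqrt (inner f f)" for f :: "'a ell2"
definition "dist f g = norm (f - g)" for f g :: "'a ell2"
definition "sgn f = inverse (norm f) *\<^sub>R f" for f :: "'a ell2"
definition "uniformity = (INF e\<in>{0<..}. principal {(f, g :: 'a ell2). dist f g < e})"
definition "open U = (\<forall>f\<in>U. \<forall>\<^sub>F (f', g) in uniformity. f' = f \<longrightarrow> g \<in> U)" for U :: "'a ell2 set"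

instance
proof
  fix f g h :: "'a ell2" and a b :: real and U :: "'a ell2 set"
  show "f + g + h = f + (g + h)" by transfer (simp add: add.assoc)
  show "f + g = g + f" by transfer (simp add: add.commute)
  show "0 + f = f" by transfer simp
  show "- f + f = 0" by transfer simp
  show "f - g = f + - g" by (simp add: minus_ell2_def)
  show "a *\<^sub>R (f + g) = a *\<^sub>R f + a *\<^sub>R g" by transfer (simp add: algebra_simps)
  show "(a + b) *\<^sub>R f = a *\<^sub>R f + b *\<^sub>R f" by transfer (simp add: algebra_simps)
  show "a *\<^sub>R b *\<^sub>R f = (a * b) *\<^sub>R f" by transfer (simp add: algebra_simps)
  show "1 *\<^sub>R f = f" by transfer simp
  show "inner f g = inner g f" by (simp add: inner_ell2_def inner_commute)
  show "inner (f + g) h = inner f h + inner g h"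
    by (simp add: inner_ell2_def plus_ell2.rep_eq inner_add_left infsum_add fun_of_summable_inner)
  show "inner (a *\<^sub>R f) g = a * inner f g"
    by (simp add: inner_ell2_def scaleR_ell2.rep_eq infsum_cmult_right'
        flip: scaleR_conv_of_real)
  show "0 \<le> inner f f" unfolding inner_ell2_def by (rule infsum_nonneg) simp
  show "inner f f = 0 \<longleftrightarrow> f = 0"
  proof
    assume "inner f f = 0"
    then have "fun_of f x \<bullet> fun_of f x = 0" for x
      unfolding inner_ell2_def
      by (intro nonneg_infsum_le_0D[where A=UNIV and f="\<lambda>x. fun_of f x \<bullet> fun_of f x"] fun_of_summable_inner) auto
    then show "f = 0" by (simp add: zero_ell2.rep_eq fun_of_inject[symmetric] fun_eq_iff)
  qed (simp add: inner_ell2_def zero_ell2.rep_eq)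
qed (simp_all add: norm_ell2_def dist_ell2_def sgn_ell2_def uniformity_ell2_def open_ell2_def)

end

lemmas fun_of_simps [simp] = zero_ell2.rep_eq plus_ell2.rep_eq uminus_ell2.rep_eq scaleR_ell2.rep_eq

lemma fun_of_minus [simp]: "fun_of (f - g) x = fun_of f x - fun_of g x"
  by (subst minus_ell2_def) (simp del: add_uminus_conv_diff)

lemma fun_of_sum [simp]: "fun_of (sum f A) x = (\<Sum>i\<in>A. fun_of (f i) x)"
  by (induction A rule: infinite_finite_induct) auto

lemma ell2_eqI: "(\<And>x. fun_of f x = fun_of g x) \<Longrightarrow> f = g"
  by (metis ext fun_of_inject)

lemma norm_ell2_sq: "(norm f)\<^sup>2 = (\<Sum>\<^sub>\<infinity>x. (cmod (fun_of f x))\<^sup>2)"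
  by (simp add: power2_norm_eq_inner inner_ell2_def)

lemma norm_fun_of_le: "cmod (fun_of f x) \<le> norm f"
proof -
  have "(cmod (fun_of f x))\<^sup>2 = (\<Sum>x\<in>{x}. (cmod (fun_of f x))\<^sup>2)" by simp
  also have "\<dots> \<le> (norm f)\<^sup>2" unfolding norm_ell2_sq
    by (rule finite_sum_le_infsum[OF fun_of_summable]) auto
  finally show ?thesis by (rule power2_le_imp_le) simp
qed

lemma bounded_linear_fun_of: "bounded_linear (\<lambda>f. fun_of f x)"
  by (rule bounded_linear_intro[where K=1]) (simp_all add: norm_fun_of_le scaleR_conv_of_real)

instance ell2 :: (type) complete_space
proof
  fix F :: "nat \<Rightarrow> 'a ell2"
  assume C: "Cauchy F"
  have "Cauchy (\<lambda>n. fun_of (F n) x)" for x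
    by (rule bounded_linear.Cauchy[OF bounded_linear_fun_of C])
  then have "\<exists>g. \<forall>x. (\<lambda>n. fun_of (F n) x) \<longlonglongrightarrow> g x"
    by (intro choice allI) (simp add: Cauchy_convergent_iff convergent_def)
  then obtain g where g: "\<And>x. (\<lambda>n. fun_of (F n) x) \<longlonglongrightarrow> g x" by blast
  \<comment> \<open>Bounds on finite partial sums pass to the pointwise limit in the second index;
    holding for all finite sets, they then bound the infinite sum.\<close>
  have fin: "\<exists>N. \<forall>n\<ge>N. \<forall>A. finite A \<longrightarrow> (\<Sum>x\<in>A. (cmod (fun_of (F n) x - g x))\<^sup>2) \<le> e\<^sup>2" if e: "e > 0" for e
  proof -
    obtain N where N: "\<And>n m. n \<ge> N \<Longrightarrow> m \<ge> N \<Longrightarrow> norm (F n - F m) < e"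
      using C e unfolding Cauchy_iff by blast
    show ?thesis
    proof (intro exI[of _ N] allI impI)
      fix n and A :: "'a set" assume n: "n \<ge> N" and A: "finite A"
      have "(\<lambda>m. \<Sum>x\<in>A. (cmod (fun_of (F n) x - fun_of (F m) x))\<^sup>2) \<longlonglongrightarrow> 
            (\<Sum>x\<in>A. (cmod (fun_of (F n) x - g x))\<^sup>2)"
        by (intro tendsto_intros g)
      moreover have "\<forall>\<^sub>F m in sequentially. (\<Sum>x\<in>A. (cmod (fun_of (F n) x - fun_of (F m) x))\<^sup>2) \<le> e\<^sup>2"
      proof (rule eventually_sequentiallyI[of N])
        fix m assume "m \<ge> N"
        have "(\<Sum>x\<in>A. (cmod (fun_of (F n) x - fun_of (F m) x))\<^sup>2) \<le> (norm (F n - F m))\<^sup>2"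
          unfolding norm_ell2_sq fun_of_minus[symmetric]
          by (rule finite_sum_le_infsum[OF fun_of_summable A]) auto
        also have "\<dots> \<le> e\<^sup>2" using N[OF n \<open>m \<ge> N\<close>] by (intro power_mono) auto
        finally show "(\<Sum>x\<in>A. (cmod (fun_of (F n) x - fun_of (F m) x))\<^sup>2) \<le> e\<^sup>2" .
      qed
      ultimately show "(\<Sum>x\<in>A. (cmod (fun_of (F n) x - g x))\<^sup>2) \<le> e\<^sup>2"
        by (rule tendsto_upperbound) simp
    qed
  qed
  have diff_summable: "(\<lambda>x. (cmod (h x))\<^sup>2) summable_on UNIV"
    if "\<And>A. finite A \<Longrightarrow> (\<Sum>x\<in>A. (cmod (h x))\<^sup>2) \<le> C" for h :: "'a \<Rightarrow> complex" and C
    using that by (intro nonneg_bdd_above_summable_on bdd_aboveI2[where M=C]) auto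
  obtain N where N: "\<And>n A. n \<ge> N \<Longrightarrow> finite A \<Longrightarrow> (\<Sum>x\<in>A. (cmod (fun_of (F n) x - g x))\<^sup>2) \<le> 1\<^sup>2"
    using fin[of 1] by auto
  have "(\<lambda>x. (cmod (g x))\<^sup>2) summable_on UNIV"
  proof -
    have "(\<lambda>x. (cmod (- 1 * (fun_of (F N) x - g x)))\<^sup>2) summable_on UNIV"
      by (intro square_summable_mult diff_summable[OF N]) auto
    from square_summable_add[OF this fun_of_summable[of "F N"]] show ?thesis by simp
  qed
  then have G: "fun_of (ell2_of g) = g" by (simp add: ell2_of_inverse)
  have "F \<longlonglongrightarrow> ell2_of g"
  proof (rule LIMSEQ_I)
    fix r :: real assume "r > 0"
    then obtain N where N: "\<And>n A. n \<ge> N \<Longrightarrow> finite A \<Longrightarrow> (\<Sum>x\<in>A. (cmod (fun_of (F n) x - g x))\<^sup>2) \<le> (r/2)\<^sup>2"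
      using fin[of "r/2"] by auto
    show "\<exists>no. \<forall>n\<ge>no. norm (F n - ell2_of g) < r"
    proof (intro exI allI impI)
      fix n assume "n \<ge> N"
      have "(norm (F n - ell2_of g))\<^sup>2 \<le> (r/2)\<^sup>2"
        unfolding norm_ell2_sq fun_of_minus G
        using fun_of_summable[of "F n - ell2_of g"]
        by (intro infsum_le_finite_sums N[OF \<open>n \<ge> N\<close>]) (simp_all add: G)
      then have "norm (F n - ell2_of g) \<le> r/2" 
        by (rule power2_le_imp_le) (use \<open>r > 0\<close> in simp)
      then show "norm (F n - ell2_of g) < r" using \<open>r > 0\<close> by simp
    qed
  qed
  then show "convergent F" by (auto simp: convergent_def)
qed

section \<open>Complex scalars and subspaces of given support\<close>

lift_definition csc :: "complex \<Rightarrow> 'a ell2 \<Rightarrow> 'a ell2" is "\<lambda>c f x. c * f x"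
  by (rule square_summable_mult)

declare csc.rep_eq [simp]

lemma csc_simps:
  "csc c (f + g) = csc c f + csc c g" "csc (c + d) f = csc c f + csc d f"
  "csc c (csc d f) = csc (c * d) f" "csc 1 f = f" "csc 0 f = 0" "csc c 0 = 0"
  "csc c (r *\<^sub>R f) = r *\<^sub>R csc c f" "csc (complex_of_real r) f = r *\<^sub>R f"
  "csc c (f - g) = csc c f - csc c g"
  by (rule ell2_eqI, simp add: algebra_simps)+

lemma norm_csc: "norm (csc c f) = cmod c * norm f"
proof -
  have "(norm (csc c f))\<^sup>2 = (cmod c * norm f)\<^sup>2"
    by (simp add: power_mult_distrib norm_ell2_sq norm_mult infsum_cmult_right')
  then show ?thesis by simp
qed

lemma csc_eq_0_iff: "csc c f = 0 \<longleftrightarrow> c = 0 \<or> f = 0"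
  using norm_csc[of c f] by (metis mult_eq_0_iff norm_eq_zero)

lemma csc_inner_cnj: "csc c f \<bullet> g = f \<bullet> csc (cnj c) g"
  by (simp add: inner_ell2_def inner_complex_def algebra_simps)

lemma csc_decomp: "csc c f = Re c *\<^sub>R f + Im c *\<^sub>R csc \<i> f"
  by (rule ell2_eqI) (simp add: complex_eq_iff)

lemma bounded_linear_csc: "bounded_linear (csc c)"
  by (rule bounded_linear_intro[where K="cmod c"]) (auto simp: csc_simps norm_csc)

definition supported :: "'a set \<Rightarrow> 'a ell2 set" where
  "supported X = {f. \<forall>x. x \<notin> X \<longrightarrow> fun_of f x = 0}"

lemma subspace_supported: "subspace (supported X)"
  by (auto simp: subspace_def supported_def)

lemma csc_supported: "f \<in> supported X \<Longrightarrow> csc c f \<in> supported X"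
  by (auto simp: supported_def)

lemma closed_supported: "closed (supported X)"
proof -
  have "supported X = (\<Inter>x\<in>-X. (\<lambda>f. fun_of f x) -` {0})" by (auto simp: supported_def)
  also have "closed \<dots>"
    by (intro closed_INT ballI continuous_closed_vimage closed_singleton
        linear_continuous_at[OF bounded_linear_fun_of])
  finally show ?thesis .
qed

lemma summable_on_UNIV_if_supported:
  assumes "\<And>x. x \<notin> X \<Longrightarrow> f x = (0::complex)"
  shows "(\<lambda>x. (cmod (f x))\<^sup>2) summable_on X \<longleftrightarrow> (\<lambda>x. (cmod (f x))\<^sup>2) summable_on UNIV"
  using assms by (intro summable_on_cong_neutral) auto

lemma l2_iff: "f \<in> l2 X \<longleftrightarrow> (\<exists>g\<in>supported X. f = fun_of g)"
proof
  assume f: "f \<in> l2 X"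
  then have "fun_of (ell2_of f) = f"
    using summable_on_UNIV_if_supported[of X f] by (auto simp: l2_def ell2_of_inverse)
  then show "\<exists>g\<in>supported X. f = fun_of g"
    using f by (intro bexI[of _ "ell2_of f"]) (auto simp: supported_def l2_def)
next
  assume "\<exists>g\<in>supported X. f = fun_of g"
  then show "f \<in> l2 X"
    using summable_on_UNIV_if_supported[of X f] fun_of_summable by (auto simp: l2_def supported_def)
qed

lemma l2norm_fun_of: "f \<in> supported X \<Longrightarrow> l2norm X (fun_of f) = norm f"
proof -
  assume f: "f \<in> supported X"
  have "infsum (\<lambda>x. (cmod (fun_of f x))\<^sup>2) X = (norm f)\<^sup>2"
    unfolding norm_ell2_sq using f by (intro infsum_cong_neutral) (auto simp: supported_def)
  then show ?thesis by (simp add: l2norm_def)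
qed

section \<open>Min-max principle below the essential spectrum\<close>

text \<open>Gaussian elimination: an equation with a nonzero pivot determines the pivot unknown, and
  the other unknowns solve the reduced system. It supplies the dimension counts below: some
  nontrivial combination of \<open>j\<close> vectors satisfies fewer than \<open>j\<close> linear
  conditions.\<close>

lemma homogeneous_system_nontrivial_solution:
  fixes a :: "'i \<Rightarrow> 'j \<Rightarrow> 'k::field"
  assumes "finite K" "finite J" "card K < card J"
  obtains c where "\<exists>l\<in>J. c l \<noteq> 0" "\<And>i. i \<in> K \<Longrightarrow> (\<Sum>l\<in>J. a i l * c l) = 0"
proof -
  have "\<exists>c. (\<exists>l\<in>J. c l \<noteq> 0) \<and> (\<forall>i\<in>K. (\<Sum>l\<in>J. a i l * c l) = 0)"
    using assms
  proof (induction K arbitrary: J a rule: finite_induct)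
    case empty
    then have "J \<noteq> {}" by auto
    then show ?case by (intro exI[of _ "\<lambda>_. 1"]) auto
  next
    case (insert r K)
    show ?case
    proof (cases "\<forall>l\<in>J. a r l = 0")
      case True
      then show ?thesis using insert.IH[of J a] insert.prems insert.hyps by auto
    next
      case False
      then obtain m where m: "m \<in> J" "a r m \<noteq> 0" by blast
      have "finite (J - {m})" "card K < card (J - {m})"
        using insert.prems insert.hyps m by (simp_all add: card_Diff_singleton)
      from insert.IH[OF this, of "\<lambda>i l. a i l - a i m * a r l / a r m"]
      obtain c where c: "\<exists>l\<in>J - {m}. c l \<noteq> 0"
        "\<forall>i\<in>K. (\<Sum>l\<in>J - {m}. (a i l - a i m * a r l / a r m) * c l) = 0" by blast
      define s where "s = (\<Sum>l\<in>J - {m}. a r l * c l)"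
      define c' where "c' = c(m := - s / a r m)"
      have split: "(\<Sum>l\<in>J. a i l * c' l) = (\<Sum>l\<in>J - {m}. a i l * c l) - a i m * s / a r m" for i
      proof -
        have "(\<Sum>l\<in>J. a i l * c' l) = a i m * c' m + (\<Sum>l\<in>J - {m}. a i l * c' l)"
          using insert.prems m by (simp add: sum.remove)
        also have "(\<Sum>l\<in>J - {m}. a i l * c' l) = (\<Sum>l\<in>J - {m}. a i l * c l)"
          by (intro sum.cong) (auto simp: c'_def)
        finally show ?thesis by (simp add: c'_def)
      qed
      have "(\<Sum>l\<in>J. a i l * c' l) = 0" if "i \<in> K" for i
      proof -
        have "0 = (\<Sum>l\<in>J - {m}. (a i l - a i m * a r l / a r m) * c l)" using c that by simp
        also have "\<dots> = (\<Sum>l\<in>J - {m}. a i l * c l) - a i m / a r m * s"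
          unfolding s_def sum_distrib_left sum_subtractf[symmetric] by (intro sum.cong) (auto simp: algebra_simps)
        finally show ?thesis unfolding split by simp
      qed
      moreover have "(\<Sum>l\<in>J. a r l * c' l) = 0" unfolding split using m by (simp add: s_def)
      moreover have "\<exists>l\<in>J. c' l \<noteq> 0" using c(1) by (auto simp: c'_def)
      ultimately show ?thesis by blast
    qed
  qed
  then show ?thesis using that by blast
qed

text \<open>The counting functions are suprema in \<open>enat\<close>, possibly infinite. Families
  can be shortened, so reaching \<open>n\<close> in the supremum means having a family of length
  \<open>n\<close>. If \<open>P 0\<close> failed, the equivalence would break at
  \<open>n = 0\<close>.\<close>

lemma enat_le_Sup_iff:
  assumes down: "\<And>m n. P m \<Longrightarrow> n \<le> m \<Longrightarrow> P n" and "P 0"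
  shows "enat n \<le> Sup {enat m | m. P m} \<longleftrightarrow> P n"
proof
  assume le: "enat n \<le> Sup {enat m | m. P m}"
  show "P n"
  proof (rule ccontr)
    assume "\<not> P n"
    then have n: "n > 0" using \<open>P 0\<close> by (cases n) auto
    have "m \<le> n - 1" if "P m" for m
      using down[OF that, of n] \<open>\<not> P n\<close> by (cases "n \<le> m") auto
    then have "Sup {enat m | m. P m} \<le> enat (n - 1)" by (intro Sup_least) auto
    with le have "enat n \<le> enat (n - 1)" by (rule order_trans)
    then show False using n by simp
  qed
qed (auto intro: Sup_upper)

text \<open>The Hermitian product, linear in the first argument, recovered from its real part: its
  imaginary part is the real product with \<open>\<i> g\<close>. Orthogonality to complex spans is
  expressed by it.\<close>

definition cinner :: "'a ell2 \<Rightarrow> 'a ell2 \<Rightarrow> complex" where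
  "cinner f g = Complex (f \<bullet> g) (f \<bullet> csc \<i> g)"

lemma cinner_add: "cinner (f + f') g = cinner f g + cinner f' g"
  by (simp add: cinner_def complex_eq_iff inner_add_left)

lemma cinner_csc: "cinner (csc c f) g = c * cinner f g"
proof -
  have 1: "csc \<i> f \<bullet> g = - (f \<bullet> csc \<i> g)"
    using csc_inner_cnj[of \<i> f g] csc_decomp[of "-\<i>" g] by (simp add: inner_minus_right)
  have 2: "csc \<i> f \<bullet> csc \<i> g = f \<bullet> g"
    using csc_inner_cnj[of \<i> f "csc \<i> g"] by (simp add: csc_simps)
  show ?thesis
    by (subst csc_decomp) (simp add: cinner_def complex_eq_iff inner_add_left 1 2)
qed

lemma cinner_sum: "cinner (sum f A) g = (\<Sum>i\<in>A. cinner (f i) g)"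
  by (induction A rule: infinite_finite_induct) (auto simp: cinner_add, simp_all add: cinner_def complex_eq_iff)

lemma inner_csc_i_self: "f \<bullet> csc \<i> f = 0"
proof -
  have "csc \<i> f \<bullet> f = - (f \<bullet> csc \<i> f)"
    using csc_inner_cnj[of \<i> f f] csc_decomp[of "-\<i>" f] by (simp add: inner_minus_right)
  then show ?thesis by (simp add: inner_commute)
qed

lemma cinner_self: "cinner f f = complex_of_real ((norm f)\<^sup>2)"
  by (simp add: cinner_def inner_csc_i_self complex_eq_iff power2_norm_eq_inner)

text \<open>\<open>T\<close> acts on all of \<open>ell2\<close> but represents \<open>A\<close> only
  on \<open>supported X\<close>. Lower bounds are therefore restricted to \<open>S\<close>;
  otherwise functions carried outside \<open>X\<close> could add spurious points to the
  spectrum.\<close>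

locale l2_operator = symmetric_operator_hilbert T
  for T :: "pt ell2 \<Rightarrow> pt ell2" +
  fixes X :: "pt set" and A :: op
  assumes T_csc: "T (csc c f) = csc c (T f)"
    and T_supported: "T f \<in> supported X"
    and A_eq: "f \<in> supported X \<Longrightarrow> A (fun_of f) = fun_of (T f)"
begin

abbreviation S where "S \<equiv> supported X"

lemma T_S: "T ` S \<subseteq> S" using T_supported by auto

text \<open>Surjectivity is the point. For nonreal \<open>z\<close> the operator
  \<open>T - z\<close> is not symmetric, so one solves \<open>(T - cnj z) (T - z) u = g\<close>,
  whose form \<open>norm ((T - z) u)^2\<close> is coercive. The two factors commute, hence
  \<open>(T - cnj z) u\<close> is the preimage of \<open>g\<close>.\<close>

lemma in_resolvent_iff:
  "in_resolvent X A z \<longleftrightarrow> bounded_below_on S (\<lambda>f. T f - csc z f)"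
proof -
  have mem: "T f - csc z f \<in> S" if "f \<in> S" for f z
    using that T_supported by (auto intro: subspace_diff subspace_supported csc_supported)
  have fun_of_Tz: "fun_of (T f - csc z f) = (\<lambda>x. A (fun_of f) x - z * fun_of f x)" if "f \<in> S" for f z
    using A_eq[OF that] by auto
  show ?thesis
  proof
    assume "in_resolvent X A z"
    then obtain B C where B: "\<And>f. f \<in> l2 X \<Longrightarrow> B (\<lambda>x. A f x - z * f x) = f"
      "\<And>g. g \<in> l2 X \<Longrightarrow> l2norm X (B g) \<le> C * l2norm X g"
      unfolding in_resolvent_def by blast
    show "bounded_below_on S (\<lambda>f. T f - csc z f)"
      unfolding bounded_below_on_def
    \<comment> \<open>\<open>C\<close> comes without a sign and is enlarged to a positive
      constant.\<close>
    proof (intro exI[of _ "inverse (max C 1)"] conjI ballI)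
      show "0 < inverse (max C 1)" by simp
      fix f assume f: "f \<in> S"
      have "norm f = l2norm X (B (fun_of (T f - csc z f)))"
        using B(1)[of "fun_of f"] f l2norm_fun_of[OF f] unfolding fun_of_Tz[OF f]
        by (metis l2_iff)
      also have "\<dots> \<le> C * norm (T f - csc z f)"
        using B(2)[of "fun_of (T f - csc z f)"] mem[OF f] l2norm_fun_of[OF mem[OF f]]
        by (auto simp: l2_iff)
      also have "\<dots> \<le> max C 1 * norm (T f - csc z f)" by (intro mult_right_mono) auto
      finally show "inverse (max C 1) * norm f \<le> norm (T f - csc z f)"
        by (simp add: field_simps)
    qed
  next
    assume "bounded_below_on S (\<lambda>f. T f - csc z f)"
    then obtain \<delta> where \<delta>: "\<delta> > 0" "\<And>f. f \<in> S \<Longrightarrow> \<delta> * norm f \<le> norm (T f - csc z f)"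
      unfolding bounded_below_on_def by blast
    let ?Tz = "\<lambda>f. T f - csc z f" and ?Tc = "\<lambda>f. T f - csc (cnj z) f"
    have bl': "bounded_linear (\<lambda>f. T f - csc w f)" for w
      by (intro bounded_linear_sub bl bounded_linear_csc)
    have adj: "?Tc f \<bullet> g = f \<bullet> ?Tz g" for f g
      by (simp add: inner_diff_left inner_diff_right sym csc_inner_cnj)
    have "?Tc (?Tz f) \<bullet> g = f \<bullet> ?Tc (?Tz g)" for f g
      by (subst inner_commute[of f]) (subst adj, subst adj, rule inner_commute)
    then interpret U: symmetric_operator_hilbert "\<lambda>f. ?Tc (?Tz f)"
      by (intro symmetric_operator_hilbert.intro symmetric_operator.intro
          bounded_linear_compose[OF bl' bl'])
    have comm: "?Tc (?Tz f) = ?Tz (?Tc f)" for f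
      by (simp add: diff T_csc csc_simps algebra_simps)
    have ex: "\<exists>f\<in>S. ?Tz f = g" if g: "g \<in> S" for g
    proof -
      have coer: "\<delta>\<^sup>2 * (f \<bullet> f) \<le> ?Tc (?Tz f) \<bullet> f" if "f \<in> S" for f
      proof -
        have "(\<delta> * norm f)\<^sup>2 \<le> (norm (?Tz f))\<^sup>2"
          using \<delta> that by (intro power_mono) auto
        then show ?thesis by (simp add: adj power_mult_distrib power2_norm_eq_inner)
      qed
      obtain u where u: "u \<in> S" "?Tc (?Tz u) = g"
        by (rule U.coercive_surj[OF _ subspace_supported closed_supported _ coer g])
          (use \<delta>(1) mem in auto)
      then show ?thesis using comm[of u] mem[of u "cnj z"] by auto
    qed
    have inj: "f = g" if "f \<in> S" "g \<in> S" "?Tz f = ?Tz g" for f g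
    proof -
      have "\<delta> * norm (f - g) \<le> norm (?Tz (f - g))"
        using \<delta> that by (auto intro: subspace_diff subspace_supported)
      also have "?Tz (f - g) = 0" using that(3) by (simp add: diff csc_simps algebra_simps)
      finally show ?thesis using \<delta> by (simp add: mult_le_0_iff)
    qed
    define R where "R g = (SOME f. f \<in> S \<and> ?Tz f = g)" for g
    have R: "R g \<in> S" "?Tz (R g) = g" if "g \<in> S" for g
      using someI_ex[of "\<lambda>f. f \<in> S \<and> ?Tz f = g"] ex[OF that] unfolding R_def by blast+
    have RT: "R (?Tz f) = f" if "f \<in> S" for f
      using inj[of "R (?Tz f)" f] R[OF mem[OF that]] that by blast
    show "in_resolvent X A z"
      unfolding in_resolvent_def
    proof (intro exI[of _ "\<lambda>g. fun_of (R (ell2_of g))"] conjI ballI exI[of _ "inverse \<delta>"])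
      fix f assume "f \<in> l2 X"
      then obtain f' where f': "f' \<in> S" "f = fun_of f'" by (auto simp: l2_iff)
      show "(\<lambda>x. A f x - z * f x) \<in> l2 X"
        using mem[OF f'(1)] unfolding f'(2) fun_of_Tz[OF f'(1), symmetric] by (auto simp: l2_iff)
      show "fun_of (R (ell2_of (\<lambda>x. A f x - z * f x))) = f"
        unfolding f'(2) fun_of_Tz[OF f'(1), symmetric] fun_of_inverse RT[OF f'(1)] ..
    next
      fix g assume "g \<in> l2 X"
      then obtain g' where g': "g' \<in> S" "g = fun_of g'" by (auto simp: l2_iff)
      show "fun_of (R (ell2_of g)) \<in> l2 X"
        unfolding g'(2) fun_of_inverse using R(1)[OF g'(1)] by (auto simp: l2_iff)
      show "(\<lambda>x. A (fun_of (R (ell2_of g))) x - z * fun_of (R (ell2_of g)) x) = g"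
        unfolding g'(2) fun_of_inverse fun_of_Tz[OF R(1)[OF g'(1)], symmetric] R(2)[OF g'(1)] ..
      show "l2norm X (fun_of (R (ell2_of g))) \<le> inverse \<delta> * l2norm X g"
        unfolding g'(2) fun_of_inverse l2norm_fun_of[OF g'(1)] l2norm_fun_of[OF R(1)[OF g'(1)]]
        using \<delta>(2)[OF R(1)[OF g'(1)]] R(2)[OF g'(1)] \<delta>(1) by (simp add: field_simps)
    qed
  qed
qed

definition sp :: "real set" where
  "sp = {x. \<not> bounded_below_on S (\<lambda>f. T f - x *\<^sub>R f)}"

lemma of_real_spectrum_iff: "complex_of_real x \<in> spectrum X A \<longleftrightarrow> x \<in> sp"
  by (simp add: spectrum_def in_resolvent_iff sp_def csc_simps)

text \<open>\<open>(T - Re z) f\<close> is orthogonal to \<open>\<i> f\<close> in the real product,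
  because the form of a complex-linear symmetric operator is real. By Pythagoras the residual at
  \<open>z\<close> is at least \<open>\<bar>Im z\<bar> * norm f\<close>.\<close>

lemma spectrum_real:
  assumes "z \<in> spectrum X A"
  shows "z = complex_of_real (Re z)"
proof (rule ccontr)
  assume neq: "z \<noteq> complex_of_real (Re z)"
  then have im: "Im z \<noteq> 0" by (auto simp: complex_eq_iff)
  have "\<bar>Im z\<bar> * norm f \<le> norm (T f - csc z f)" for f
  proof -
    let ?a = "T f - Re z *\<^sub>R f" and ?b = "Im z *\<^sub>R csc \<i> f"
    interpret R: symmetric_operator "\<lambda>f. T f - Re z *\<^sub>R f" by (rule shift)
    have "?a \<bullet> csc \<i> f = f \<bullet> csc \<i> ?a"
      by (simp add: R.sym T_csc csc_simps)
    also have "\<dots> = - (csc \<i> f \<bullet> ?a)"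
      using csc_inner_cnj[of \<i> f ?a] csc_decomp[of "-\<i>" ?a] by (simp add: inner_minus_right)
    finally have orth: "?a \<bullet> csc \<i> f = 0" by (simp add: inner_commute)
    have "T f - csc z f = ?a - ?b" using csc_decomp[of z f] by simp
    moreover have "?a \<bullet> ?b = 0" using orth by simp
    ultimately have "(norm (T f - csc z f))\<^sup>2 = (norm ?a)\<^sup>2 + (norm ?b)\<^sup>2"
      by (simp only: power2_norm_eq_inner inner_diff_left[of ?a] inner_diff_right[of _ ?a]
          inner_commute[of ?b ?a])
    then have "(\<bar>Im z\<bar> * norm f)\<^sup>2 \<le> (norm (T f - csc z f))\<^sup>2"
      by (simp add: norm_csc power_mult_distrib)
    then show ?thesis by (rule power2_le_imp_le) simp
  qed
  then have "in_resolvent X A z"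
    unfolding in_resolvent_iff bounded_below_on_def using im by (intro exI[of _ "\<bar>Im z\<bar>"]) auto
  then show False using assms by (simp add: spectrum_def)
qed

lemma abs_sp_le_onorm:
  assumes x: "x \<in> sp"
  shows "\<bar>x\<bar> \<le> onorm T"
proof (rule ccontr)
  assume "\<not> \<bar>x\<bar> \<le> onorm T"
  moreover have "(\<bar>x\<bar> - onorm T) * norm f \<le> norm (T f - x *\<^sub>R f)" for f
    using norm_triangle_ineq2[of "x *\<^sub>R f" "T f"] onorm[OF bl, of f]
    by (simp add: norm_minus_commute algebra_simps)
  ultimately show False
    using x unfolding sp_def bounded_below_on_def by (auto dest!: spec[of _ "\<bar>x\<bar> - onorm T"])
qed

lemma closed_sp: "closed sp"
  unfolding closed_def open_dist
proof safe
  fix x assume "x \<notin> sp"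
  then obtain \<delta> where \<delta>: "\<delta> > 0" "\<And>f. f \<in> S \<Longrightarrow> \<delta> * norm f \<le> norm (T f - x *\<^sub>R f)"
    unfolding sp_def bounded_below_on_def by auto
  show "\<exists>e>0. \<forall>y. dist y x < e \<longrightarrow> y \<in> - sp"
  proof (intro exI[of _ \<delta>] conjI allI impI)
    fix y assume y: "dist y x < \<delta>"
    have "(\<delta> - \<bar>y - x\<bar>) * norm f \<le> norm (T f - y *\<^sub>R f)" if "f \<in> S" for f
    proof -
      have "norm (T f - x *\<^sub>R f) - norm ((y - x) *\<^sub>R f) \<le> norm ((T f - x *\<^sub>R f) - (y - x) *\<^sub>R f)"
        by (rule norm_triangle_ineq2)
      also have "(T f - x *\<^sub>R f) - (y - x) *\<^sub>R f = T f - y *\<^sub>R f" by (simp add: algebra_simps)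
      finally show ?thesis using \<delta>(2)[OF that] by (simp add: left_diff_distrib)
    qed
    then have "bounded_below_on S (\<lambda>f. T f - y *\<^sub>R f)"
      using y unfolding bounded_below_on_def dist_real_def by (intro exI[of _ "\<delta> - \<bar>y - x\<bar>"]) auto
    then show "y \<in> - sp" by (simp add: sp_def)
  qed (use \<delta> in auto)
qed

text \<open>The common form of \<open>mult\<close>, \<open>count_below\<close>,
  \<open>count_fin\<close> and \<open>num_fin\<close>. Eigenvalues may repeat while the vectors are
  independent over the complex numbers, so multiplicities are counted.\<close>

definition eigenfamily :: "(real \<Rightarrow> bool) \<Rightarrow> nat \<Rightarrow> bool" where
  "eigenfamily R n \<longleftrightarrow> (\<exists>g l. (\<forall>i<n. g i \<in> S \<and> T (g i) = l i *\<^sub>R g i \<and> R (l i)) \<and>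
     (\<forall>c. (\<Sum>i<n. csc (c i) (g i)) = 0 \<longrightarrow> (\<forall>i<n. c i = 0)))"

lemma eigenfamily_antimono: "eigenfamily R m \<Longrightarrow> n \<le> m \<Longrightarrow> eigenfamily R n"
proof -
  assume "eigenfamily R m" and nm: "n \<le> m"
  then obtain g l where g: "\<forall>i<m. g i \<in> S \<and> T (g i) = l i *\<^sub>R g i \<and> R (l i)"
    and ind: "\<And>c. (\<Sum>i<m. csc (c i) (g i)) = 0 \<Longrightarrow> \<forall>i<m. c i = 0"
    unfolding eigenfamily_def by blast
  have "\<forall>i<n. c i = 0" if c: "(\<Sum>i<n. csc (c i) (g i)) = 0" for c
  proof -
    define c' where "c' i = (if i < n then c i else 0)" for i
    have "(\<Sum>i<m. csc (c' i) (g i)) = (\<Sum>i<n. csc (c i) (g i))"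
      using nm by (intro sum.mono_neutral_cong_right) (auto simp: c'_def csc_simps)
    then have "\<forall>i<m. c' i = 0" using ind[of c'] c by simp
    then show ?thesis using nm by (metis c'_def less_le_trans)
  qed
  then show "eigenfamily R n"
    unfolding eigenfamily_def using g nm by (intro exI[of _ g] exI[of _ l]) auto
qed

lemma eigenfamily_0: "eigenfamily R 0"
  by (simp add: eigenfamily_def)

lemma eigenfamily_mono:
  assumes "eigenfamily R n" "\<And>x. R x \<Longrightarrow> R' x"
  shows "eigenfamily R' n"
proof -
  obtain g l where "\<forall>i<n. g i \<in> S \<and> T (g i) = l i *\<^sub>R g i \<and> R (l i)"
    "\<forall>c. (\<Sum>i<n. csc (c i) (g i)) = 0 \<longrightarrow> (\<forall>i<n. c i = 0)"
    using assms(1) unfolding eigenfamily_def by blast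
  then show ?thesis unfolding eigenfamily_def
    using assms(2) by (intro exI[of _ g] exI[of _ l]) auto
qed

lemma ex_eigenlists_iff:
  "(\<exists>fs ls. length fs = n \<and> length ls = n \<and> lin_indep fs \<and>
      (\<forall>i<n. fs ! i \<in> l2 X \<and> A (fs ! i) = (\<lambda>x. complex_of_real (ls ! i) * (fs ! i) x) \<and> R (ls ! i)))
    \<longleftrightarrow> eigenfamily R n" (is "?L \<longleftrightarrow> ?R")
proof
  assume ?L
  then obtain fs ls where fs: "length fs = n" "length ls = n" "lin_indep fs"
    "\<And>i. i < n \<Longrightarrow> fs ! i \<in> l2 X"
    "\<And>i. i < n \<Longrightarrow> A (fs ! i) = (\<lambda>x. complex_of_real (ls ! i) * (fs ! i) x)"
    "\<And>i. i < n \<Longrightarrow> R (ls ! i)" by blast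
  define g where "g i = ell2_of (fs ! i)" for i
  have g: "g i \<in> S" "fun_of (g i) = fs ! i" if "i < n" for i
    using fs(4)[OF that] by (auto simp: l2_iff g_def fun_of_inverse)
  show ?R unfolding eigenfamily_def
  proof (intro exI[of _ g] exI[of _ "\<lambda>i. ls ! i"] conjI allI impI)
    fix i assume i: "i < n"
    show "g i \<in> S" using g i by blast
    show "R (ls ! i)" using fs i by blast
    show "T (g i) = (ls ! i) *\<^sub>R g i"
    proof (rule ell2_eqI)
      fix x
      have "fun_of (T (g i)) x = A (fs ! i) x" using A_eq[OF g(1)[OF i]] g(2)[OF i] by simp
      then show "fun_of (T (g i)) x = fun_of ((ls ! i) *\<^sub>R g i) x"
        by (simp add: fs(5)[OF i] g(2)[OF i])
    qed
  next
    fix c i assume c: "(\<Sum>i<n. csc (c i) (g i)) = 0" and i: "i < n"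
    have "(\<Sum>i<length fs. c i * (fs ! i) x) = 0" for x
    proof -
      have "(\<Sum>i<n. c i * (fs ! i) x) = fun_of (\<Sum>i<n. csc (c i) (g i)) x" by (simp add: g(2))
      then show ?thesis using c fs(1) by simp
    qed
    then show "c i = 0" using fs(1,3) i unfolding lin_indep_def by blast
  qed
next
  assume ?R
  then obtain g l where g: "\<forall>i<n. g i \<in> S \<and> T (g i) = l i *\<^sub>R g i \<and> R (l i)"
    and ind: "\<And>c. (\<Sum>i<n. csc (c i) (g i)) = 0 \<Longrightarrow> \<forall>i<n. c i = 0"
    unfolding eigenfamily_def by blast
  show ?L
  proof (intro exI[of _ "map (\<lambda>i. fun_of (g i)) [0..<n]"] exI[of _ "map l [0..<n]"] conjI allI impI)
    show "lin_indep (map (\<lambda>i. fun_of (g i)) [0..<n])"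
      unfolding lin_indep_def
    proof (intro allI impI)
      fix c :: "nat \<Rightarrow> complex" and i
      assume c: "\<forall>x. (\<Sum>i<length (map (\<lambda>i. fun_of (g i)) [0..<n]). c i * (map (\<lambda>i. fun_of (g i)) [0..<n] ! i) x) = 0"
        and i: "i < length (map (\<lambda>i. fun_of (g i)) [0..<n])"
      have "(\<Sum>i<n. csc (c i) (g i)) = 0" by (rule ell2_eqI) (use c in simp)
      then show "c i = 0" using ind[of c] i by simp
    qed
    fix i assume i: "i < n"
    show "A (map (\<lambda>i. fun_of (g i)) [0..<n] ! i) =
         (\<lambda>x. complex_of_real (map l [0..<n] ! i) * (map (\<lambda>i. fun_of (g i)) [0..<n] ! i) x)"
      using g i A_eq[of "g i"] by auto
  qed (use g in \<open>auto simp: l2_iff\<close>)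
qed

lemma count_below_iff: "enat j \<le> count_below X A t \<longleftrightarrow> eigenfamily (\<lambda>l. l \<le> t) j"
  unfolding count_below_def ex_eigenlists_iff[where R="\<lambda>l. l \<le> t"]
  by (rule enat_le_Sup_iff) (auto intro: eigenfamily_antimono eigenfamily_0)

lemma count_fin_iff:
  "enat j \<le> count_fin X A t \<longleftrightarrow> eigenfamily (\<lambda>l. mult X A (complex_of_real l) < \<infinity> \<and> l \<le> t) j"
  unfolding count_fin_def ex_eigenlists_iff[where R="\<lambda>l. mult X A (complex_of_real l) < \<infinity> \<and> l \<le> t"]
  by (rule enat_le_Sup_iff) (auto intro: eigenfamily_antimono eigenfamily_0)

lemma num_fin_iff:
  "enat j \<le> num_fin X A \<longleftrightarrow> eigenfamily (\<lambda>l. mult X A (complex_of_real l) < \<infinity>) j"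
  unfolding num_fin_def ex_eigenlists_iff[where R="\<lambda>l. mult X A (complex_of_real l) < \<infinity>"]
  by (rule enat_le_Sup_iff) (auto intro: eigenfamily_antimono eigenfamily_0)

lemma mult_iff: "enat j \<le> mult X A (complex_of_real z) \<longleftrightarrow> eigenfamily (\<lambda>l. l = z) j"
proof -
  have "(\<exists>fs. length fs = n \<and> lin_indep fs \<and> (\<forall>f\<in>set fs. f \<in> l2 X \<and> A f = (\<lambda>x. complex_of_real z * f x)))
    \<longleftrightarrow> eigenfamily (\<lambda>l. l = z) n" for n
    unfolding ex_eigenlists_iff[symmetric]
  proof safe
    fix fs assume "lin_indep fs" "\<forall>f\<in>set fs. f \<in> l2 X \<and> A f = (\<lambda>x. complex_of_real z * f x)"
    then show "\<exists>fs' ls. length fs' = length fs \<and> length ls = length fs \<and> lin_indep fs' \<and>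
      (\<forall>i<length fs. fs' ! i \<in> l2 X \<and> A (fs' ! i) = (\<lambda>x. complex_of_real (ls ! i) * (fs' ! i) x) \<and> ls ! i = z)"
      by (intro exI[of _ fs] exI[of _ "replicate (length fs) z"]) auto
  next
    fix fs ls assume "n = length fs" "lin_indep fs" 
      "\<forall>i<length fs. fs ! i \<in> l2 X \<and> A (fs ! i) = (\<lambda>x. complex_of_real (ls ! i) * (fs ! i) x) \<and> ls ! i = z"
    then show "\<exists>fs'. length fs' = length fs \<and> lin_indep fs' \<and> (\<forall>f\<in>set fs'. f \<in> l2 X \<and> A f = (\<lambda>x. complex_of_real z * f x))"
      by (intro exI[of _ fs]) (auto simp: in_set_conv_nth)
  qed
  then show ?thesis unfolding mult_def
    by (simp only:) (rule enat_le_Sup_iff, auto intro: eigenfamily_antimono eigenfamily_0)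
qed


text \<open>Strict negativity for nonzero coefficient vectors already contains the linear independence
  of the family.\<close>

definition negdim :: "real \<Rightarrow> nat \<Rightarrow> bool" where
  "negdim s j \<longleftrightarrow> (\<exists>g. (\<forall>i<j. g i \<in> S) \<and>
     (\<forall>c. (\<exists>i<j. c i \<noteq> 0) \<longrightarrow>
       T (\<Sum>i<j. csc (c i) (g i)) \<bullet> (\<Sum>i<j. csc (c i) (g i)) <
       s * ((\<Sum>i<j. csc (c i) (g i)) \<bullet> (\<Sum>i<j. csc (c i) (g i)))))"

section \<open>Spaces on which the form lies below a given level\<close>

lemma eigenvectors_orthogonal:
  assumes "T f = x *\<^sub>R f" "T g = y *\<^sub>R g" "x \<noteq> y"
  shows "f \<bullet> g = 0"
proof -
  have "x * (f \<bullet> g) = y * (f \<bullet> g)" using sym[of f g] assms by simp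
  then show ?thesis using assms(3) by simp
qed

text \<open>Vectors with the same eigenvalue need not be orthogonal, so a combination is grouped by
  eigenvalue into parts \<open>u x\<close>. These are mutually orthogonal, and the form is the sum
  of their squared norms weighted by the eigenvalues. The eigenvalues may have any position relative
  to the essential spectrum.\<close>

lemma eigenfamily_negdim:
  assumes "eigenfamily (\<lambda>l. l \<le> t) j" "t < s"
  shows "negdim s j"
proof -
  obtain g l where g: "\<And>i. i < j \<Longrightarrow> g i \<in> S" "\<And>i. i < j \<Longrightarrow> T (g i) = l i *\<^sub>R g i" "\<And>i. i < j \<Longrightarrow> l i \<le> t"
    and ind: "\<And>c. (\<Sum>i<j. csc (c i) (g i)) = 0 \<Longrightarrow> \<forall>i<j. c i = 0"
    using assms(1) unfolding eigenfamily_def by blast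
  have "T f \<bullet> f < s * (f \<bullet> f)" if c: "\<exists>i<j. c i \<noteq> 0" and f: "f = (\<Sum>i<j. csc (c i) (g i))" for c f
  proof -
    define u where "u x = (\<Sum>i\<in>{i\<in>{..<j}. l i = x}. csc (c i) (g i))" for x
    let ?L = "l ` {..<j}"
    have fu: "f = (\<Sum>x\<in>?L. u x)" unfolding f u_def by (rule sum.image_gen) simp
    have Tu: "T (u x) = x *\<^sub>R u x" for x
      unfolding u_def sum scaleR_sum_right by (intro sum.cong) (auto simp: T_csc g csc_simps)
    have orth: "u x \<bullet> u y = 0" if "x \<noteq> y" for x y
      using eigenvectors_orthogonal[OF Tu Tu that] .
    have diag: "(\<Sum>y\<in>?L. u x \<bullet> u y) = u x \<bullet> u x" if "x \<in> ?L" for x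
    proof -
      have "(\<Sum>y\<in>?L. u x \<bullet> u y) = (\<Sum>y\<in>{x}. u x \<bullet> u y)"
        using that orth by (intro sum.mono_neutral_right) auto
      then show ?thesis by simp
    qed
    have "T f \<bullet> f = (\<Sum>x\<in>?L. x * (\<Sum>y\<in>?L. u x \<bullet> u y))"
      unfolding fu sum inner_sum_left inner_sum_right Tu sum_distrib_left inner_scaleR_left
      by (rule sum.swap)
    also have "\<dots> = (\<Sum>x\<in>?L. x * (u x \<bullet> u x))" by (intro sum.cong) (auto simp: diag)
    also have "\<dots> \<le> (\<Sum>x\<in>?L. t * (u x \<bullet> u x))"
      using g(3) by (intro sum_mono mult_right_mono) auto
    also have "\<dots> = t * (\<Sum>x\<in>?L. u x \<bullet> u x)" by (simp add: sum_distrib_left)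
    also have "\<dots> = t * (\<Sum>x\<in>?L. (\<Sum>y\<in>?L. u x \<bullet> u y))"
      by (intro arg_cong[where f="(*) t"] sum.cong) (auto simp: diag)
    also have "\<dots> = t * (f \<bullet> f)" unfolding fu inner_sum_left inner_sum_right
      by (subst sum.swap) (rule refl)
    also have "\<dots> < s * (f \<bullet> f)"
      using ind[of c] c assms(2) unfolding f by (intro mult_strict_right_mono) auto
    finally show ?thesis .
  qed
  then show ?thesis unfolding negdim_def using g(1) by blast
qed

text \<open>Approximate eigenvectors for different spectral points are almost orthogonal, so for a
  sufficiently good approximation they span a space of the full dimension.\<close>

lemma finite_sp_negdim:
  assumes Z: "finite Z" "Z \<subseteq> sp" "\<And>z. z \<in> Z \<Longrightarrow> z < s"
  shows "negdim s (card Z)"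
proof -
  define j where "j = card Z"
  obtain h where h: "bij_betw h {0..<j} Z"
    using ex_bij_betw_nat_finite[OF Z(1)] unfolding j_def by blast
  have hZ: "h i \<in> Z" if "i < j" for i using h that by (auto simp: bij_betw_def)
  have hinj: "h i \<noteq> h k" if "i < j" "k < j" "i \<noteq> k" for i k
    using h that by (auto simp: bij_betw_def inj_on_def)
  \<comment> \<open>The element 1 keeps \<open>Min\<close> meaningful when \<open>Z\<close> is
    empty, and for \<open>D\<close> below when no two points differ.\<close>
  have "\<exists>\<gamma>>0. \<forall>z\<in>Z. \<gamma> \<le> s - z"
  proof (intro exI[of _ "Min (insert 1 ((\<lambda>z. s - z) ` Z))"] conjI ballI)
    show "0 < Min (insert 1 ((\<lambda>z. s - z) ` Z))" using Z by (subst Min_gr_iff) auto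
    show "Min (insert 1 ((\<lambda>z. s - z) ` Z)) \<le> s - z" if "z \<in> Z" for z using Z(1) that by (intro Min_le) auto
  qed
  then obtain \<gamma> where \<gamma>: "\<gamma> > 0" "\<And>z. z \<in> Z \<Longrightarrow> \<gamma> \<le> s - z" by blast
  have "\<exists>D>0. \<forall>z\<in>Z. \<forall>w\<in>Z. z \<noteq> w \<longrightarrow> D \<le> \<bar>z - w\<bar>"
  proof (intro exI[of _ "Min (insert 1 ((\<lambda>(z,w). \<bar>z - w\<bar>) ` {(z,w)\<in>Z\<times>Z. z \<noteq> w}))"] conjI ballI impI)
    have fin: "finite (insert 1 ((\<lambda>(z,w). \<bar>z - w\<bar>) ` {(z,w)\<in>Z\<times>Z. z \<noteq> w}))"
      using Z(1) by (auto intro!: finite_imageI intro: finite_subset[of _ "Z \<times> Z"])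
    then show "0 < Min (insert 1 ((\<lambda>(z,w). \<bar>z - w\<bar>) ` {(z,w)\<in>Z\<times>Z. z \<noteq> w}))"
      by (subst Min_gr_iff) auto
    show "Min (insert 1 ((\<lambda>(z,w). \<bar>z - w\<bar>) ` {(z,w)\<in>Z\<times>Z. z \<noteq> w})) \<le> \<bar>z - w\<bar>" if "z \<in> Z" "w \<in> Z" "z \<noteq> w" for z w
      using fin that by (intro Min_le) auto
  qed
  then obtain D where D: "D > 0" "\<And>z w. z \<in> Z \<Longrightarrow> w \<in> Z \<Longrightarrow> z \<noteq> w \<Longrightarrow> D \<le> \<bar>z - w\<bar>" by blast
  obtain R where R: "\<And>z. z \<in> Z \<Longrightarrow> s - z \<le> R" "R \<ge> 0"
  proof
    show "s - z \<le> (\<Sum>z\<in>Z. s - z)" if "z \<in> Z" for z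
      using Z that by (intro member_le_sum[where f="\<lambda>z. s - z"]) (auto intro: less_imp_le)
    show "(\<Sum>z\<in>Z. s - z) \<ge> 0" using Z by (intro sum_nonneg) (auto intro: less_imp_le)
  qed
  \<comment> \<open>Error of a pair in units of \<open>\<eta>\<close>: 1 from the residual and
    \<open>2 * R / D\<close> from the inner product of two almost orthogonal vectors, weighted by at
    most \<open>R\<close>.\<close>
  define \<kappa> where "\<kappa> = 1 + 2 * R / D"
  have \<kappa>: "\<kappa> \<ge> 1" using R D by (simp add: \<kappa>_def)
  \<comment> \<open>All error terms together amount to at most \<open>\<eta> * \<kappa> * j\<close>
    times the sum of the squared coefficients, which must stay below \<open>\<gamma>\<close> times
    that sum; \<open>j + 1\<close> also covers \<open>j = 0\<close>.\<close>
  define \<eta> where "\<eta> = \<gamma> / (\<kappa> * (real j + 1))"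
  have "\<eta> * \<kappa> * real j = \<gamma> * (real j / (real j + 1))" using \<kappa> by (simp add: \<eta>_def)
  also have "\<dots> < \<gamma> * 1" using \<gamma>(1) by (intro mult_strict_left_mono) auto
  finally have \<eta>: "\<eta> > 0" "\<eta> * \<kappa> * real j < \<gamma>" using \<gamma>(1) \<kappa> by (simp_all add: \<eta>_def)
  have "\<exists>x. x \<in> S \<and> norm x = 1 \<and> norm (T x - h i *\<^sub>R x) < \<eta>" if "i < j" for i
  proof -
    have nb: "\<not> bounded_below_on S (\<lambda>f. T f - h i *\<^sub>R f)" using hZ[OF that] Z(2) by (auto simp: sp_def)
    interpret P: symmetric_operator "\<lambda>f. T f - h i *\<^sub>R f" by (rule shift)
    show ?thesis by (rule not_bounded_below_onD[OF nb P.bl subspace_supported \<eta>(1)]) auto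
  qed
  then have "\<exists>g. \<forall>i. i < j \<longrightarrow> g i \<in> S \<and> norm (g i) = 1 \<and> norm (T (g i) - h i *\<^sub>R g i) < \<eta>"
    by (intro choice) auto
  then obtain g where g: "\<And>i. i < j \<Longrightarrow> g i \<in> S" "\<And>i. i < j \<Longrightarrow> norm (g i) = 1"
    "\<And>i. i < j \<Longrightarrow> norm (T (g i) - h i *\<^sub>R g i) < \<eta>" by blast
  have "T f \<bullet> f < s * (f \<bullet> f)" if c: "\<exists>i<j. c i \<noteq> 0" and f: "f = (\<Sum>i<j. csc (c i) (g i))" for c f
  proof -
    define k where "k i = csc (c i) (g i)" for i
    define n where "n i = norm (k i)" for i
    have n: "n i = cmod (c i)" if "i < j" for i by (simp add: n_def k_def norm_csc g(2)[OF that])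
    have n_ge: "0 \<le> n i" for i by (simp add: n_def)
    have ev: "norm (T (k i) - h i *\<^sub>R k i) \<le> \<eta> * n i" if i: "i < j" for i
    proof -
      have "T (k i) - h i *\<^sub>R k i = csc (c i) (T (g i) - h i *\<^sub>R g i)"
        by (simp add: k_def T_csc csc_simps)
      then have "norm (T (k i) - h i *\<^sub>R k i) = cmod (c i) * norm (T (g i) - h i *\<^sub>R g i)"
        by (simp add: norm_csc)
      also have "\<dots> \<le> cmod (c i) * \<eta>" using g(3)[OF i] by (intro mult_left_mono) auto
      finally show ?thesis using n[OF i] by (simp add: mult.commute)
    qed
    have err: "\<bar>(T (k i) - h i *\<^sub>R k i) \<bullet> k m\<bar> \<le> \<eta> * (n i * n m)" if "i < j" for i m
    proof -
      have "\<bar>(T (k i) - h i *\<^sub>R k i) \<bullet> k m\<bar> \<le> norm (T (k i) - h i *\<^sub>R k i) * n m"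
        unfolding n_def by (rule Cauchy_Schwarz_ineq2)
      also have "\<dots> \<le> (\<eta> * n i) * n m" using ev[OF that] n_ge by (intro mult_right_mono)
      finally show ?thesis by (simp add: mult.assoc)
    qed
    have near_orth: "\<bar>k i \<bullet> k m\<bar> \<le> 2 * \<eta> / D * (n i * n m)" if "i < j" "m < j" "i \<noteq> m" for i m
    proof -
      \<comment> \<open>By symmetry the \<open>T\<close> terms cancel and only the two residuals
        remain: the approximate version of the orthogonality of eigenvectors.\<close>
      have "(h i - h m) * (k i \<bullet> k m) = (T (k m) - h m *\<^sub>R k m) \<bullet> k i - (T (k i) - h i *\<^sub>R k i) \<bullet> k m"
        using sym[of "k i" "k m"] by (simp add: inner_diff_left inner_commute algebra_simps)
      then have "\<bar>h i - h m\<bar> * \<bar>k i \<bullet> k m\<bar> \<le> 2 * \<eta> * (n i * n m)"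
        using err[of i m] err[of m i] that by (simp add: abs_mult[symmetric] mult.commute[of "n m"])
      moreover have "D * \<bar>k i \<bullet> k m\<bar> \<le> \<bar>h i - h m\<bar> * \<bar>k i \<bullet> k m\<bar>"
        using D(2)[OF hZ hZ hinj] that by (intro mult_right_mono) auto
      ultimately show ?thesis using D(1) by (simp add: field_simps)
    qed
    have bound: "(T (k i) - s *\<^sub>R k i) \<bullet> k m \<le> (if i = m then - \<gamma> * (n i)\<^sup>2 else 0) + \<eta> * \<kappa> * (n i * n m)"
      if i: "i < j" and m: "m < j" for i m
    proof -
      have split: "(T (k i) - s *\<^sub>R k i) \<bullet> k m = (T (k i) - h i *\<^sub>R k i) \<bullet> k m - (s - h i) * (k i \<bullet> k m)"
        by (simp add: inner_diff_left algebra_simps)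
      have nn: "0 \<le> n i * n m" using n_ge by simp
      show ?thesis
      proof (cases "i = m")
        case True
        have "(s - h i) * (k i \<bullet> k m) \<ge> \<gamma> * (n i)\<^sup>2"
          using \<gamma>(2)[OF hZ[OF i]] True by (auto simp: n_def power2_norm_eq_inner intro!: mult_right_mono)
        moreover have "\<eta> * (n i * n m) \<le> \<eta> * \<kappa> * (n i * n m)"
          using \<eta>(1) \<kappa> nn by (intro mult_right_mono) auto
        ultimately show ?thesis using err[OF i, of m] split True by simp
      next
        case False
        have "\<bar>(s - h i) * (k i \<bullet> k m)\<bar> \<le> R * (2 * \<eta> / D * (n i * n m))"
          unfolding abs_mult using near_orth[OF i m False] R Z(3)[OF hZ[OF i]] hZ[OF i]
          by (intro mult_mono) auto
        then have "(T (k i) - s *\<^sub>R k i) \<bullet> k m \<le> \<eta> * (n i * n m) + R * (2 * \<eta> / D * (n i * n m))"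
          using err[OF i, of m] split by linarith
        also have "\<dots> = \<eta> * \<kappa> * (n i * n m)" by (simp add: \<kappa>_def algebra_simps)
        finally show ?thesis using False by simp
      qed
    qed
    have fk: "f = (\<Sum>i<j. k i)" by (simp add: f k_def)
    have "T f \<bullet> f - s * (f \<bullet> f) = (T f - s *\<^sub>R f) \<bullet> f" by (simp add: inner_diff_left)
    also have "\<dots> = (\<Sum>i<j. \<Sum>m<j. (T (k i) - s *\<^sub>R k i) \<bullet> k m)"
      unfolding fk sum scaleR_sum_right sum_subtractf[symmetric] inner_sum_left inner_sum_right
      by (rule sum.swap)
    also have "\<dots> \<le> (\<Sum>i<j. \<Sum>m<j. (if i = m then - \<gamma> * (n i)\<^sup>2 else 0) + \<eta> * \<kappa> * (n i * n m))"
      by (intro sum_mono bound) auto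
    also have "\<dots> = - \<gamma> * (\<Sum>i<j. (n i)\<^sup>2) + \<eta> * \<kappa> * (\<Sum>i<j. n i)\<^sup>2"
    proof -
      have "(\<Sum>i<j. \<Sum>m<j. if i = m then - \<gamma> * (n i)\<^sup>2 else 0) = - \<gamma> * (\<Sum>i<j. (n i)\<^sup>2)"
        by (simp add: sum_distrib_left sum_negf)
      moreover have "(\<Sum>i<j. \<Sum>m<j. \<eta> * \<kappa> * (n i * n m)) = \<eta> * \<kappa> * (\<Sum>i<j. n i)\<^sup>2"
        unfolding power2_eq_square sum_product by (simp add: sum_distrib_left)
      ultimately show ?thesis by (simp only: sum.distrib)
    qed
    also have "\<dots> \<le> - \<gamma> * (\<Sum>i<j. (n i)\<^sup>2) + \<eta> * \<kappa> * ((\<Sum>i<j. (n i)\<^sup>2) * real j)"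
      using sum_squared_le_sum_of_squares[of n "{..<j}"] \<eta>(1) \<kappa>
      by (intro add_left_mono mult_left_mono) auto
    also have "\<dots> = (\<eta> * \<kappa> * real j - \<gamma>) * (\<Sum>i<j. (n i)\<^sup>2)" by (simp add: algebra_simps)
    also have "\<dots> < 0"
    proof (rule mult_neg_pos)
      obtain i where i: "i < j" "c i \<noteq> 0" using c by blast
      then have "0 < (n i)\<^sup>2" using n by simp
      also have "\<dots> \<le> (\<Sum>i<j. (n i)\<^sup>2)" using i by (intro member_le_sum) auto
      finally show "0 < (\<Sum>i<j. (n i)\<^sup>2)" .
    qed (use \<eta>(2) in simp)
    finally show ?thesis by simp
  qed
  then show ?thesis unfolding negdim_def j_def[symmetric] using g(1) by blast
qed

lemma not_isolated_islimpt:
  assumes "\<not> (\<exists>\<epsilon>>0. ball (complex_of_real z) \<epsilon> \<inter> spectrum X A = {complex_of_real z})" "z \<in> sp"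
  shows "z islimpt sp"
  unfolding islimpt_approachable
proof (intro allI impI)
  fix e :: real assume "e > 0"
  have "complex_of_real z \<in> ball (complex_of_real z) e \<inter> spectrum X A"
    using assms(2) \<open>e > 0\<close> by (simp add: of_real_spectrum_iff)
  then obtain w where w: "w \<in> ball (complex_of_real z) e" "w \<in> spectrum X A" "w \<noteq> complex_of_real z"
    using assms(1) \<open>e > 0\<close> by blast
  have "w = complex_of_real (Re w)" using spectrum_real[OF w(2)] .
  then show "\<exists>x'\<in>sp. x' \<noteq> z \<and> dist x' z < e"
    using w by (intro bexI[of _ "Re w"])
      (metis of_real_eq_iff dist_commute dist_of_real mem_ball, metis of_real_spectrum_iff)
qed

lemma isolated_sp:
  assumes "ball (complex_of_real z) \<epsilon> \<inter> spectrum X A = {complex_of_real z}" "\<bar>w - z\<bar> < \<epsilon>" "w \<noteq> z"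
  shows "bounded_below_on S (\<lambda>f. T f - w *\<^sub>R f)"
proof -
  have "complex_of_real w \<in> ball (complex_of_real z) \<epsilon>"
    using assms(2) by (simp add: dist_of_real dist_real_def abs_minus_commute)
  then have "complex_of_real w \<notin> spectrum X A"
    using assms(1,3) by (metis IntI of_real_eq_iff singletonD)
  then show ?thesis by (simp add: of_real_spectrum_iff sp_def)
qed

text \<open>An isolated point may lie between other spectral points, where \<open>T - z\<close> has
  no sign. Its square has a nonnegative form, and the gap \<open>(0, \<epsilon>^2)\<close> because
  \<open>(T - z)^2 - r^2\<close> is a product of two operators that are bounded below. A null vector
  of the square is a null vector of \<open>T - z\<close>.\<close>

lemma isolated_sp_eigenvalue:
  assumes iso: "ball (complex_of_real z) \<epsilon> \<inter> spectrum X A = {complex_of_real z}" and \<epsilon>: "\<epsilon> > 0"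
    and z: "z \<in> sp"
  shows "eigenfamily (\<lambda>l. l = z) 1"
proof -
  let ?P = "\<lambda>f. T f - z *\<^sub>R f"
  interpret P: symmetric_operator ?P by (rule shift)
  interpret PPh: symmetric_operator_hilbert "\<lambda>f. ?P (?P f)"
    by (rule symmetric_operator_hilbert.intro) (rule P.square)
  have P_S: "?P f \<in> S" if "f \<in> S" for f
    using that T_supported by (auto intro!: subspace_diff subspace_scale subspace_supported)
  obtain K where K: "K > 0" "\<And>f. norm (?P f) \<le> norm f * K" using P.pos_bounded by blast
  obtain x where x: "x \<in> S" "x \<noteq> 0" "?P (?P x) = 0"
  proof (rule PPh.kernel_nontrivial_of_gap[of S "\<epsilon>\<^sup>2"])
    show "(\<lambda>f. ?P (?P f)) ` S \<subseteq> S" using P_S by auto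
    show "0 \<le> ?P (?P f) \<bullet> f" for f by (subst P.sym) simp
    show "bounded_below_on S (\<lambda>f. ?P (?P f) - w *\<^sub>R f)" if w: "0 < w" "w < \<epsilon>\<^sup>2" for w
    proof -
      define r where "r = sqrt w"
      have r: "0 < r" "r < \<epsilon>" "r * r = w"
        using w \<epsilon> by (auto simp: r_def intro: real_less_lsqrt)
      obtain a where a: "a > 0" "\<And>f. f \<in> S \<Longrightarrow> a * norm f \<le> norm (T f - (z + r) *\<^sub>R f)"
        using isolated_sp[OF iso, of "z + r"] r unfolding bounded_below_on_def by auto
      obtain b where b: "b > 0" "\<And>f. f \<in> S \<Longrightarrow> b * norm f \<le> norm (T f - (z - r) *\<^sub>R f)"
        using isolated_sp[OF iso, of "z - r"] r unfolding bounded_below_on_def by auto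
      have "a * b * norm f \<le> norm (?P (?P f) - w *\<^sub>R f)" if f: "f \<in> S" for f
      proof -
        let ?y = "T f - (z - r) *\<^sub>R f"
        have "?y \<in> S" using f T_supported by (auto intro!: subspace_diff subspace_scale subspace_supported)
        then have "a * norm ?y \<le> norm (T ?y - (z + r) *\<^sub>R ?y)" by (rule a)
        also have "T ?y - (z + r) *\<^sub>R ?y = ?P (?P f) - w *\<^sub>R f"
          by (simp add: diff add scaleR algebra_simps flip: r(3))
        finally show ?thesis
          using order_trans[OF mult_left_mono[OF b(2)[OF f], of a]] a(1) by (simp add: mult.assoc)
      qed
      then show ?thesis unfolding bounded_below_on_def using a(1) b(1) by (intro exI[of _ "a * b"]) auto
    qed
    show "\<not> bounded_below_on S (\<lambda>f. ?P (?P f))"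
    proof
      assume "bounded_below_on S (\<lambda>f. ?P (?P f))"
      then obtain \<delta> where \<delta>: "\<delta> > 0" "\<And>f. f \<in> S \<Longrightarrow> \<delta> * norm f \<le> norm (?P (?P f))"
        unfolding bounded_below_on_def by blast
      have "\<delta> / K * norm f \<le> norm (?P f)" if "f \<in> S" for f
        using order_trans[OF \<delta>(2)[OF that] K(2)] K(1) by (simp add: field_simps)
      then have "bounded_below_on S ?P" unfolding bounded_below_on_def
        using \<delta>(1) K(1) by (intro exI[of _ "\<delta> / K"]) auto
      then show False using z by (simp add: sp_def)
    qed
  qed (use \<epsilon> subspace_supported closed_supported in auto)
  have "?P x \<bullet> ?P x = 0" using x(3) P.sym[of "?P x" x] by simp
  then have "T x = z *\<^sub>R x" by simp
  then show ?thesis unfolding eigenfamily_def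
    using x by (intro exI[of _ "\<lambda>_. x"] exI[of _ "\<lambda>_. z"]) (auto simp: csc_eq_0_iff)
qed

text \<open>An essential point is either isolated, hence an eigenvalue and then of infinite
  multiplicity, or a limit point, so that infinitely many spectral points lie below
  \<open>s\<close>. Either way every dimension \<open>j\<close> is reached.\<close>

lemma ess_negdim:
  assumes ess: "complex_of_real z \<in> ess_spectrum X A" and s: "z < s"
  shows "negdim s j"
proof -
  have z: "z \<in> sp" using ess by (simp add: ess_spectrum_def of_real_spectrum_iff)
  show ?thesis
  proof (cases "\<exists>\<epsilon>>0. ball (complex_of_real z) \<epsilon> \<inter> spectrum X A = {complex_of_real z}")
    case True
    then have "enat 1 \<le> mult X A (complex_of_real z)"
      using isolated_sp_eigenvalue z by (auto simp: mult_iff)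
    then have "0 < mult X A (complex_of_real z)"
      by (metis enat_ord_simps(2) less_le_trans less_numeral_extra(1) zero_enat_def)
    then have "mult X A (complex_of_real z) = \<infinity>"
      using ess True by (auto simp: ess_spectrum_def disc_spectrum_def)
    then have "eigenfamily (\<lambda>l. l = z) j" by (simp flip: mult_iff)
    then have "eigenfamily (\<lambda>l. l \<le> z) j" by (rule eigenfamily_mono) simp
    then show ?thesis using s by (rule eigenfamily_negdim)
  next
    case False
    then have "infinite (sp \<inter> ball z (s - z))"
      using not_isolated_islimpt[OF _ z] s unfolding islimpt_eq_infinite_ball by simp
    then obtain Z where Z: "finite Z" "card Z = j" "Z \<subseteq> sp \<inter> ball z (s - z)"
      using infinite_arbitrarily_large by blast
    have "negdim s (card Z)"
      using Z by (intro finite_sp_negdim) (auto simp: dist_real_def abs_if split: if_splits)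
    then show ?thesis using Z by simp
  qed
qed


section \<open>Successive construction of orthogonal eigenvectors below the essential
  spectrum\<close>

lemma eigenvalue_in_sp:
  assumes "T b = l *\<^sub>R b" "b \<in> S" "b \<noteq> 0"
  shows "l \<in> sp"
proof -
  have "\<not> \<delta> * norm b \<le> norm (T b - l *\<^sub>R b)" if "\<delta> > 0" for \<delta>
    using assms that by (simp add: not_le)
  then show ?thesis using assms(2) unfolding sp_def bounded_below_on_def by blast
qed

text \<open>A set, because it grows by insertion; orthogonal rather than merely independent, because
  the next eigenvector is sought in the orthogonal complement.\<close>

definition orthofamily :: "(real \<Rightarrow> bool) \<Rightarrow> pt ell2 set \<Rightarrow> bool" where
  "orthofamily R B \<longleftrightarrow> finite B \<and> B \<subseteq> S \<and> (\<forall>b\<in>B. b \<noteq> 0 \<and> (\<exists>l. T b = l *\<^sub>R b \<and> R l)) \<and>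
     (\<forall>b\<in>B. \<forall>b'\<in>B. b \<noteq> b' \<longrightarrow> cinner b b' = 0)"

lemma orthofamily_eigenfamily:
  assumes "orthofamily R B"
  shows "eigenfamily R (card B)"
proof -
  have B: "finite B" "B \<subseteq> S" "\<And>b. b \<in> B \<Longrightarrow> b \<noteq> 0" "\<And>b. b \<in> B \<Longrightarrow> \<exists>l. T b = l *\<^sub>R b \<and> R l"
    "\<And>b b'. b \<in> B \<Longrightarrow> b' \<in> B \<Longrightarrow> b \<noteq> b' \<Longrightarrow> cinner b b' = 0"
    using assms unfolding orthofamily_def by auto
  obtain h where h: "bij_betw h {0..<card B} B" using ex_bij_betw_nat_finite[OF B(1)] by blast
  have hB: "h i \<in> B" if "i < card B" for i using h that by (auto simp: bij_betw_def)
  have hinj: "h i \<noteq> h k" if "i < card B" "k < card B" "i \<noteq> k" for i k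
    using h that by (auto simp: bij_betw_def inj_on_def)
  have "\<exists>l. \<forall>b\<in>B. T b = l b *\<^sub>R b \<and> R (l b)" using B(4) by (intro bchoice) auto
  then obtain l where l: "\<And>b. b \<in> B \<Longrightarrow> T b = l b *\<^sub>R b \<and> R (l b)" by blast
  have "c i = 0" if c: "(\<Sum>i<card B. csc (c i) (h i)) = 0" and i: "i < card B" for c i
  proof -
    have "0 = cinner (\<Sum>k<card B. csc (c k) (h k)) (h i)" by (simp add: c cinner_def complex_eq_iff)
    also have "\<dots> = (\<Sum>k<card B. c k * cinner (h k) (h i))" by (simp add: cinner_sum cinner_csc)
    also have "\<dots> = (\<Sum>k\<in>{i}. c k * cinner (h k) (h i))"
      using i B(5)[OF hB hB hinj] by (intro sum.mono_neutral_right) auto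
    finally show ?thesis using B(3)[OF hB[OF i]] by (simp add: cinner_self)
  qed
  then show ?thesis unfolding eigenfamily_def
    using hB B(2) l by (intro exI[of _ h] exI[of _ "\<lambda>i. l (h i)"]) auto
qed

definition perp :: "pt ell2 set \<Rightarrow> pt ell2 set" where
  "perp B = {f\<in>S. \<forall>b\<in>B. cinner f b = 0}"

lemma perp_alt: "perp B = S \<inter> (\<Inter>b\<in>B. {f. f \<bullet> b = 0} \<inter> {f. f \<bullet> csc \<i> b = 0})"
  by (auto simp: perp_def cinner_def complex_eq_iff)

lemma subspace_perp: "subspace (perp B)"
  using subspace_supported[of X] unfolding perp_alt
  by (auto simp: subspace_def inner_add_left)

lemma closed_perp: "closed (perp B)"
  unfolding perp_alt
  by (intro closed_Int closed_INT ballI closed_supported closed_Collect_eq continuous_intros)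

lemma T_perp:
  assumes "\<And>b. b \<in> B \<Longrightarrow> \<exists>l. T b = l *\<^sub>R b"
  shows "T ` perp B \<subseteq> perp B"
proof safe
  fix f assume f: "f \<in> perp B"
  have "cinner (T f) b = 0" if b: "b \<in> B" for b
  proof -
    obtain l where l: "T b = l *\<^sub>R b" using assms[OF b] by blast
    have "T f \<bullet> b = l * (f \<bullet> b)" by (simp add: sym l)
    moreover have "T f \<bullet> csc \<i> b = l * (f \<bullet> csc \<i> b)" by (simp add: sym T_csc l csc_simps)
    ultimately show ?thesis using f b by (auto simp: perp_def cinner_def complex_eq_iff)
  qed
  then show "T f \<in> perp B" using T_supported by (simp add: perp_def)
qed

text \<open>The complement of eigenvectors is invariant and closed, so the Rayleigh infimum
  \<open>m\<close> on it is a spectral point of \<open>T\<close>. The vector \<open>f0\<close>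
  forces \<open>m < s\<close>, hence \<open>m\<close> is not essential and is isolated, and
  \<open>kernel_nontrivial_of_gap\<close> applies to \<open>T - m\<close> on
  \<open>perp B\<close>.\<close>

lemma rayleigh_below_ess_eigenvector:
  assumes B: "\<And>b. b \<in> B \<Longrightarrow> \<exists>l. T b = l *\<^sub>R b"
    and f0: "f0 \<in> perp B" "T f0 \<bullet> f0 < s * (f0 \<bullet> f0)"
    and no_ess: "\<And>z. complex_of_real z \<in> ess_spectrum X A \<Longrightarrow> s \<le> z"
  obtains x m where "x \<in> perp B" "x \<noteq> 0" "T x = m *\<^sub>R x" "m < s"
proof -
  define m where "m = rayleigh_inf (perp B)"
  have f0_ne: "f0 \<noteq> 0" using f0(2) by auto
  have "m * (f0 \<bullet> f0) \<le> T f0 \<bullet> f0" unfolding m_def by (rule rayleigh_inf_le[OF subspace_perp f0(1)])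
  then have "m * (f0 \<bullet> f0) < s * (f0 \<bullet> f0)" using f0(2) by linarith
  then have ms: "m < s" using f0_ne by simp
  have nbb: "\<not> bounded_below_on (perp B) (\<lambda>f. T f - m *\<^sub>R f)"
    unfolding m_def by (rule rayleigh_inf_not_bounded_below[OF T_perp[OF B] subspace_perp f0(1) f0_ne])
  have restrict: "bounded_below_on (perp B) P" if "bounded_below_on S P" for P
    using that unfolding bounded_below_on_def perp_def by auto
  have m_sp: "complex_of_real m \<in> spectrum X A"
    using nbb restrict by (auto simp: of_real_spectrum_iff sp_def)
  then have "complex_of_real m \<in> disc_spectrum X A"
    using no_ess[of m] ms by (auto simp: ess_spectrum_def)
  then obtain \<epsilon> where \<epsilon>: "\<epsilon> > 0" "ball (complex_of_real m) \<epsilon> \<inter> spectrum X A = {complex_of_real m}"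
    unfolding disc_spectrum_def by blast
  interpret P: symmetric_operator_hilbert "\<lambda>f. T f - m *\<^sub>R f"
    by (rule symmetric_operator_hilbert.intro) (rule shift)
  obtain x where "x \<in> perp B" "x \<noteq> 0" "T x - m *\<^sub>R x = 0"
  proof (rule P.kernel_nontrivial_of_gap[OF _ subspace_perp closed_perp _ \<epsilon>(1) _ nbb])
    show "(\<lambda>f. T f - m *\<^sub>R f) ` perp B \<subseteq> perp B"
      using T_perp[OF B] by (auto intro!: subspace_diff subspace_scale subspace_perp)
    show "0 \<le> (T f - m *\<^sub>R f) \<bullet> f" if "f \<in> perp B" for f
      using rayleigh_inf_le[OF subspace_perp that] by (simp add: inner_diff_left m_def)
    show "bounded_below_on (perp B) (\<lambda>f. T f - m *\<^sub>R f - w *\<^sub>R f)" if "0 < w" "w < \<epsilon>" for w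
      using restrict[OF isolated_sp[OF \<epsilon>(2), of "m + w"]] that by (simp add: algebra_simps)
  qed auto
  then show ?thesis using that ms by auto
qed

text \<open>Orthogonality to \<open>B\<close> imposes only \<open>card B\<close> complex linear
  conditions on the \<open>j\<close> coefficients.\<close>

lemma negdim_perp:
  assumes "negdim s j" "finite B" "card B < j"
  obtains f where "f \<in> perp B" "T f \<bullet> f < s * (f \<bullet> f)"
proof -
  obtain g where g: "\<forall>i<j. g i \<in> S" "\<And>c. \<exists>i<j. c i \<noteq> 0 \<Longrightarrow>
       T (\<Sum>i<j. csc (c i) (g i)) \<bullet> (\<Sum>i<j. csc (c i) (g i)) <
       s * ((\<Sum>i<j. csc (c i) (g i)) \<bullet> (\<Sum>i<j. csc (c i) (g i)))"
    using assms(1) unfolding negdim_def by blast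
  obtain c where c: "\<exists>i\<in>{..<j}. c i \<noteq> 0" "\<And>b. b \<in> B \<Longrightarrow> (\<Sum>i\<in>{..<j}. cinner (g i) b * c i) = 0"
    using homogeneous_system_nontrivial_solution[OF assms(2), of "{..<j}" "\<lambda>b i. cinner (g i) b"] assms(3)
    by auto
  show ?thesis
  proof (rule that)
    have "(\<Sum>i<j. csc (c i) (g i)) \<in> S"
      using g(1) by (intro subspace_sum subspace_supported csc_supported) auto
    then show "(\<Sum>i<j. csc (c i) (g i)) \<in> perp B"
      using c(2) by (simp add: perp_def cinner_sum cinner_csc mult.commute)
    show "T (\<Sum>i<j. csc (c i) (g i)) \<bullet> (\<Sum>i<j. csc (c i) (g i)) <
       s * ((\<Sum>i<j. csc (c i) (g i)) \<bullet> (\<Sum>i<j. csc (c i) (g i)))"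
      using c(1) by (intro g(2)) auto
  qed
qed

text \<open>Deflation: while fewer than \<open>j\<close> eigenvectors are known, some vector of the
  given space is orthogonal to all of them and has its form below level \<open>s\<close>; the bottom
  of the form on their complement is then the next eigenvalue.\<close>

lemma negdim_orthofamily:
  assumes nd: "negdim s j" and no_ess: "\<And>z. complex_of_real z \<in> ess_spectrum X A \<Longrightarrow> s \<le> z"
  shows "\<exists>B. orthofamily (\<lambda>l. l < s) B \<and> card B = j"
proof -
  have "\<exists>B. orthofamily (\<lambda>l. l < s) B \<and> card B = k" if "k \<le> j" for k
    using that
  proof (induction k)
    case 0
    show ?case by (intro exI[of _ "{}"]) (simp add: orthofamily_def)
  next
    case (Suc k)
    then obtain B where B: "orthofamily (\<lambda>l. l < s) B" "card B = k" by auto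
    then have fin: "finite B" and ev: "\<And>b. b \<in> B \<Longrightarrow> \<exists>l. T b = l *\<^sub>R b"
      unfolding orthofamily_def by auto
    obtain f where f: "f \<in> perp B" "T f \<bullet> f < s * (f \<bullet> f)"
      using negdim_perp[OF nd fin] B(2) Suc.prems by auto
    obtain x m where x: "x \<in> perp B" "x \<noteq> 0" "T x = m *\<^sub>R x" "m < s"
      using rayleigh_below_ess_eigenvector[OF ev f no_ess] by blast
    have x_notin: "x \<notin> B"
      using x(1,2) by (auto simp: perp_def cinner_self dest!: bspec[of B _ x])
    have xb: "cinner x b = 0" if "b \<in> B" for b using x(1) that by (simp add: perp_def)
    have bx: "cinner b x = 0" if "b \<in> B" for b
    proof -
      have "b \<bullet> csc \<i> x = - (x \<bullet> csc \<i> b)"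
        using csc_inner_cnj[of \<i> x b] csc_decomp[of "-\<i>" b]
        by (simp add: inner_minus_right inner_commute)
      then show ?thesis using xb[OF that] by (simp add: cinner_def complex_eq_iff inner_commute)
    qed
    have "orthofamily (\<lambda>l. l < s) (insert x B)"
      using B(1) x xb bx unfolding orthofamily_def by (auto simp: perp_def)
    then show ?case using B(2) fin x_notin by (intro exI[of _ "insert x B"]) auto
  qed
  then show ?thesis by blast
qed

text \<open>Above the norm bound every nonzero vector qualifies, so point masses at \<open>j\<close>
  vertices suffice. This feeds \<open>ess_spectrum_nonempty\<close>.\<close>

lemma negdim_of_infinite:
  assumes "infinite X"
  obtains s where "\<And>j. negdim s j"
proof -
  obtain K where K: "\<And>f. norm (T f) \<le> norm f * K" using pos_bounded by blast
  have "negdim (K + 1) j" for j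
  proof -
    obtain Y where Y: "finite Y" "card Y = j" "Y \<subseteq> X" using infinite_arbitrarily_large[OF assms] by blast
    obtain h where h: "bij_betw h {0..<j} Y" using ex_bij_betw_nat_finite[OF Y(1)] Y(2) by blast
    have hinj: "h i = h k \<longleftrightarrow> i = k" if "i < j" "k < j" for i k
      using h that by (auto simp: bij_betw_def inj_on_def)
    define g where "g i = ell2_of (\<lambda>x. if x = h i then 1 else 0)" for i
    have g: "fun_of (g i) x = (if x = h i then 1 else 0)" for i x
    proof -
      have "(\<lambda>x. (cmod (if x = h i then 1 else 0))\<^sup>2) summable_on {h i}" by (rule summable_on_finite) simp
      then have "(\<lambda>x. (cmod (if x = h i then 1 else 0))\<^sup>2) summable_on UNIV"
        by (rule summable_on_cong_neutral[THEN iffD1, rotated -1]) auto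
      then show ?thesis by (simp add: g_def ell2_of_inverse)
    qed
    have "T f \<bullet> f < (K + 1) * (f \<bullet> f)" if c: "\<exists>i<j. c i \<noteq> 0" and f: "f = (\<Sum>i<j. csc (c i) (g i))" for c f
    proof -
      obtain i where i: "i < j" "c i \<noteq> 0" using c by blast
      have "fun_of f (h i) = (\<Sum>k<j. if k = i then c i else 0)"
        unfolding f fun_of_sum csc.rep_eq g using hinj i by (intro sum.cong) auto
      then have "fun_of f (h i) \<noteq> 0" using i by simp
      then have "f \<noteq> 0" by auto
      have "T f \<bullet> f \<le> norm (T f) * norm f" by (rule norm_cauchy_schwarz)
      also have "\<dots> \<le> (norm f * K) * norm f" using K by (intro mult_right_mono) auto
      also have "\<dots> = K * (f \<bullet> f)" by (simp add: power2_norm_eq_inner[symmetric] power2_eq_square)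
      also have "\<dots> < (K + 1) * (f \<bullet> f)" using \<open>f \<noteq> 0\<close> by (intro mult_strict_right_mono) auto
      finally show ?thesis .
    qed
    moreover have "\<forall>i<j. g i \<in> S" using h Y by (auto simp: supported_def g bij_betw_def)
    ultimately show ?thesis unfolding negdim_def by blast
  qed
  then show ?thesis using that by blast
qed

text \<open>A bounded closed spectrum of isolated points is finite. With finite multiplicities it
  admits only finitely many orthogonal eigenvectors, whereas deflation at a high level yields any
  number of them in infinite dimension.\<close>

lemma ess_spectrum_nonempty:
  assumes "infinite X"
  obtains z where "complex_of_real z \<in> ess_spectrum X A"
proof (rule ccontr)
  assume "\<not> thesis"
  then have none: "complex_of_real z \<notin> ess_spectrum X A" for z using that by blast
  then have disc: "complex_of_real z \<in> disc_spectrum X A" if "z \<in> sp" for z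
    using that by (auto simp: ess_spectrum_def simp flip: of_real_spectrum_iff)
  have fin: "finite sp"
  proof (rule ccontr)
    assume inf: "infinite sp"
    have "sp \<subseteq> {- onorm T..onorm T}" using abs_sp_le_onorm by (force simp: abs_le_iff)
    then obtain z where z: "z islimpt sp"
      using Heine_Borel_imp_Bolzano_Weierstrass[OF compact_Icc inf] by blast
    then have "z \<in> sp" using closed_sp by (simp add: closed_limpt)
    then obtain \<epsilon> where \<epsilon>: "\<epsilon> > 0" "ball (complex_of_real z) \<epsilon> \<inter> spectrum X A = {complex_of_real z}"
      using disc[of z] unfolding disc_spectrum_def by blast
    obtain w where "w \<in> sp" "w \<noteq> z" "dist w z < \<epsilon>"
      using z \<epsilon>(1) unfolding islimpt_approachable by blast
    then show False using isolated_sp[OF \<epsilon>(2), of w] by (auto simp: sp_def dist_real_def)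
  qed
  have "\<exists>N. \<forall>z\<in>sp. \<not> eigenfamily (\<lambda>l. l = z) (N z)"
  proof (rule bchoice, rule ballI)
    fix z assume "z \<in> sp"
    then have "mult X A (complex_of_real z) < \<infinity>" using disc[of z] by (auto simp: disc_spectrum_def)
    then obtain n where "mult X A (complex_of_real z) = enat n" by (cases "mult X A (complex_of_real z)") auto
    then have "\<not> enat (Suc n) \<le> mult X A (complex_of_real z)" by simp
    then show "\<exists>N. \<not> eigenfamily (\<lambda>l. l = z) N" by (auto simp: mult_iff)
  qed
  then obtain N where N: "\<And>z. z \<in> sp \<Longrightarrow> \<not> eigenfamily (\<lambda>l. l = z) (N z)" by blast
  obtain s where s: "\<And>j. negdim s j" using negdim_of_infinite[OF assms] by blast
  \<comment> \<open>One eigenvector more than the bounds \<open>N z\<close> leave room for.\<close>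
  obtain B where B: "orthofamily (\<lambda>l. l < s) B" "card B = Suc (\<Sum>z\<in>sp. N z)"
    using negdim_orthofamily[OF s] none by blast
  define E where "E z = {b\<in>B. T b = z *\<^sub>R b}" for z
  have fB: "finite B" using B(1) by (simp add: orthofamily_def)
  have E_le: "card (E z) \<le> N z" if "z \<in> sp" for z
  proof (rule ccontr)
    assume gt: "\<not> ?thesis"
    have "orthofamily (\<lambda>l. l = z) (E z)" using B(1) unfolding orthofamily_def E_def by auto
    then have "eigenfamily (\<lambda>l. l = z) (card (E z))" by (rule orthofamily_eigenfamily)
    then show False using N[OF that] eigenfamily_antimono gt by auto
  qed
  have "B \<subseteq> (\<Union>z\<in>sp. E z)"
  proof
    fix b assume b: "b \<in> B"
    then obtain l where l: "T b = l *\<^sub>R b" "b \<noteq> 0" "b \<in> S" using B(1) unfolding orthofamily_def by blast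
    then show "b \<in> (\<Union>z\<in>sp. E z)" using b eigenvalue_in_sp by (auto simp: E_def)
  qed
  then have "card B \<le> card (\<Union>z\<in>sp. E z)"
    using fin fB by (intro card_mono finite_UN_I) (auto simp: E_def)
  also have "\<dots> \<le> (\<Sum>z\<in>sp. card (E z))" using fin by (rule card_UN_le)
  also have "\<dots> \<le> (\<Sum>z\<in>sp. N z)" using E_le by (rule sum_mono)
  finally show False using B(2) by simp
qed

section \<open>Comparison of \<open>mu\<close> and \<open>lam\<close> with
  \<open>negdim\<close>\<close>

lemma eigenfamily_bound:
  assumes "1 \<le> j" "eigenfamily R j" "\<And>l. R l \<Longrightarrow> l \<le> t"
  shows "- onorm T \<le> t"
proof -
  have "eigenfamily R 1" using eigenfamily_antimono[OF assms(2,1)] .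
  then obtain g l where g: "g 0 \<in> S" "T (g 0) = l 0 *\<^sub>R g 0" "R (l 0)"
    and ind: "\<forall>c. csc (c 0) (g 0) = 0 \<longrightarrow> c (0::nat) = 0"
    unfolding eigenfamily_def by auto
  have "g 0 \<noteq> 0" using ind[rule_format, of "\<lambda>_. 1"] by (auto simp: csc_simps)
  then have "\<bar>l 0\<bar> \<le> onorm T" using eigenvalue_in_sp g abs_sp_le_onorm by blast
  then show ?thesis using assms(3)[OF g(3)] by linarith
qed

lemma bdd_below_ess: "bdd_below {x. complex_of_real x \<in> ess_spectrum X A}"
proof (rule bdd_belowI)
  show "- onorm T \<le> x" if "x \<in> {x. complex_of_real x \<in> ess_spectrum X A}" for x
    using that abs_sp_le_onorm[of x] by (simp add: ess_spectrum_def of_real_spectrum_iff abs_le_iff)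
qed

text \<open>If \<open>s\<close> is at least \<open>inf_ess\<close>, the cap in \<open>mu\<close>
  gives the bound. Otherwise \<open>s\<close> lies below the essential spectrum and deflation
  provides the eigenvectors that \<open>count_below\<close> counts.\<close>

lemma mu_le:
  assumes nd: "negdim s j" and j: "1 \<le> j"
  shows "mu X A j \<le> s"
proof -
  let ?M = "{t. t < inf_ess X A \<and> enat j \<le> count_below X A t}"
  \<comment> \<open>For \<open>j \<ge> 1\<close> a family contains an actual eigenvalue, which is at
    least \<open>- onorm T\<close>; for \<open>j = 0\<close> every real \<open>t\<close> would
    qualify.\<close>
  have bdd: "bdd_below (?M \<union> {inf_ess X A})"
    using eigenfamily_bound[OF j]
    by (intro bdd_belowI[of _ "min (- onorm T) (inf_ess X A)"]) (auto simp: count_below_iff min_le_iff_disj)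
  then have mu_ie: "mu X A j \<le> inf_ess X A" unfolding mu_def by (intro cInf_lower) auto
  show ?thesis
  proof (cases "inf_ess X A \<le> s")
    case True
    then show ?thesis using mu_ie by linarith
  next
    case False
    have "s \<le> z" if z: "complex_of_real z \<in> ess_spectrum X A" for z
    proof -
      have "inf_ess X A \<le> z" unfolding inf_ess_def using z by (intro cInf_lower bdd_below_ess) auto
      then show ?thesis using False by linarith
    qed
    then obtain B where "orthofamily (\<lambda>l. l < s) B" "card B = j" using negdim_orthofamily[OF nd] by blast
    then have "eigenfamily (\<lambda>l. l < s) j" using orthofamily_eigenfamily by blast
    then have "eigenfamily (\<lambda>l. l \<le> s) j" by (rule eigenfamily_mono) simp
    then show ?thesis unfolding mu_def using False by (intro cInf_lower bdd) (auto simp: count_below_iff)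
  qed
qed

text \<open>A value below \<open>s\<close> stems from counted eigenvalues or from the cap. In the
  second case there are essential points below \<open>s\<close>, since the essential spectrum is
  nonempty for infinite \<open>X\<close>.\<close>

lemma mu_less:
  assumes "mu X A j < s" "infinite X"
  shows "negdim s j"
proof -
  have "\<exists>t\<in>{t. t < inf_ess X A \<and> enat j \<le> count_below X A t} \<union> {inf_ess X A}. t < s"
    using assms(1) unfolding mu_def by (intro cInf_lessD) auto
  then consider t where "enat j \<le> count_below X A t" "t < s" | "inf_ess X A < s" by auto
  then show ?thesis
  proof cases
    case 1
    then show ?thesis using eigenfamily_negdim by (simp add: count_below_iff)
  next
    case 2
    obtain z0 where "complex_of_real z0 \<in> ess_spectrum X A" using ess_spectrum_nonempty[OF assms(2)] by blast
    then have "\<exists>z\<in>{x. complex_of_real x \<in> ess_spectrum X A}. z < s"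
      using 2 unfolding inf_ess_def by (intro cInf_lessD) auto
    then show ?thesis using ess_negdim by auto
  qed
qed

text \<open>\<open>num_fin\<close> ensures that the set defining \<open>lam\<close> is nonempty, so
  it contains some \<open>t < s\<close>, and the eigenvectors counted at \<open>t\<close> span the
  required space.\<close>

lemma lam_less:
  assumes nf: "enat j \<le> num_fin X A" and lt: "lam X A j < s"
  shows "negdim s j"
proof -
  have ex: "\<exists>t. enat j \<le> count_fin X A t"
  proof -
    obtain g l where g: "\<forall>i<j. g i \<in> S \<and> T (g i) = l i *\<^sub>R g i \<and> mult X A (complex_of_real (l i)) < \<infinity>"
      and ind: "\<forall>c. (\<Sum>i<j. csc (c i) (g i)) = 0 \<longrightarrow> (\<forall>i<j. c i = 0)"
      using nf unfolding num_fin_iff eigenfamily_def by blast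
    \<comment> \<open>A common upper bound of the finitely many eigenvalues, at which
      \<open>count_fin\<close> reaches \<open>j\<close>.\<close>
    have "l i \<le> (\<Sum>i<j. \<bar>l i\<bar>)" if "i < j" for i
    proof -
      have "\<bar>l i\<bar> \<le> (\<Sum>i<j. \<bar>l i\<bar>)" using that by (intro member_le_sum) auto
      then show ?thesis by linarith
    qed
    then have "enat j \<le> count_fin X A (\<Sum>i<j. \<bar>l i\<bar>)"
      unfolding count_fin_iff eigenfamily_def using g ind by (intro exI[of _ g] exI[of _ l]) auto
    then show ?thesis by blast
  qed
  then have "\<exists>t\<in>{t. enat j \<le> count_fin X A t}. t < s"
    using lt unfolding lam_def by (intro cInf_lessD) auto
  then obtain t where t: "enat j \<le> count_fin X A t" "t < s" by auto
  have "eigenfamily (\<lambda>l. l \<le> t) j"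
    using t(1) unfolding count_fin_iff by (rule eigenfamily_mono) simp
  then show ?thesis using t(2) by (rule eigenfamily_negdim)
qed

text \<open>\<open>lam\<close> counts only eigenvalues of finite multiplicity. Those found by
  deflation lie below the essential spectrum by \<open>no_ess\<close>, hence are discrete and are
  counted.\<close>

lemma lam_le:
  assumes nd: "negdim s j" and j: "1 \<le> j"
    and no_ess: "\<And>z. complex_of_real z \<in> ess_spectrum X A \<Longrightarrow> s \<le> z"
  shows "lam X A j \<le> s"
proof -
  obtain B where B: "orthofamily (\<lambda>l. l < s) B" "card B = j"
    using negdim_orthofamily[OF nd no_ess] by blast
  have "orthofamily (\<lambda>l. mult X A (complex_of_real l) < \<infinity> \<and> l \<le> s) B"
    unfolding orthofamily_def
  proof (intro conjI ballI)
    fix b assume b: "b \<in> B"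
    then obtain l where l: "T b = l *\<^sub>R b" "l < s" "b \<noteq> 0" "b \<in> S"
      using B(1) unfolding orthofamily_def by blast
    have "complex_of_real l \<in> spectrum X A"
      using eigenvalue_in_sp l by (simp add: of_real_spectrum_iff)
    then have "complex_of_real l \<in> disc_spectrum X A" using no_ess[of l] l(2) by (auto simp: ess_spectrum_def)
    then show "\<exists>l. T b = l *\<^sub>R b \<and> mult X A (complex_of_real l) < \<infinity> \<and> l \<le> s"
      using l by (intro exI[of _ l]) (auto simp: disc_spectrum_def)
  qed (use B(1) in \<open>auto simp: orthofamily_def\<close>)
  then have "enat j \<le> count_fin X A s"
    using orthofamily_eigenfamily B(2) unfolding count_fin_iff by blast
  moreover have "bdd_below {t. enat j \<le> count_fin X A t}"
    using eigenfamily_bound[OF j] by (intro bdd_belowI[of _ "- onorm T"]) (auto simp: count_fin_iff)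
  ultimately show ?thesis unfolding lam_def by (intro cInf_lower) auto
qed

end

text \<open>The Rayleigh infimum over \<open>S\<close> is itself a spectral point, so it cannot lie
  below \<open>inf_spec\<close>.\<close>

lemma (in l2_operator) inf_spec_le_form:
  assumes "f \<in> S"
  shows "inf_spec X A * (f \<bullet> f) \<le> T f \<bullet> f"
proof (cases "f = 0")
  case False
  have "\<not> bounded_below_on S (\<lambda>f. T f - rayleigh_inf S *\<^sub>R f)"
    by (rule rayleigh_inf_not_bounded_below[OF T_S subspace_supported assms False])
  then have "inf_spec X A \<le> rayleigh_inf S"
    unfolding inf_spec_def of_real_spectrum_iff using abs_sp_le_onorm
    by (intro cInf_lower bdd_belowI[of _ "- onorm T"]) (auto simp: sp_def abs_le_iff minus_le_iff)
  then have "inf_spec X A * (f \<bullet> f) \<le> rayleigh_inf S * (f \<bullet> f)" by (rule mult_right_mono) simp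
  also have "\<dots> \<le> T f \<bullet> f" by (rule rayleigh_inf_le[OF subspace_supported assms])
  finally show ?thesis .
qed (simp add: zero)

text \<open>The same vectors witness both claims; this is the monotonicity of min-max values with
  respect to the form.\<close>

lemma negdim_transfer:
  assumes "l2_operator T X A" "l2_operator T' X A'"
    and le: "\<And>f. f \<in> supported X \<Longrightarrow> T' f \<bullet> f \<le> T f \<bullet> f + c * (f \<bullet> f)"
    and nd: "l2_operator.negdim T X s j"
  shows "l2_operator.negdim T' X (s + c) j"
proof -
  interpret A: l2_operator T X A by fact
  interpret A': l2_operator T' X A' by fact
  obtain g where g: "\<forall>i<j. g i \<in> supported X"
    "\<And>c. \<exists>i<j. c i \<noteq> 0 \<Longrightarrow>
       T (\<Sum>i<j. csc (c i) (g i)) \<bullet> (\<Sum>i<j. csc (c i) (g i)) <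
       s * ((\<Sum>i<j. csc (c i) (g i)) \<bullet> (\<Sum>i<j. csc (c i) (g i)))"
    using nd unfolding A.negdim_def by blast
  show ?thesis unfolding A'.negdim_def
  proof (intro exI[of _ g] conjI g(1) allI impI)
    fix c' :: "nat \<Rightarrow> complex" assume "\<exists>i<j. c' i \<noteq> 0"
    let ?f = "\<Sum>i<j. csc (c' i) (g i)"
    have "T ?f \<bullet> ?f < s * (?f \<bullet> ?f)" using g(2)[OF \<open>\<exists>i<j. c' i \<noteq> 0\<close>] .
    moreover have "?f \<in> supported X"
      using g(1) by (intro subspace_sum subspace_supported csc_supported) auto
    ultimately show "T' ?f \<bullet> ?f < (s + c) * (?f \<bullet> ?f)" using le[of ?f] by (simp add: distrib_right)
  qed
qed

section \<open>Schroedinger operators on graphs of bounded degree\<close>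

definition diag_op :: "('a \<Rightarrow> real) \<Rightarrow> 'a ell2 \<Rightarrow> 'a ell2" where
  "diag_op m f = ell2_of (\<lambda>v. complex_of_real (m v) * fun_of f v)"

locale bounded_symbol =
  fixes m :: "'a \<Rightarrow> real" and K :: real
  assumes m_bounded: "\<bar>m v\<bar> \<le> K"
begin

lemma norm_mult_sq_le: "(cmod (complex_of_real (m v) * z))\<^sup>2 \<le> K\<^sup>2 * (cmod z)\<^sup>2"
  using power_mono[OF m_bounded[of v], of 2] by (simp add: norm_mult power_mult_distrib mult_right_mono)

lemma fun_of_diag_op: "fun_of (diag_op m f) v = complex_of_real (m v) * fun_of f v"
proof -
  have "(\<lambda>v. (cmod (complex_of_real (m v) * fun_of f v))\<^sup>2) summable_on UNIV"
    by (rule summable_on_comparison_test[OF summable_on_cmult_right[OF fun_of_summable[of f], of "K\<^sup>2"]])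
      (auto intro: norm_mult_sq_le)
  then show ?thesis by (simp add: diag_op_def ell2_of_inverse)
qed

lemma K_nonneg: "0 \<le> K" using m_bounded[of undefined] by linarith

lemma norm_diag_op: "norm (diag_op m f) \<le> K * norm f"
proof (rule power2_le_imp_le)
  have "(norm (diag_op m f))\<^sup>2 \<le> (\<Sum>\<^sub>\<infinity>v. K\<^sup>2 * (cmod (fun_of f v))\<^sup>2)"
    unfolding norm_ell2_sq
    by (intro infsum_mono fun_of_summable summable_on_cmult_right) (simp add: fun_of_diag_op norm_mult_sq_le)
  then show "(norm (diag_op m f))\<^sup>2 \<le> (K * norm f)\<^sup>2"
    by (simp add: infsum_cmult_right' power_mult_distrib flip: norm_ell2_sq)
  show "0 \<le> K * norm f" using K_nonneg by simp
qed

lemma bounded_linear_diag_op: "bounded_linear (diag_op m)"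
proof (rule bounded_linear_intro)
  show "norm (diag_op m f) \<le> norm f * K" for f using norm_diag_op[of f] by (simp only: mult.commute)
qed (rule ell2_eqI, simp add: fun_of_diag_op algebra_simps)+

lemma diag_op_inner: "diag_op m f \<bullet> g = (\<Sum>\<^sub>\<infinity>v. m v * (fun_of f v \<bullet> fun_of g v))"
  unfolding inner_ell2_def fun_of_diag_op
  by (simp add: scaleR_conv_of_real[symmetric])

lemma diag_op_sym: "diag_op m f \<bullet> g = f \<bullet> diag_op m g"
  unfolding inner_commute[of f "diag_op m g"] diag_op_inner by (simp add: inner_commute)

lemma diag_op_csc: "diag_op m (csc c f) = csc c (diag_op m f)"
  by (rule ell2_eqI) (simp add: fun_of_diag_op)

lemma diag_op_form: "diag_op m f \<bullet> f = (\<Sum>\<^sub>\<infinity>v. m v * (cmod (fun_of f v))\<^sup>2)"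
  by (simp add: diag_op_inner power2_norm_eq_inner)

end

text \<open>A common frame for the periodic graph, its fibers, the bridgeless cylinder and the
  bridges alone. The reversal \<open>\<sigma>\<close> is a bijection rather than an involution: it
  serves to reindex sums over edges.\<close>

locale edge_system =
  fixes X :: "'v set" and E :: "'e set" and s b :: "'e \<Rightarrow> 'v" and \<kappa> :: "'e \<Rightarrow> complex"
    and \<sigma> :: "'e \<Rightarrow> 'e" and D :: nat
  assumes s_in: "e \<in> E \<Longrightarrow> s e \<in> X"
    and bij: "bij_betw \<sigma> E E"
    and s_\<sigma>: "e \<in> E \<Longrightarrow> s (\<sigma> e) = b e"
    and b_\<sigma>: "e \<in> E \<Longrightarrow> b (\<sigma> e) = s e"
    and \<kappa>_\<sigma>: "e \<in> E \<Longrightarrow> \<kappa> (\<sigma> e) = cnj (\<kappa> e)"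
    and \<kappa>_norm: "e \<in> E \<Longrightarrow> cmod (\<kappa> e) = 1"
    and fin: "finite {e\<in>E. s e = v}"
    and deg_le: "card {e\<in>E. s e = v} \<le> D"
begin

abbreviation out where "out v \<equiv> {e\<in>E. s e = v}"

definition deg :: "'v \<Rightarrow> real" where "deg v = real (card (out v))"

sublocale deg: bounded_symbol deg "real D"
  by unfold_locales (use deg_le in \<open>auto simp: deg_def\<close>)

lemma out_outside: "v \<notin> X \<Longrightarrow> out v = {}" using s_in by auto

lemma edge_sum:
  fixes F :: "'e \<Rightarrow> real"
  assumes "F summable_on E"
  shows "(\<Sum>\<^sub>\<infinity>v. \<Sum>e\<in>out v. F e) = (\<Sum>\<^sub>\<infinity>e\<in>E. F e)" "(\<lambda>v. \<Sum>e\<in>out v. F e) summable_on UNIV"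
proof -
  have bij': "bij_betw snd (Sigma UNIV out) E"
    by (rule bij_betwI[where g="\<lambda>e. (s e, e)"]) auto
  have "(\<lambda>p. F (snd p)) summable_on (Sigma UNIV out)"
    using assms summable_on_reindex_bij_betw[OF bij', of F] by simp
  then have sm: "(\<lambda>(v, e). F e) summable_on (Sigma UNIV out)" by (simp only: case_prod_beta')
  have "(\<Sum>\<^sub>\<infinity>v. \<Sum>\<^sub>\<infinity>e\<in>out v. F e) = infsum (\<lambda>(v, e). F e) (Sigma UNIV out)"
    by (rule infsum_Sigma'_banach[OF sm])
  also have "\<dots> = infsum (\<lambda>p. F (snd p)) (Sigma UNIV out)" by (simp only: case_prod_beta')
  also have "\<dots> = (\<Sum>\<^sub>\<infinity>e\<in>E. F e)" by (rule infsum_reindex_bij_betw[OF bij'])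
  finally show "(\<Sum>\<^sub>\<infinity>v. \<Sum>e\<in>out v. F e) = (\<Sum>\<^sub>\<infinity>e\<in>E. F e)" using fin by simp
  show "(\<lambda>v. \<Sum>e\<in>out v. F e) summable_on UNIV"
    using summable_on_Sigma_banach[OF sm] fin by simp
qed

lemma src_summable:
  fixes f :: "'v ell2"
  shows "(\<lambda>e. (cmod (fun_of f (s e)))\<^sup>2) summable_on E"
proof (rule nonneg_bdd_above_summable_on)
  show "bdd_above (sum (\<lambda>e. (cmod (fun_of f (s e)))\<^sup>2) ` {F. F \<subseteq> E \<and> finite F})"
  proof (rule bdd_aboveI2)
    fix F assume "F \<in> {F. F \<subseteq> E \<and> finite F}"
    then have F: "F \<subseteq> E" "finite F" by auto
    have "(\<Sum>e\<in>F. (cmod (fun_of f (s e)))\<^sup>2) = (\<Sum>v\<in>s ` F. \<Sum>e\<in>{e\<in>F. s e = v}. (cmod (fun_of f (s e)))\<^sup>2)"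
      by (rule sum.image_gen[OF F(2)])
    also have "\<dots> \<le> (\<Sum>v\<in>s ` F. real D * (cmod (fun_of f v))\<^sup>2)"
    proof (rule sum_mono)
      fix v
      have "(\<Sum>e\<in>{e\<in>F. s e = v}. (cmod (fun_of f (s e)))\<^sup>2) = real (card {e\<in>F. s e = v}) * (cmod (fun_of f v))\<^sup>2"
        by simp
      also have "\<dots> \<le> real D * (cmod (fun_of f v))\<^sup>2"
      proof (rule mult_right_mono)
        have "card {e\<in>F. s e = v} \<le> card (out v)" using F fin by (intro card_mono) auto
        then show "real (card {e\<in>F. s e = v}) \<le> real D" using deg_le[of v] by linarith
      qed simp
      finally show "(\<Sum>e\<in>{e\<in>F. s e = v}. (cmod (fun_of f (s e)))\<^sup>2) \<le> real D * (cmod (fun_of f v))\<^sup>2" .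
    qed
    also have "\<dots> \<le> real D * (norm f)\<^sup>2"
      unfolding sum_distrib_left[symmetric] norm_ell2_sq using F(2)
      by (intro mult_left_mono finite_sum_le_infsum fun_of_summable) auto
    finally show "(\<Sum>e\<in>F. (cmod (fun_of f (s e)))\<^sup>2) \<le> real D * (norm f)\<^sup>2" .
  qed
qed auto

lemma src_sum: "(\<Sum>\<^sub>\<infinity>e\<in>E. (cmod (fun_of f (s e)))\<^sup>2) = diag_op deg f \<bullet> f"
proof -
  have "(\<Sum>e\<in>out v. (cmod (fun_of f (s e)))\<^sup>2) = deg v * (cmod (fun_of f v))\<^sup>2" for v
    by (simp add: deg_def)
  then show ?thesis using edge_sum(1)[OF src_summable[of f]] by (simp only: deg.diag_op_form)
qed

text \<open>The degree bound concerns outgoing edges; sums over end points are brought to that case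
  by reindexing with \<open>\<sigma>\<close>.\<close>

lemma tgt_summable: "(\<lambda>e. (cmod (fun_of f (b e)))\<^sup>2) summable_on E"
  and tgt_sum: "(\<Sum>\<^sub>\<infinity>e\<in>E. (cmod (fun_of f (b e)))\<^sup>2) = diag_op deg f \<bullet> f"
proof -
  have "(\<lambda>e. (cmod (fun_of f (s (\<sigma> e))))\<^sup>2) summable_on E"
    using summable_on_reindex_bij_betw[OF bij, of "\<lambda>e. (cmod (fun_of f (s e)))\<^sup>2"] src_summable by simp
  then show "(\<lambda>e. (cmod (fun_of f (b e)))\<^sup>2) summable_on E"
    by (rule summable_on_cong[THEN iffD1, rotated]) (simp add: s_\<sigma>)
  have "(\<Sum>\<^sub>\<infinity>e\<in>E. (cmod (fun_of f (b e)))\<^sup>2) = (\<Sum>\<^sub>\<infinity>e\<in>E. (cmod (fun_of f (s (\<sigma> e))))\<^sup>2)"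
    by (rule infsum_cong) (simp add: s_\<sigma>)
  also have "\<dots> = (\<Sum>\<^sub>\<infinity>e\<in>E. (cmod (fun_of f (s e)))\<^sup>2)"
    by (rule infsum_reindex_bij_betw[OF bij])
  finally show "(\<Sum>\<^sub>\<infinity>e\<in>E. (cmod (fun_of f (b e)))\<^sup>2) = diag_op deg f \<bullet> f" by (simp add: src_sum)
qed

lemma deg_form_le: "diag_op deg f \<bullet> f \<le> real D * (f \<bullet> f)"
proof -
  have "diag_op deg f \<bullet> f \<le> norm (diag_op deg f) * norm f" by (rule norm_cauchy_schwarz)
  also have "\<dots> \<le> (real D * norm f) * norm f" by (intro mult_right_mono deg.norm_diag_op) auto
  finally show ?thesis by (simp add: power2_norm_eq_inner[symmetric] power2_eq_square)
qed

definition adj :: "'v ell2 \<Rightarrow> 'v ell2" where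
  "adj f = ell2_of (\<lambda>v. \<Sum>e\<in>out v. \<kappa> e * fun_of f (b e))"

lemma norm_adj_sum_le: "(cmod (\<Sum>e\<in>out v. \<kappa> e * fun_of f (b e)))\<^sup>2 \<le> real D * (\<Sum>e\<in>out v. (cmod (fun_of f (b e)))\<^sup>2)"
proof -
  have "cmod (\<Sum>e\<in>out v. \<kappa> e * fun_of f (b e)) \<le> (\<Sum>e\<in>out v. cmod (fun_of f (b e)))"
    by (rule order_trans[OF norm_sum]) (auto intro!: sum_mono simp: norm_mult \<kappa>_norm)
  then have "(cmod (\<Sum>e\<in>out v. \<kappa> e * fun_of f (b e)))\<^sup>2 \<le> (\<Sum>e\<in>out v. cmod (fun_of f (b e)))\<^sup>2"
    by (intro power_mono) auto
  also have "\<dots> \<le> (\<Sum>e\<in>out v. (cmod (fun_of f (b e)))\<^sup>2) * real (card (out v))"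
    by (rule sum_squared_le_sum_of_squares)
  also have "\<dots> \<le> (\<Sum>e\<in>out v. (cmod (fun_of f (b e)))\<^sup>2) * real D"
    using deg_le by (intro mult_left_mono sum_nonneg) auto
  finally show ?thesis by (simp add: mult.commute)
qed

lemma fun_of_adj: "fun_of (adj f) v = (\<Sum>e\<in>out v. \<kappa> e * fun_of f (b e))"
proof -
  have "(\<lambda>v. (cmod (\<Sum>e\<in>out v. \<kappa> e * fun_of f (b e)))\<^sup>2) summable_on UNIV"
    by (rule summable_on_comparison_test[OF summable_on_cmult_right[OF edge_sum(2)[OF tgt_summable[of f]], of "real D"]])
      (auto intro: norm_adj_sum_le)
  then show ?thesis by (simp add: adj_def ell2_of_inverse)
qed

lemma norm_adj: "norm (adj f) \<le> real D * norm f"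
proof (rule power2_le_imp_le)
  have "(norm (adj f))\<^sup>2 \<le> (\<Sum>\<^sub>\<infinity>v. real D * (\<Sum>e\<in>out v. (cmod (fun_of f (b e)))\<^sup>2))"
    unfolding norm_ell2_sq
    by (intro infsum_mono fun_of_summable summable_on_cmult_right edge_sum(2) tgt_summable)
      (simp add: fun_of_adj norm_adj_sum_le)
  also have "\<dots> = real D * (diag_op deg f \<bullet> f)"
    by (simp add: infsum_cmult_right' edge_sum(1)[OF tgt_summable] tgt_sum)
  also have "\<dots> \<le> real D * (real D * (f \<bullet> f))" by (intro mult_left_mono deg_form_le) auto
  finally show "(norm (adj f))\<^sup>2 \<le> (real D * norm f)\<^sup>2"
    by (simp add: power_mult_distrib power2_eq_square[of "real D"] power2_norm_eq_inner)
qed simp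

lemma bounded_linear_adj: "bounded_linear adj"
proof (rule bounded_linear_intro)
  show "norm (adj f) \<le> norm f * real D" for f using norm_adj[of f] by (simp only: mult.commute)
qed (rule ell2_eqI, simp add: fun_of_adj algebra_simps sum.distrib sum_distrib_left)+

lemma adj_csc: "adj (csc c f) = csc c (adj f)"
  by (rule ell2_eqI) (simp add: fun_of_adj sum_distrib_left mult.left_commute)

lemma edge_inner_bound:
  assumes "e \<in> E"
  shows "\<bar>(\<kappa> e * fun_of f (b e)) \<bullet> fun_of g (s e)\<bar> \<le> ((cmod (fun_of f (b e)))\<^sup>2 + (cmod (fun_of g (s e)))\<^sup>2) / 2"
proof -
  have "\<bar>(\<kappa> e * fun_of f (b e)) \<bullet> fun_of g (s e)\<bar> \<le> cmod (fun_of f (b e)) * cmod (fun_of g (s e))"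
    using Cauchy_Schwarz_ineq2[of "\<kappa> e * fun_of f (b e)" "fun_of g (s e)"] \<kappa>_norm[OF assms]
    by (simp add: norm_mult)
  also have "\<dots> \<le> ((cmod (fun_of f (b e)))\<^sup>2 + (cmod (fun_of g (s e)))\<^sup>2) / 2"
    using sum_squares_bound[of "cmod (fun_of f (b e))" "cmod (fun_of g (s e))"] by simp
  finally show ?thesis .
qed

lemma edge_bound_summable:
  "(\<lambda>e. ((cmod (fun_of f (b e)))\<^sup>2 + (cmod (fun_of g (s e)))\<^sup>2) / 2) summable_on E"
  using summable_on_cmult_left[OF summable_on_add[OF tgt_summable[of f] src_summable[of g]], of "1/2"]
  by simp

lemma edge_inner_abs_summable: "(\<lambda>e. \<bar>(\<kappa> e * fun_of f (b e)) \<bullet> fun_of g (s e)\<bar>) summable_on E"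
  by (rule summable_on_comparison_test[OF edge_bound_summable[of f g]]) (simp_all only: edge_inner_bound abs_ge_zero)

lemma edge_inner_summable: "(\<lambda>e. (\<kappa> e * fun_of f (b e)) \<bullet> fun_of g (s e)) summable_on E"
  by (rule abs_summable_summable) (use edge_inner_abs_summable[of f g] in simp)

text \<open>The arithmetic-geometric mean inequality on each edge. A vertex is the source of
  \<open>deg\<close> edges and the end of \<open>deg\<close> edges, so the two halves add up to
  exactly the degree form.\<close>

lemma edge_inner_abs_sum_le: "(\<Sum>\<^sub>\<infinity>e\<in>E. \<bar>(\<kappa> e * fun_of f (b e)) \<bullet> fun_of f (s e)\<bar>) \<le> diag_op deg f \<bullet> f"
proof -
  have "(\<Sum>\<^sub>\<infinity>e\<in>E. \<bar>(\<kappa> e * fun_of f (b e)) \<bullet> fun_of f (s e)\<bar>) \<le>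
        (\<Sum>\<^sub>\<infinity>e\<in>E. ((cmod (fun_of f (b e)))\<^sup>2 + (cmod (fun_of f (s e)))\<^sup>2) * (1/2))"
    using edge_bound_summable[of f f] edge_inner_abs_summable[of f f]
    by (intro infsum_mono) (auto dest: edge_inner_bound[of _ f f])
  also have "\<dots> = diag_op deg f \<bullet> f"
    by (subst infsum_cmult_left') (simp add: infsum_add tgt_summable src_summable tgt_sum src_sum)
  finally show ?thesis .
qed

lemma adj_inner: "adj f \<bullet> g = (\<Sum>\<^sub>\<infinity>e\<in>E. (\<kappa> e * fun_of f (b e)) \<bullet> fun_of g (s e))"
proof -
  have "adj f \<bullet> g = (\<Sum>\<^sub>\<infinity>v. \<Sum>e\<in>out v. (\<kappa> e * fun_of f (b e)) \<bullet> fun_of g (s e))"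
    unfolding inner_ell2_def fun_of_adj inner_sum_left by (intro infsum_cong sum.cong) auto
  also have "\<dots> = (\<Sum>\<^sub>\<infinity>e\<in>E. (\<kappa> e * fun_of f (b e)) \<bullet> fun_of g (s e))"
    by (rule edge_sum(1)[OF edge_inner_summable])
  finally show ?thesis .
qed

text \<open>Reversing every edge by \<open>\<sigma>\<close> swaps its ends and conjugates its
  phase.\<close>

lemma adj_sym: "adj f \<bullet> g = f \<bullet> adj g"
proof -
  have "adj f \<bullet> g = (\<Sum>\<^sub>\<infinity>e\<in>E. (\<kappa> (\<sigma> e) * fun_of f (b (\<sigma> e))) \<bullet> fun_of g (s (\<sigma> e)))"
    unfolding adj_inner by (rule infsum_reindex_bij_betw[OF bij, symmetric])
  also have "\<dots> = (\<Sum>\<^sub>\<infinity>e\<in>E. (\<kappa> e * fun_of g (b e)) \<bullet> fun_of f (s e))"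
    by (rule infsum_cong) (simp add: s_\<sigma> b_\<sigma> \<kappa>_\<sigma> inner_complex_def algebra_simps)
  also have "\<dots> = f \<bullet> adj g" by (simp add: inner_commute[of f] adj_inner)
  finally show ?thesis .
qed

text \<open>It places the form of degree minus adjacency between 0 and twice the degree form, the
  origin of the factor 2 in the theorem.\<close>

lemma abs_adj_form_le: "\<bar>adj f \<bullet> f\<bar> \<le> diag_op deg f \<bullet> f"
proof -
  have "\<bar>adj f \<bullet> f\<bar> \<le> (\<Sum>\<^sub>\<infinity>e\<in>E. \<bar>(\<kappa> e * fun_of f (b e)) \<bullet> fun_of f (s e)\<bar>)"
    unfolding adj_inner using norm_infsum_bound[of "\<lambda>e. (\<kappa> e * fun_of f (b e)) \<bullet> fun_of f (s e)" E]
      edge_inner_abs_summable[of f f] by simp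
  then show ?thesis using edge_inner_abs_sum_le[of f] by linarith
qed

end

text \<open>Potential and degree both vanish outside \<open>X\<close>, so the operator maps into
  \<open>supported X\<close>, as \<open>l2_operator\<close> demands.\<close>

locale schroedinger = edge_system X E s b \<kappa> \<sigma> D
  for X :: "'v set" and E :: "'e set" and s b \<kappa> \<sigma> D +
  fixes U :: "'v \<Rightarrow> real" and C :: real
  assumes U_bounded: "\<bar>U v\<bar> \<le> C" and U_outside: "v \<notin> X \<Longrightarrow> U v = 0"
begin

sublocale U: bounded_symbol U C
  by unfold_locales (rule U_bounded)

definition ham :: "'v ell2 \<Rightarrow> 'v ell2" where
  "ham f = diag_op deg f + diag_op U f - adj f"

lemma fun_of_ham:
  "fun_of (ham f) v = (\<Sum>e\<in>out v. fun_of f v - \<kappa> e * fun_of f (b e)) + complex_of_real (U v) * fun_of f v"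
  by (simp add: ham_def fun_of_adj deg.fun_of_diag_op U.fun_of_diag_op deg_def sum_subtractf)

lemma ham_supported: "ham f \<in> supported X"
  by (simp add: supported_def fun_of_ham U_outside out_outside del: Collect_empty_eq)

lemma ham_csc: "ham (csc c f) = csc c (ham f)"
  by (simp add: ham_def deg.diag_op_csc U.diag_op_csc adj_csc csc_simps)

lemma symmetric_ham: "symmetric_operator_hilbert ham"
proof (intro symmetric_operator_hilbert.intro symmetric_operator.intro)
  show "bounded_linear ham"
    unfolding ham_def[abs_def]
    by (intro bounded_linear_sub bounded_linear_add deg.bounded_linear_diag_op
        U.bounded_linear_diag_op bounded_linear_adj)
  show "ham f \<bullet> g = f \<bullet> ham g" for f g
    by (simp add: ham_def inner_add_left inner_add_right inner_diff_left inner_diff_right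
        deg.diag_op_sym U.diag_op_sym adj_sym)
qed

lemma ham_form: "ham f \<bullet> f = diag_op deg f \<bullet> f + diag_op U f \<bullet> f - adj f \<bullet> f"
  by (simp add: ham_def inner_add_left inner_diff_left)

end

section \<open>Periodic graphs and their cylinders\<close>

text \<open>Periodicity is given for single lattice steps; this reaches every lattice vector, one
  coordinate after another, by steps of either sign.\<close>

lemma int_vector_induct [consumes 1, case_names zero plus minus]:
  fixes n :: "nat \<Rightarrow> int"
  assumes supp: "\<forall>i\<ge>m. n i = 0"
    and "P (\<lambda>_. 0)"
    and plus: "\<And>n s. s < m \<Longrightarrow> P n \<Longrightarrow> P (n(s := n s + 1))"
    and minus: "\<And>n s. s < m \<Longrightarrow> P n \<Longrightarrow> P (n(s := n s - 1))"
  shows "P n"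
proof -
  have "\<forall>n. (\<forall>i\<ge>k. n i = 0) \<longrightarrow> P n" if "k \<le> m" for k
    using that
  proof (induction k)
    case 0
    have "n = (\<lambda>_. 0)" if "\<forall>i\<ge>0. n i = 0" for n :: "nat \<Rightarrow> int" using that by auto
    then show ?case using assms(2) by metis
  next
    case (Suc k)
    show ?case
    proof (intro allI impI)
      fix n :: "nat \<Rightarrow> int" assume n: "\<forall>i\<ge>Suc k. n i = 0"
      have "P (n(k := l))" for l
      proof (induction l rule: int_induct[where k=0])
        case base
        have "\<forall>i\<ge>k. (n(k := 0)) i = 0" using n by auto
        then show ?case using Suc by auto
      next
        case (step1 l)
        then have "P (n(k := l))" by (simp only: fun_upd_def)
        then have "P ((n(k := l))(k := (n(k := l)) k + 1))" using Suc.prems by (intro plus) auto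
        then have "P (n(k := l + 1))" by (simp only: fun_upd_upd fun_upd_same)
        then show ?case by (simp only: fun_upd_def)
      next
        case (step2 l)
        then have "P (n(k := l))" by (simp only: fun_upd_def)
        then have "P ((n(k := l))(k := (n(k := l)) k - 1))" using Suc.prems by (intro minus) auto
        then have "P (n(k := l - 1))" by (simp only: fun_upd_upd fun_upd_same)
        then show ?case by (simp only: fun_upd_def)
      qed
      from this[of "n k"] show "P n" by simp
    qed
  qed
  then show ?thesis using supp by blast
qed

section \<open>Integer translations, cells and Bloch phases\<close>

definition shift :: "(nat \<Rightarrow> int) \<Rightarrow> pt \<Rightarrow> pt" where
  "shift n p = (\<lambda>i. p i + of_int (n i))"

lemma shift_0: "shift (\<lambda>_. 0) p = p" by (simp add: shift_def)

lemma shift_plus: "shift (n(s := n s + 1)) p = unitshift s (shift n p)"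
  by (auto simp: shift_def unitshift_def fun_eq_iff)

lemma shift_minus: "unitshift s (shift (n(s := n s - 1)) p) = shift n p"
  by (auto simp: shift_def unitshift_def fun_eq_iff)

lemma unitshift_inject: "unitshift s p = unitshift s q \<longleftrightarrow> p = q"
proof
  assume eq: "unitshift s p = unitshift s q"
  show "p = q"
  proof
    fix i show "p i = q i" using fun_cong[OF eq, of i] by (cases "i = s") (auto simp: unitshift_def)
  qed
qed simp

lemma shift_inject: "shift n p = shift n q \<longleftrightarrow> p = q"
  by (auto simp: shift_def fun_eq_iff)

lemma cell_outside: "d \<le> i \<Longrightarrow> cell d p i = 0" by (simp add: cell_def)

lemma cell_shift: "cell d (shift n p) = (\<lambda>i. cell d p i + (if i < d then n i else 0))"
  by (auto simp: cell_def shift_def fun_eq_iff)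

lemma base_eq_shift: "base d p = shift (\<lambda>i. - cell d p i) p"
  by (auto simp: base_def cell_def shift_def fun_eq_iff)

lemma base_shift:
  assumes "\<And>i. d \<le> i \<Longrightarrow> n i = 0"
  shows "base d (shift n p) = base d p"
  using assms by (auto simp: base_def shift_def fun_eq_iff not_less)

lemma shift_cell_base: "shift (cell d p) (base d p) = p"
  by (auto simp: base_def cell_def shift_def fun_eq_iff)

lemma Vcyl_iff: "v \<in> Vcyl d V \<longleftrightarrow> v \<in> V \<and> cell d v = (\<lambda>_. 0)"
  by (auto simp: Vcyl_def cell_def fun_eq_iff floor_eq_iff)

lemma cell_base: "cell d (base d p) = (\<lambda>_. 0)"
  by (auto simp: base_def cell_def fun_eq_iff)

lemma base_Vcyl: "v \<in> Vcyl d V \<Longrightarrow> base d v = v"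
  by (simp add: Vcyl_iff base_eq_shift shift_0)

lemma ipd_add: "ipd d (\<lambda>i. m i + n i) \<theta> = ipd d m \<theta> + ipd d n \<theta>"
  by (simp add: ipd_def sum.distrib algebra_simps)

lemma ipd_uminus: "ipd d (\<lambda>i. - n i) \<theta> = - ipd d n \<theta>"
  by (simp add: ipd_def sum_negf)

definition phase :: "nat \<Rightarrow> (nat \<Rightarrow> real) \<Rightarrow> (nat \<Rightarrow> int) \<Rightarrow> complex" where
  "phase d \<theta> n = exp (\<i> * complex_of_real (ipd d n \<theta>))"

lemma cmod_phase [simp]: "cmod (phase d \<theta> n) = 1"
  by (simp add: phase_def)

lemma phase_add: "phase d \<theta> (\<lambda>i. m i + n i) = phase d \<theta> m * phase d \<theta> n"
  by (simp add: phase_def ipd_add algebra_simps exp_add)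

lemma phase_uminus: "phase d \<theta> (\<lambda>i. - n i) = cnj (phase d \<theta> n)"
  by (simp add: phase_def ipd_uminus exp_cnj)

lemma phase_0 [simp]: "phase d \<theta> (\<lambda>_. 0) = 1"
  by (simp add: phase_def ipd_def)

lemma unit_mult_inner: "cmod c = 1 \<Longrightarrow> (c * z) \<bullet> (c * w) = z \<bullet> (w :: complex)"
proof -
  assume "cmod c = 1"
  then have "(Re c)\<^sup>2 + (Im c)\<^sup>2 = 1" by (simp add: cmod_def)
  moreover have "(c * z) \<bullet> (c * w) = ((Re c)\<^sup>2 + (Im c)\<^sup>2) * (z \<bullet> w)"
    by (simp add: inner_complex_def power2_eq_square algebra_simps)
  ultimately show ?thesis by simp
qed

locale periodic_graph =
  fixes dt d :: nat and V :: "pt set" and src tgt :: "'e \<Rightarrow> pt" and rev :: "'e \<Rightarrow> 'e"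
    and W :: "pt \<Rightarrow> real"
  assumes d_less: "d < dt"
    and V_infinite: "infinite V"
    and ends: "\<forall>e. src e \<in> V \<and> tgt e \<in> V"
    and revs: "\<forall>e. rev (rev e) = e \<and> rev e \<noteq> e \<and> src (rev e) = tgt e"
    and findeg: "\<forall>v. finite {e. src e = v}"
    and Vper: "\<forall>s<dt. \<forall>v. v \<in> V \<longleftrightarrow> unitshift s v \<in> V"
    and Eper: "\<forall>s<dt. \<exists>T. bij T \<and> (\<forall>e. src (T e) = unitshift s (src e)
                 \<and> tgt (T e) = unitshift s (tgt e) \<and> T (rev e) = rev (T e))"
    and finquot: "finite {v \<in> V. \<forall>i<dt. 0 \<le> v i \<and> v i < 1}"
    and Wper: "\<forall>s<dt. \<forall>v\<in>V. W (unitshift s v) = W v"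
begin

abbreviation X where "X \<equiv> Vcyl d V"
abbreviation \<tau> where "\<tau> \<equiv> tau d src tgt"

lemma tgt_rev: "tgt (rev e) = src e" using revs by metis

lemma V_shift:
  assumes "\<And>i. dt \<le> i \<Longrightarrow> n i = 0"
  shows "shift n v \<in> V \<longleftrightarrow> v \<in> V"
proof -
  have "\<forall>i\<ge>dt. n i = 0" using assms by simp
  then show ?thesis
  proof (induction n rule: int_vector_induct)
    case zero
    show ?case by (simp add: shift_0)
  next
    case (plus n s)
    then show ?case using Vper shift_plus[of n s v] by metis
  next
    case (minus n s)
    then show ?case using Vper shift_minus[of s n v] by metis
  qed
qed

lemma W_shift:
  assumes "\<And>i. dt \<le> i \<Longrightarrow> n i = 0" "v \<in> V"
  shows "shift n v \<in> V \<and> W (shift n v) = W v"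
proof -
  have "\<forall>i\<ge>dt. n i = 0" using assms(1) by simp
  then show ?thesis
  proof (induction n rule: int_vector_induct)
    case zero
    show ?case using assms(2) by (simp add: shift_0)
  next
    case (plus n s)
    then show ?case using Vper Wper shift_plus[of n s v] by metis
  next
    case (minus n s)
    then have "shift (n(s := n s - 1)) v \<in> V" using Vper shift_minus[of s n v] by metis
    then show ?case using minus Wper shift_minus[of s n v] by metis
  qed
qed

definition is_trans :: "(nat \<Rightarrow> int) \<Rightarrow> ('e \<Rightarrow> 'e) \<Rightarrow> bool" where
  "is_trans n T \<longleftrightarrow> bij T \<and> (\<forall>e. src (T e) = shift n (src e) \<and> tgt (T e) = shift n (tgt e))"

text \<open>One chosen edge translation per lattice vector, fixed by bijectivity and its effect on
  end points only; no composition law may be expected.\<close>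

definition trans :: "(nat \<Rightarrow> int) \<Rightarrow> 'e \<Rightarrow> 'e" where
  "trans n = (SOME T. is_trans n T)"

lemma trans:
  assumes "\<And>i. dt \<le> i \<Longrightarrow> n i = 0"
  shows "bij (trans n)" "src (trans n e) = shift n (src e)" "tgt (trans n e) = shift n (tgt e)"
proof -
  have "\<forall>i\<ge>dt. n i = 0" using assms by simp
  then have "\<exists>T. is_trans n T"
  proof (rule int_vector_induct[where P="\<lambda>n. \<exists>T. is_trans n T"])
    show "\<exists>T. is_trans (\<lambda>_. 0) T" by (rule exI[of _ id]) (simp add: is_trans_def shift_0)
  next
    fix n s assume s: "s < dt" and "\<exists>T. is_trans n T"
    then obtain T where T: "bij T" "\<And>e. src (T e) = shift n (src e)" "\<And>e. tgt (T e) = shift n (tgt e)"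
      unfolding is_trans_def by blast
    obtain T' where T': "bij T'" "\<forall>e. src (T' e) = unitshift s (src e) \<and> tgt (T' e) = unitshift s (tgt e)"
      using Eper s by blast
    have "is_trans (n(s := n s + 1)) (T' \<circ> T)"
      unfolding is_trans_def shift_plus using T T' by (simp add: bij_comp)
    then show "\<exists>T. is_trans (n(s := n s + 1)) T" by blast
    have T'_inv: "T' (inv T' e) = e" for e using T'(1) by (simp add: bij_is_surj surj_f_inv_f)
    have "unitshift s (src (inv T' (T e))) = unitshift s (shift (n(s := n s - 1)) (src e))"
      "unitshift s (tgt (inv T' (T e))) = unitshift s (shift (n(s := n s - 1)) (tgt e))" for e
      using T'(2)[rule_format, of "inv T' (T e)"] by (simp_all only: T'_inv shift_minus T)
    then have "is_trans (n(s := n s - 1)) (inv T' \<circ> T)"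
      unfolding is_trans_def unitshift_inject using T T' by (simp add: bij_comp bij_imp_bij_inv)
    then show "\<exists>T. is_trans (n(s := n s - 1)) T" by blast
  qed
  then have "is_trans n (trans n)" unfolding trans_def by (rule someI_ex)
  then show "bij (trans n)" "src (trans n e) = shift n (src e)" "tgt (trans n e) = shift n (tgt e)"
    unfolding is_trans_def by auto
qed

lemma trans_surj:
  assumes "\<And>i. dt \<le> i \<Longrightarrow> n i = 0"
  shows "\<exists>u. e = trans n u"
proof -
  have "bij (trans n)" by (rule trans) (rule assms)
  then show ?thesis by (simp add: bij_def surj_def)
qed

lemma tau_trans:
  assumes "\<And>i. dt \<le> i \<Longrightarrow> n i = 0"
  shows "\<tau> (trans n e) = \<tau> e"
  by (simp add: tau_def trans[OF assms] cell_shift)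

lemma tau_outside: "d \<le> i \<Longrightarrow> \<tau> e i = 0" by (simp add: tau_def cell_outside)

text \<open>The finite fundamental cell of the full lattice, whereas \<open>X\<close> belongs to the
  first \<open>d\<close> directions only. Uniform bounds on degrees, indices and \<open>W\<close>
  come from translating into it.\<close>

definition V0 where "V0 = {v \<in> V. \<forall>i<dt. 0 \<le> v i \<and> v i < 1}"
definition E0 where "E0 = {e. src e \<in> V0}"

lemma finite_V0: "finite V0" using finquot by (simp add: V0_def)

lemma finite_E0: "finite E0"
proof -
  have "E0 = (\<Union>v\<in>V0. {e. src e = v})" by (auto simp: E0_def)
  then show ?thesis using finite_V0 findeg by simp
qed

lemma base_V0: "v \<in> V \<Longrightarrow> shift (\<lambda>i. - cell dt v i) v \<in> V0"
  using V_shift[of "\<lambda>i. - cell dt v i" v] unfolding V0_def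
  by (auto simp: cell_outside) (auto simp: shift_def cell_def frac_lt_1 frac_def[symmetric])

lemma out_trans:
  assumes "\<And>i. dt \<le> i \<Longrightarrow> n i = 0"
  shows "bij_betw (trans n) {e. src e = v} {e. src e = shift n v}"
proof (rule bij_betw_imageI)
  show "inj_on (trans n) {e. src e = v}" using trans(1)[OF assms] by (meson bij_is_inj inj_on_subset subset_UNIV)
  show "trans n ` {e. src e = v} = {e. src e = shift n v}"
  proof safe
    fix e assume e: "src e = shift n v"
    obtain e' where e': "e = trans n e'" using trans_surj[of n e] assms by blast
    then have "src e' = v" using e trans(2)[OF assms] by (simp add: shift_inject)
    then show "e \<in> trans n ` {e. src e = v}" using e' by blast
  qed (simp add: trans[OF assms])
qed

text \<open>A crude degree bound, for boundedness and for boundary terms. The constant of the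
  theorem enters only for the bridges, as \<open>beta_plus\<close>.\<close>

definition D where "D = card E0"

lemma deg_le_D: "card {e. src e = v} \<le> D"
proof (cases "v \<in> V")
  case True
  let ?n = "\<lambda>i. - cell dt v i"
  have "card {e. src e = v} = card {e. src e = shift ?n v}"
    by (rule bij_betw_same_card[OF out_trans]) (simp add: cell_outside)
  also have "\<dots> \<le> D" unfolding D_def
    using base_V0[OF True] by (intro card_mono finite_E0) (auto simp: E0_def)
  finally show ?thesis .
next
  case False
  then have "{e. src e = v} = {}" using ends by auto
  then show ?thesis by simp
qed

text \<open>Every edge is a translate of one in \<open>E0\<close>, with the same index. The range
  \<open>r\<close> later fixes the width of the boundary layer of a box.\<close>

lemma tau_bound:
  obtains r :: nat where "\<And>e i. \<bar>\<tau> e i\<bar> \<le> int r"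
proof
  fix e i
  let ?n = "\<lambda>i. - cell dt (src e) i"
  have n: "\<And>i. dt \<le> i \<Longrightarrow> ?n i = 0" by (simp add: cell_outside)
  have e0: "trans ?n e \<in> E0" using base_V0 ends by (simp add: E0_def trans[OF n])
  show "\<bar>\<tau> e i\<bar> \<le> int (nat (\<Sum>e\<in>E0. \<Sum>i<d. \<bar>\<tau> e i\<bar>))"
  proof (cases "i < d")
    case True
    have "\<bar>\<tau> (trans ?n e) i\<bar> \<le> (\<Sum>i<d. \<bar>\<tau> (trans ?n e) i\<bar>)"
      using True by (intro member_le_sum) auto
    also have "\<dots> \<le> (\<Sum>e\<in>E0. \<Sum>i<d. \<bar>\<tau> e i\<bar>)"
      using e0 finite_E0 by (intro member_le_sum[where f="\<lambda>e. \<Sum>i<d. \<bar>\<tau> e i\<bar>"]) (auto intro: sum_nonneg)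
    finally have "\<bar>\<tau> e i\<bar> \<le> (\<Sum>e\<in>E0. \<Sum>i<d. \<bar>\<tau> e i\<bar>)" by (simp only: tau_trans[OF n])
    then show ?thesis by linarith
  qed (simp add: tau_outside)
qed

lemma W_bound: "v \<in> V \<Longrightarrow> \<bar>W v\<bar> \<le> (\<Sum>v\<in>V0. \<bar>W v\<bar>)"
proof -
  assume v: "v \<in> V"
  let ?n = "\<lambda>i. - cell dt v i"
  have "W v = W (shift ?n v)" using W_shift[OF _ v, of ?n] by (simp add: cell_outside)
  moreover have "\<bar>W (shift ?n v)\<bar> \<le> (\<Sum>v\<in>V0. \<bar>W v\<bar>)"
    using base_V0[OF v] finite_V0 by (intro member_le_sum[where f="\<lambda>v. \<bar>W v\<bar>"]) auto
  ultimately show ?thesis by simp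
qed

lemma base_in_X: "v \<in> V \<Longrightarrow> base d v \<in> X"
  using V_shift[of "\<lambda>i. - cell d v i" v] d_less
  by (simp add: Vcyl_iff cell_base) (simp add: base_eq_shift cell_outside)

text \<open>As \<open>d < dt\<close>, the lattice step in coordinate \<open>d\<close> acts inside
  the cylinder and moves a vertex through infinitely many positions.\<close>

lemma X_infinite: "infinite X"
proof -
  have "V \<noteq> {}" using V_infinite by auto
  then obtain v where "v \<in> V" by blast
  then have x: "base d v \<in> X" by (rule base_in_X)
  define g where "g k = shift ((\<lambda>_. 0)(d := int k)) (base d v)" for k :: nat
  have "g k \<in> X" for k
    using x d_less V_shift[of "(\<lambda>_. 0)(d := int k)" "base d v"]
    by (auto simp: g_def Vcyl_iff cell_shift fun_eq_iff)
  moreover have "inj g"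
  proof (rule injI)
    fix k l assume "g k = g l"
    from fun_cong[OF this, of d] show "k = l" by (simp add: g_def shift_def)
  qed
  ultimately show ?thesis by (meson infinite_iff_countable_subset image_subsetI)
qed

lemma tau_X: "src e \<in> X \<Longrightarrow> \<tau> e = cell d (tgt e)"
  by (simp add: tau_def Vcyl_iff)

text \<open>The translations of different coordinate directions need not commute on edges, so this
  inversion of the cylinder's edges is a bijection but in general not an involution.\<close>

definition inversion :: "'e \<Rightarrow> 'e" where
  "inversion e = trans (\<lambda>i. - cell d (tgt e) i) (rev e)"

lemma neg_cell_outside: "dt \<le> i \<Longrightarrow> - cell d p i = 0" using d_less by (simp add: cell_outside)

lemma inversion:
  assumes "src e \<in> X"
  shows "src (inversion e) = base d (tgt e)" "src (inversion e) \<in> X"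
    "base d (tgt (inversion e)) = src e" "\<tau> (inversion e) = (\<lambda>i. - \<tau> e i)"
proof -
  show s: "src (inversion e) = base d (tgt e)"
    using revs by (simp add: inversion_def trans(2)[OF neg_cell_outside] base_eq_shift)
  then show "src (inversion e) \<in> X" using ends base_in_X by simp
  have t: "tgt (inversion e) = shift (\<lambda>i. - cell d (tgt e) i) (src e)"
    by (simp add: inversion_def trans(3)[OF neg_cell_outside] tgt_rev)
  then show "base d (tgt (inversion e)) = src e"
    using assms base_shift[of d "\<lambda>i. - cell d (tgt e) i" "src e"] by (simp add: cell_outside base_Vcyl)
  show "\<tau> (inversion e) = (\<lambda>i. - \<tau> e i)"
    using assms unfolding tau_def s t cell_base cell_shift by (auto simp: Vcyl_iff cell_outside)
qed

text \<open>Injectivity: the index is negated, so \<open>inversion e\<close> reveals which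
  translation was applied to \<open>rev e\<close>. Surjectivity: if \<open>u\<close> is
  \<open>e\<close> moved back until its end lies in \<open>X\<close>, then \<open>rev u\<close>
  starts in \<open>X\<close> and is sent to \<open>e\<close>.\<close>

lemma inversion_bij: "bij_betw inversion {e. src e \<in> X} {e. src e \<in> X}"
proof (rule bij_betw_imageI)
  show "inj_on inversion {e. src e \<in> X}"
  proof (rule inj_onI)
    fix e e' assume e: "e \<in> {e. src e \<in> X}" "e' \<in> {e. src e \<in> X}" "inversion e = inversion e'"
    then have "(\<lambda>i. - \<tau> e i) = (\<lambda>i. - \<tau> e' i)" using inversion(4) by (metis mem_Collect_eq)
    then have "cell d (tgt e) = cell d (tgt e')" using e tau_X by (simp add: fun_eq_iff)
    moreover have "bij (trans (\<lambda>i. - cell d (tgt e') i))" by (rule trans(1)[OF neg_cell_outside])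
    ultimately have "rev e = rev e'"
      using e(3) unfolding inversion_def by (metis bij_is_inj injD)
    then show "e = e'" using revs by metis
  qed
  show "inversion ` {e. src e \<in> X} = {e. src e \<in> X}"
  proof safe
    fix e assume "src e \<in> X" then show "src (inversion e) \<in> X" by (rule inversion)
  next
    fix e assume e: "src e \<in> X"
    let ?m = "cell d (tgt e)"
    have m: "\<And>i. dt \<le> i \<Longrightarrow> ?m i = 0" using d_less by (simp add: cell_outside)
    \<comment> \<open>A preimage under \<open>trans ?m\<close>, not the image under the opposite
      translation, because \<open>inversion\<close> has to apply this very map to return to
      \<open>e\<close>.\<close>
    obtain u where u: "e = trans ?m u" using trans_surj[of ?m e] m by blast
    have "shift ?m (tgt u) = tgt e" using trans(3)[of ?m u, OF m] u by simp
    then have "shift ?m (tgt u) = shift ?m (base d (tgt e))" by (simp add: shift_cell_base)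
    then have tu: "tgt u = base d (tgt e)" by (simp only: shift_inject)
    have "src e = shift ?m (src u)" using trans(2)[of ?m u, OF m] u by simp
    then have "cell d (src e) = (\<lambda>i. cell d (src u) i + (if i < d then ?m i else 0))"
      by (simp only: cell_shift)
    also have "\<dots> = (\<lambda>i. cell d (src u) i + ?m i)" by (auto simp: cell_outside)
    finally have "cell d (src e) = (\<lambda>i. cell d (src u) i + ?m i)" .
    then have su: "(\<lambda>i. - cell d (src u) i) = ?m" using e by (auto simp: Vcyl_iff fun_eq_iff add_eq_0_iff)
    have "src (rev u) \<in> X" using revs tu ends base_in_X by simp
    moreover have "inversion (rev u) = e" using u revs su by (simp add: inversion_def tgt_rev)
    ultimately show "e \<in> inversion ` {e. src e \<in> X}" by blast
  qed
qed

definition cyl_edges :: "((nat \<Rightarrow> int) \<Rightarrow> bool) \<Rightarrow> 'e set" where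
  "cyl_edges P = {e. src e \<in> X \<and> P (\<tau> e)}"

text \<open>Invariance of \<open>P\<close> under a change of sign makes the selected edges stable
  under \<open>inversion\<close>. All, zero or nonzero indices give the cylinder, the bridgeless
  graph and the bridges.\<close>

lemma edge_system_cyl:
  assumes P: "\<And>t. P (\<lambda>i. - t i) \<longleftrightarrow> P t"
    and D': "\<And>v. v \<in> X \<Longrightarrow> card {e. src e = v \<and> P (\<tau> e)} \<le> D'"
  shows "edge_system X (cyl_edges P) src (\<lambda>e. base d (tgt e)) (\<lambda>e. phase d \<theta> (\<tau> e)) inversion D'"
proof
  show "bij_betw inversion (cyl_edges P) (cyl_edges P)"
  proof (rule bij_betw_imageI)
    show "inj_on inversion (cyl_edges P)"
      using inversion_bij by (auto simp: bij_betw_def cyl_edges_def inj_on_def)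
    show "inversion ` cyl_edges P = cyl_edges P"
    proof safe
      fix e assume "e \<in> cyl_edges P"
      then show "inversion e \<in> cyl_edges P" using P inversion by (simp add: cyl_edges_def)
    next
      fix e assume e: "e \<in> cyl_edges P"
      then have "e \<in> inversion ` {e. src e \<in> X}" using inversion_bij by (simp add: bij_betw_def cyl_edges_def)
      then obtain e' where e': "src e' \<in> X" "e = inversion e'" by auto
      then have "e' \<in> cyl_edges P" using e P inversion(4)[OF e'(1)] by (simp add: cyl_edges_def)
      then show "e \<in> inversion ` cyl_edges P" using e'(2) by blast
    qed
  qed
  fix v
  show "finite {e \<in> cyl_edges P. src e = v}"
    by (rule finite_subset[OF _ findeg[rule_format, of v]]) auto
  show "card {e \<in> cyl_edges P. src e = v} \<le> D'"
  proof (cases "v \<in> X")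
    case True
    then have "{e \<in> cyl_edges P. src e = v} = {e. src e = v \<and> P (\<tau> e)}" by (auto simp: cyl_edges_def)
    then show ?thesis using D'[OF True] by simp
  next
    case False
    then have "{e \<in> cyl_edges P. src e = v} = {}" by (auto simp: cyl_edges_def)
    then show ?thesis by (simp only: card.empty)
  qed
qed (auto simp: cyl_edges_def inversion phase_uminus)

lemma card_out_le_D: "card {e. src e = v \<and> P e} \<le> D"
  by (rule order_trans[OF card_mono deg_le_D[of v]]) (use findeg in auto)

end

section \<open>Fiber operators as averages over truncated Bloch waves\<close>

definition box :: "nat \<Rightarrow> int \<Rightarrow> int \<Rightarrow> (nat \<Rightarrow> int) set" where
  "box d lo hi = {n. (\<forall>i<d. lo \<le> n i \<and> n i < hi) \<and> (\<forall>i\<ge>d. n i = 0)}"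

lemma box_outside: "n \<in> box d lo hi \<Longrightarrow> d \<le> i \<Longrightarrow> n i = 0"
  by (simp add: box_def)

lemma finite_box: "finite (box d lo hi)" and card_box: "card (box d lo hi) = nat (hi - lo) ^ d"
proof -
  let ?P = "{..<d} \<rightarrow>\<^sub>E {lo..<hi}"
  have "bij_betw (\<lambda>f i. if i < d then f i else 0) ?P (box d lo hi)"
  proof (rule bij_betwI[where g="\<lambda>f. restrict f {..<d}"])
    show "(\<lambda>f i. if i < d then f i else 0) \<in> ?P \<rightarrow> box d lo hi" by (auto simp: box_def PiE_iff)
    show "(\<lambda>f. restrict f {..<d}) \<in> box d lo hi \<rightarrow> ?P" by (auto simp: box_def)
    show "restrict (\<lambda>i. if i < d then f i else 0) {..<d} = f" if "f \<in> ?P" for f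
      using that by (auto simp: fun_eq_iff PiE_iff extensional_def)
    show "(\<lambda>i. if i < d then restrict f {..<d} i else 0) = f" if "f \<in> box d lo hi" for f
      using that by (auto simp: fun_eq_iff box_def)
  qed
  then show "finite (box d lo hi)" "card (box d lo hi) = nat (hi - lo) ^ d"
    using bij_betw_finite bij_betw_same_card by (force simp: finite_PiE, force simp: card_funcsetE)
qed

text \<open>Divide by \<open>N^d\<close>: the boundary share \<open>1 - (1 - 2 * r / N)^d\<close>
  tends to 0. For \<open>N > 2 * r\<close> the subtraction of natural numbers is exact.\<close>

lemma nonneg_of_box_estimate:
  fixes h c :: real
  assumes "\<And>N. N > 2 * r \<Longrightarrow> 0 \<le> real N ^ d * h + (real N ^ d - real (N - 2 * r) ^ d) * c"
  shows "0 \<le> h"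
proof -
  have "(\<lambda>N. h + (1 - (1 - 2 * real r * inverse (real N)) ^ d) * c) \<longlonglongrightarrow> h + (1 - (1 - 2 * real r * 0) ^ d) * c"
    by (intro tendsto_intros lim_inverse_n)
  then have lim: "(\<lambda>N. h + (1 - (1 - 2 * real r * inverse (real N)) ^ d) * c) \<longlonglongrightarrow> h" by simp
  moreover have "\<forall>\<^sub>F N in sequentially. 0 \<le> h + (1 - (1 - 2 * real r * inverse (real N)) ^ d) * c"
  proof (rule eventually_sequentiallyI[of "Suc (2 * r)"])
    fix N assume N: "Suc (2 * r) \<le> N"
    then have pos: "real N ^ d > 0" by simp
    have eq: "real (N - 2 * r) = real N * (1 - 2 * real r * inverse (real N))"
      using N by (simp add: of_nat_diff field_simps)
    have "real N ^ d * h + (real N ^ d - real (N - 2 * r) ^ d) * c =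
        real N ^ d * (h + (1 - (1 - 2 * real r * inverse (real N)) ^ d) * c)"
      unfolding eq power_mult_distrib by (simp add: algebra_simps)
    then have "0 \<le> real N ^ d * (h + (1 - (1 - 2 * real r * inverse (real N)) ^ d) * c)"
      using assms[of N] N by simp
    then show "0 \<le> h + (1 - (1 - 2 * real r * inverse (real N)) ^ d) * c"
      using pos by (simp add: zero_le_mult_iff)
  qed
  ultimately show ?thesis by (rule tendsto_lowerbound) simp
qed

context periodic_graph
begin

abbreviation W_max where "W_max \<equiv> \<Sum>v\<in>V0. \<bar>W v\<bar>"

sublocale G: schroedinger V UNIV src tgt "\<lambda>_. 1" rev D "\<lambda>v. if v \<in> V then W v else 0" W_max
proof
  show "bij_betw rev UNIV UNIV"
    using revs by (intro bij_betwI[where g=rev]) auto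
  show "\<bar>if v \<in> V then W v else 0\<bar> \<le> W_max" for v
    using W_bound[of v] by (auto intro: sum_nonneg)
  show "finite {e \<in> UNIV. src e = v}" "card {e \<in> UNIV. src e = v} \<le> D" for v
    using findeg deg_le_D[of v] by simp_all
qed (use ends revs tgt_rev in auto)

lemma l2_operator_G: "l2_operator G.ham V (opH0 V src tgt W)"
proof (intro l2_operator.intro l2_operator_axioms.intro G.symmetric_ham G.ham_csc G.ham_supported)
  fix f :: "pt ell2" assume "f \<in> supported V"
  show "opH0 V src tgt W (fun_of f) = fun_of (G.ham f)"
  proof
    fix v
    show "opH0 V src tgt W (fun_of f) v = fun_of (G.ham f) v"
    proof (cases "v \<in> V")
      case True
      then show ?thesis by (simp add: opH0_def G.fun_of_ham)
    next
      case False
      then have "{e \<in> UNIV. src e = v} = {}" using ends by auto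
      then show ?thesis using False by (simp only: opH0_def G.fun_of_ham) simp
    qed
  qed
qed

lemma shift_bij:
  assumes "\<And>i. d \<le> i \<Longrightarrow> n i = 0"
  shows "bij_betw (shift n) X {v \<in> V. cell d v = n}"
proof (rule bij_betwI[where g="base d"])
  have n: "\<And>i. dt \<le> i \<Longrightarrow> n i = 0" using assms d_less by simp
  show "shift n \<in> X \<rightarrow> {v \<in> V. cell d v = n}"
    using V_shift[of n] n assms by (auto simp: Vcyl_iff cell_shift fun_eq_iff not_less)
  show "base d \<in> {v \<in> V. cell d v = n} \<rightarrow> X" using base_in_X by auto
  show "base d (shift n x) = x" if "x \<in> X" for x using that by (simp add: base_shift assms base_Vcyl)
  show "shift n (base d v) = v" if "v \<in> {v \<in> V. cell d v = n}" for v
    using that shift_cell_base[of d v] by simp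
qed

definition transl :: "(nat \<Rightarrow> int) \<Rightarrow> pt ell2 \<Rightarrow> pt ell2" where
  "transl n f = ell2_of (\<lambda>v. if v \<in> V \<and> cell d v = n then fun_of f (base d v) else 0)"

lemma fun_of_transl:
  assumes "\<And>i. d \<le> i \<Longrightarrow> n i = 0"
  shows "fun_of (transl n f) v = (if v \<in> V \<and> cell d v = n then fun_of f (base d v) else 0)"
proof -
  let ?g = "\<lambda>v. if v \<in> V \<and> cell d v = n then fun_of f (base d v) else 0"
  have bij: "bij_betw (shift n) X {v \<in> V. cell d v = n}" by (rule shift_bij) (rule assms)
  have "(\<lambda>x. (cmod (fun_of f x))\<^sup>2) summable_on X" by (rule summable_on_subset[OF fun_of_summable]) simp
  then have "(\<lambda>x. (cmod (?g (shift n x)))\<^sup>2) summable_on X"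
    by (rule summable_on_cong[THEN iffD1, rotated])
      (use bij in \<open>auto simp: bij_betw_def base_shift assms base_Vcyl\<close>)
  then have "(\<lambda>v. (cmod (?g v))\<^sup>2) summable_on {v \<in> V. cell d v = n}"
    using summable_on_reindex_bij_betw[OF bij, of "\<lambda>v. (cmod (?g v))\<^sup>2"] by simp
  then have "(\<lambda>v. (cmod (?g v))\<^sup>2) summable_on UNIV"
    by (rule summable_on_cong_neutral[THEN iffD1, rotated -1]) auto
  then show ?thesis by (simp add: transl_def ell2_of_inverse)
qed

end

locale fiber = periodic_graph dt d V src tgt rev W
  for dt d V and src tgt :: "'e \<Rightarrow> pt" and rev W +
  fixes \<theta> :: "nat \<Rightarrow> real"
begin

abbreviation b where "b \<equiv> \<lambda>e. base d (tgt e)"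
abbreviation \<kappa> where "\<kappa> \<equiv> \<lambda>e. phase d \<theta> (\<tau> e)"
abbreviation ph where "ph \<equiv> phase d \<theta>"

sublocale C: schroedinger X "cyl_edges (\<lambda>_. True)" src b \<kappa> inversion D "\<lambda>v. if v \<in> X then W v else 0" W_max
proof (intro schroedinger.intro edge_system_cyl schroedinger_axioms.intro)
  show "\<bar>if v \<in> X then W v else 0\<bar> \<le> W_max" for v
    using W_bound[of v] by (auto simp: Vcyl_def intro: sum_nonneg)
qed (auto simp: deg_le_D)

text \<open>The quasi-periodic extension of \<open>f\<close> from \<open>X\<close> to
  \<open>V\<close>, cut off outside \<open>B\<close>, since the full extension is in general not
  square summable.\<close>

definition wave :: "(nat \<Rightarrow> int) set \<Rightarrow> pt ell2 \<Rightarrow> pt ell2" where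
  "wave B f = (\<Sum>n\<in>B. csc (ph n) (transl n f))"

lemma fun_of_wave:
  assumes "finite B" "\<forall>n\<in>B. \<forall>i\<ge>d. n i = 0"
  shows "fun_of (wave B f) v = (if v \<in> V \<and> cell d v \<in> B then ph (cell d v) * fun_of f (base d v) else 0)"
proof -
  have "fun_of (wave B f) v = (\<Sum>n\<in>B. if cell d v = n then (if v \<in> V then ph n * fun_of f (base d v) else 0) else 0)"
    unfolding wave_def fun_of_sum using fun_of_transl assms(2) by (intro sum.cong) auto
  also have "\<dots> = (if v \<in> V \<and> cell d v \<in> B then ph (cell d v) * fun_of f (base d v) else 0)"
    using assms(1) by simp
  finally show ?thesis .
qed

lemma wave_supported:
  assumes "finite B" "\<forall>n\<in>B. \<forall>i\<ge>d. n i = 0"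
  shows "wave B f \<in> supported V"
  using fun_of_wave[OF assms] by (simp add: supported_def)

lemma out_X: "x \<in> X \<Longrightarrow> C.out x = {e. src e = x}" by (auto simp: cyl_edges_def)

text \<open>The phase of cell \<open>n\<close> times that of an edge is the phase of the target
  cell, so edges staying in \<open>B\<close> reproduce \<open>C.ham f\<close>. An edge leaving
  \<open>B\<close> meets the value 0, and the second sum undoes the term that \<open>C.ham f\<close>
  subtracts for it.\<close>

lemma ham_wave:
  assumes B: "finite B" "\<forall>n\<in>B. \<forall>i\<ge>d. n i = 0" and n: "n \<in> B" and x: "x \<in> X"
  shows "fun_of (G.ham (wave B f)) (shift n x) =
    ph n * (fun_of (C.ham f) x + (\<Sum>e\<in>C.out x. if (\<lambda>i. n i + \<tau> e i) \<in> B then 0 else \<kappa> e * fun_of f (b e)))"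
proof -
  let ?F = "fun_of (wave B f)"
  have nd: "\<And>i. d \<le> i \<Longrightarrow> n i = 0" using B(2) n by blast
  have nt: "\<And>i. dt \<le> i \<Longrightarrow> n i = 0" using nd d_less by simp
  have xV: "x \<in> V" "cell d x = (\<lambda>_. 0)" using x by (auto simp: Vcyl_iff)
  have sx: "shift n x \<in> V" "W (shift n x) = W x" using W_shift[of n x] nt xV by auto
  have cell_n: "cell d (shift n p) = (\<lambda>i. n i + cell d p i)" for p
    using nd by (auto simp: cell_shift fun_eq_iff not_less)
  have base_n: "base d (shift n p) = base d p" for p by (rule base_shift) (rule nd)
  have F_x: "?F (shift n x) = ph n * fun_of f x"
    using n sx x by (simp add: fun_of_wave[OF B] cell_n xV base_n base_Vcyl)
  have F_e: "?F (shift n (tgt e)) = ph n * (if (\<lambda>i. n i + \<tau> e i) \<in> B then \<kappa> e * fun_of f (b e) else 0)"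
    if e: "src e = x" for e
  proof -
    have "shift n (tgt e) \<in> V" using V_shift[of n "tgt e"] nt ends by simp
    then show ?thesis
      using e x by (simp add: fun_of_wave[OF B] cell_n base_n tau_X phase_add)
  qed
  have bij: "bij_betw (trans n) {e. src e = x} {e. src e = shift n x}" by (rule out_trans) (rule nt)
  have "fun_of (G.ham (wave B f)) (shift n x) =
      (\<Sum>e\<in>{e. src e = shift n x}. ?F (shift n x) - ?F (tgt e)) + complex_of_real (W x) * ?F (shift n x)"
    using sx by (simp add: G.fun_of_ham)
  also have "(\<Sum>e\<in>{e. src e = shift n x}. ?F (shift n x) - ?F (tgt e)) =
      (\<Sum>e\<in>{e. src e = x}. ?F (shift n x) - ?F (tgt (trans n e)))"
    by (rule sum.reindex_bij_betw[OF bij, symmetric])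
  also have "\<dots> = (\<Sum>e\<in>{e. src e = x}. ph n * (fun_of f x - (if (\<lambda>i. n i + \<tau> e i) \<in> B then \<kappa> e * fun_of f (b e) else 0)))"
  proof (rule sum.cong)
    fix e assume "e \<in> {e. src e = x}"
    moreover have "tgt (trans n e) = shift n (tgt e)" by (rule trans) (rule nt)
    ultimately show "?F (shift n x) - ?F (tgt (trans n e)) =
        ph n * (fun_of f x - (if (\<lambda>i. n i + \<tau> e i) \<in> B then \<kappa> e * fun_of f (b e) else 0))"
      using F_x F_e by (simp add: right_diff_distrib)
  qed simp
  also have "\<dots> = ph n * ((\<Sum>e\<in>{e. src e = x}. fun_of f x - \<kappa> e * fun_of f (b e)) +
      (\<Sum>e\<in>{e. src e = x}. if (\<lambda>i. n i + \<tau> e i) \<in> B then 0 else \<kappa> e * fun_of f (b e)))"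
    unfolding sum_distrib_left[symmetric] sum.distrib[symmetric] by (intro arg_cong[where f="(*) (ph n)"] sum.cong) auto
  finally show ?thesis using x unfolding F_x C.fun_of_ham out_X[OF x] by (simp add: algebra_simps)
qed

text \<open>The factor \<open>ph n\<close> has modulus 1 and drops out, so \<open>n\<close> matters
  only through the edges that leave \<open>B\<close>.\<close>

lemma ham_wave_inner:
  assumes B: "finite B" "\<forall>n\<in>B. \<forall>i\<ge>d. n i = 0" and n: "n \<in> B"
  shows "G.ham (wave B f) \<bullet> csc (ph n) (transl n f) = (\<Sum>\<^sub>\<infinity>x\<in>X. fun_of (C.ham f) x \<bullet> fun_of f x +
    (\<Sum>e\<in>C.out x. if (\<lambda>i. n i + \<tau> e i) \<in> B then 0 else (\<kappa> e * fun_of f (b e)) \<bullet> fun_of f (src e)))"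
proof -
  have nd: "\<And>i. d \<le> i \<Longrightarrow> n i = 0" using B(2) n by blast
  have bij: "bij_betw (shift n) X {v \<in> V. cell d v = n}" by (rule shift_bij) (rule nd)
  let ?h = "\<lambda>v. fun_of (G.ham (wave B f)) v \<bullet> (ph n * fun_of f (base d v))"
  have "G.ham (wave B f) \<bullet> csc (ph n) (transl n f) = infsum ?h {v \<in> V. cell d v = n}"
    unfolding inner_ell2_def using fun_of_transl[of n f] nd by (intro infsum_cong_neutral) auto
  also have "\<dots> = (\<Sum>\<^sub>\<infinity>x\<in>X. ?h (shift n x))" by (rule infsum_reindex_bij_betw[OF bij, symmetric])
  also have "\<dots> = (\<Sum>\<^sub>\<infinity>x\<in>X. fun_of (C.ham f) x \<bullet> fun_of f x +
    (\<Sum>e\<in>C.out x. if (\<lambda>i. n i + \<tau> e i) \<in> B then 0 else (\<kappa> e * fun_of f (b e)) \<bullet> fun_of f (src e)))"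
  proof (rule infsum_cong)
    fix x assume x: "x \<in> X"
    have "base d (shift n x) = x" using x nd by (simp add: base_shift base_Vcyl)
    then have "?h (shift n x) = (fun_of (C.ham f) x + (\<Sum>e\<in>C.out x. if (\<lambda>i. n i + \<tau> e i) \<in> B then 0 else \<kappa> e * fun_of f (b e))) \<bullet> fun_of f x"
      by (simp only: ham_wave[OF B n x] unit_mult_inner cmod_phase)
    also have "\<dots> = fun_of (C.ham f) x \<bullet> fun_of f x +
      (\<Sum>e\<in>C.out x. (if (\<lambda>i. n i + \<tau> e i) \<in> B then 0 else \<kappa> e * fun_of f (b e)) \<bullet> fun_of f x)"
      by (simp only: inner_add_left inner_sum_left)
    also have "(\<Sum>e\<in>C.out x. (if (\<lambda>i. n i + \<tau> e i) \<in> B then 0 else \<kappa> e * fun_of f (b e)) \<bullet> fun_of f x) =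
      (\<Sum>e\<in>C.out x. if (\<lambda>i. n i + \<tau> e i) \<in> B then 0 else (\<kappa> e * fun_of f (b e)) \<bullet> fun_of f (src e))"
      by (rule sum.cong) auto
    finally show "?h (shift n x) = fun_of (C.ham f) x \<bullet> fun_of f x +
    (\<Sum>e\<in>C.out x. if (\<lambda>i. n i + \<tau> e i) \<in> B then 0 else (\<kappa> e * fun_of f (b e)) \<bullet> fun_of f (src e))" .
  qed
  finally show ?thesis .
qed

lemma C_ham_inner: "(\<Sum>\<^sub>\<infinity>x\<in>X. fun_of (C.ham f) x \<bullet> fun_of f x) = C.ham f \<bullet> f"
  unfolding inner_ell2_def using C.ham_supported[of f]
  by (intro infsum_cong_neutral) (auto simp: supported_def)

lemma ham_wave_inner_interior:
  assumes B: "finite B" "\<forall>n\<in>B. \<forall>i\<ge>d. n i = 0" and n: "n \<in> B"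
    and int: "\<And>e. (\<lambda>i. n i + \<tau> e i) \<in> B"
  shows "G.ham (wave B f) \<bullet> csc (ph n) (transl n f) = C.ham f \<bullet> f"
  by (simp add: ham_wave_inner[OF B n] int C_ham_inner)

text \<open>The edges leaving \<open>B\<close> contribute at most the absolute sum over all edges, a
  bound independent of \<open>n\<close> and \<open>B\<close>.\<close>

lemma ham_wave_inner_le:
  assumes B: "finite B" "\<forall>n\<in>B. \<forall>i\<ge>d. n i = 0" and n: "n \<in> B"
  shows "G.ham (wave B f) \<bullet> csc (ph n) (transl n f) \<le> C.ham f \<bullet> f + real D * (f \<bullet> f)"
proof -
  let ?c = "\<lambda>e. (\<kappa> e * fun_of f (b e)) \<bullet> fun_of f (src e)"
  let ?r = "\<lambda>e. if (\<lambda>i. n i + \<tau> e i) \<in> B then 0 else ?c e"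
  have s1: "(\<lambda>x. fun_of (C.ham f) x \<bullet> fun_of f x) summable_on X"
    by (rule summable_on_subset[OF fun_of_summable_inner]) simp
  have "(\<lambda>e. norm (?r e)) summable_on cyl_edges (\<lambda>_. True)"
    by (rule summable_on_comparison_test[OF C.edge_inner_abs_summable[of f f]]) auto
  then have "?r summable_on cyl_edges (\<lambda>_. True)" by (rule abs_summable_summable)
  then have s2: "(\<lambda>x. \<Sum>e\<in>C.out x. ?r e) summable_on X"
    by (rule summable_on_subset[OF C.edge_sum(2)]) simp
  have s3: "(\<lambda>x. \<Sum>e\<in>C.out x. \<bar>?c e\<bar>) summable_on X"
    by (rule summable_on_subset[OF C.edge_sum(2)[OF C.edge_inner_abs_summable]]) simp
  have "G.ham (wave B f) \<bullet> csc (ph n) (transl n f) = (\<Sum>\<^sub>\<infinity>x\<in>X. fun_of (C.ham f) x \<bullet> fun_of f x + (\<Sum>e\<in>C.out x. ?r e))"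
    by (rule ham_wave_inner[OF B n])
  also have "\<dots> \<le> (\<Sum>\<^sub>\<infinity>x\<in>X. fun_of (C.ham f) x \<bullet> fun_of f x + (\<Sum>e\<in>C.out x. \<bar>?c e\<bar>))"
    by (intro infsum_mono summable_on_add s1 s2 s3 add_left_mono sum_mono) auto
  also have "\<dots> = C.ham f \<bullet> f + (\<Sum>\<^sub>\<infinity>x\<in>X. \<Sum>e\<in>C.out x. \<bar>?c e\<bar>)"
    by (simp only: infsum_add[OF s1 s3] C_ham_inner)
  also have "(\<Sum>\<^sub>\<infinity>x\<in>X. \<Sum>e\<in>C.out x. \<bar>?c e\<bar>) = (\<Sum>\<^sub>\<infinity>x. \<Sum>e\<in>C.out x. \<bar>?c e\<bar>)"
    by (rule infsum_cong_neutral) (auto simp: cyl_edges_def intro!: sum.neutral)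
  also have "\<dots> = (\<Sum>\<^sub>\<infinity>e\<in>cyl_edges (\<lambda>_. True). \<bar>?c e\<bar>)"
    by (rule C.edge_sum(1)[OF C.edge_inner_abs_summable])
  also have "\<dots> \<le> real D * (f \<bullet> f)"
    using C.edge_inner_abs_sum_le[of f] C.deg_form_le[of f] by linarith
  finally show ?thesis by simp
qed

text \<open>Bloch waves cut off to a box of side \<open>N\<close> are test functions for the whole graph; the cut-off
  only affects the boundary layer of the box, whose share of the volume vanishes as \<open>N\<close> grows.\<close>

lemma fiber_nonneg:
  assumes pos: "\<And>F. F \<in> supported V \<Longrightarrow> 0 \<le> G.ham F \<bullet> F"
  shows "0 \<le> C.ham f \<bullet> f"
proof -
  obtain r where r: "\<And>e i. \<bar>\<tau> e i\<bar> \<le> int r" using tau_bound by blast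
  show ?thesis
  proof (rule nonneg_of_box_estimate[of r d _ "real D * (f \<bullet> f)"])
    fix N :: nat assume N: "N > 2 * r"
    define B where "B = box d 0 (int N)"
    \<comment> \<open>Indices are bounded by \<open>r\<close>, so no edge from a cell of
      \<open>I\<close> leaves \<open>B\<close>.\<close>
    define I where "I = box d (int r) (int N - int r)"
    have B: "finite B" "\<forall>n\<in>B. \<forall>i\<ge>d. n i = 0" by (auto simp: B_def finite_box box_outside)
    have IB: "I \<subseteq> B" using N by (force simp: I_def B_def box_def)
    have cB: "real (card B) = real N ^ d" by (simp add: B_def card_box)
    have "nat (int N - int r - int r) = N - 2 * r" by simp
    then have cI: "real (card I) = real (N - 2 * r) ^ d" by (simp add: I_def card_box)
    have int: "(\<lambda>i. n i + \<tau> e i) \<in> B" if n: "n \<in> I" for n e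
    proof -
      have "0 \<le> n i + \<tau> e i \<and> n i + \<tau> e i < int N" if "i < d" for i
        using n that r[of e i] unfolding I_def box_def abs_le_iff by force
      moreover have "n i + \<tau> e i = 0" if "d \<le> i" for i
        using n that by (simp add: I_def box_outside tau_outside)
      ultimately show ?thesis by (simp add: B_def box_def)
    qed
    let ?t = "\<lambda>n. G.ham (wave B f) \<bullet> csc (ph n) (transl n f)"
    have "0 \<le> G.ham (wave B f) \<bullet> wave B f" by (rule pos[OF wave_supported[OF B]])
    also have "\<dots> = (\<Sum>n\<in>B. ?t n)" by (subst (2) wave_def) (rule inner_sum_right)
    also have "\<dots> = (\<Sum>n\<in>I. ?t n) + (\<Sum>n\<in>B - I. ?t n)"
      using sum.subset_diff[OF IB B(1), of ?t] by simp
    also have "(\<Sum>n\<in>I. ?t n) = (\<Sum>n\<in>I. C.ham f \<bullet> f)"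
      using IB int by (intro sum.cong ham_wave_inner_interior[OF B]) auto
    also have "\<dots> + (\<Sum>n\<in>B - I. ?t n) \<le> (\<Sum>n\<in>I. C.ham f \<bullet> f) + (\<Sum>n\<in>B - I. C.ham f \<bullet> f + real D * (f \<bullet> f))"
      by (intro add_left_mono sum_mono ham_wave_inner_le[OF B]) auto
    also have "\<dots> = real (card B) * (C.ham f \<bullet> f) + (real (card B) - real (card I)) * (real D * (f \<bullet> f))"
    proof -
      have "card (B - I) = card B - card I" using IB B(1) by (simp add: card_Diff_subset finite_subset)
      then have eq: "real (card (B - I)) = real (card B) - real (card I)"
        using card_mono[OF B(1) IB] by (simp add: of_nat_diff)
      show ?thesis unfolding sum_constant eq by (simp add: algebra_simps)
    qed
    finally show "0 \<le> real N ^ d * (C.ham f \<bullet> f) + (real N ^ d - real (N - 2 * r) ^ d) * (real D * (f \<bullet> f))"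
      by (simp only: cB cI)
  qed
qed

end

section \<open>Guided bands\<close>

locale guided = fiber dt d V src tgt rev W \<theta>
  for dt d V and src tgt :: "'e \<Rightarrow> pt" and rev W \<theta> +
  fixes Q :: "pt \<Rightarrow> real"
  assumes Qfin: "finite {v \<in> Vcyl d V. Q v \<noteq> 0}"
begin

abbreviation \<beta> where "\<beta> \<equiv> beta_plus d V src tgt"
definition U where "U v = (if v \<in> X then W v - Q v else 0)"
definition U_max where "U_max = W_max + (\<Sum>v\<in>{v \<in> X. Q v \<noteq> 0}. \<bar>Q v\<bar>)"

lemma U_le: "\<bar>U v\<bar> \<le> U_max"
proof (cases "v \<in> X")
  case True
  have "\<bar>Q v\<bar> \<le> (\<Sum>v\<in>{v \<in> X. Q v \<noteq> 0}. \<bar>Q v\<bar>)"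
  proof (cases "Q v = 0")
    case False
    then show ?thesis using True Qfin by (intro member_le_sum[where f="\<lambda>v. \<bar>Q v\<bar>"]) auto
  qed (simp add: sum_nonneg)
  moreover have "\<bar>W v\<bar> \<le> W_max" using True by (intro W_bound) (simp add: Vcyl_def)
  ultimately show ?thesis using True by (simp add: U_def U_max_def)
qed (simp add: U_def U_max_def sum_nonneg)

lemma U_out: "v \<notin> X \<Longrightarrow> U v = 0" by (simp add: U_def)

text \<open>\<open>X\<close> is infinite, but \<open>beta\<close> takes values up to
  \<open>D\<close> only, so the \<open>Max\<close> in \<open>beta_plus\<close> is over a finite
  set.\<close>

lemma beta_le: "v \<in> X \<Longrightarrow> card {e. src e = v \<and> \<tau> e \<noteq> (\<lambda>_. 0)} \<le> \<beta>"
proof -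
  assume v: "v \<in> X"
  have "beta d src tgt ` X \<subseteq> {..D}" using card_out_le_D by (auto simp: beta_def)
  then have "finite (beta d src tgt ` X)" using finite_subset by blast
  then show ?thesis using v unfolding beta_plus_def beta_def[symmetric] by (intro Max_ge) auto
qed

sublocale H: schroedinger X "cyl_edges (\<lambda>_. True)" src b \<kappa> inversion D U U_max
  by (intro schroedinger.intro edge_system_cyl schroedinger_axioms.intro U_le U_out) (auto simp: deg_le_D)

text \<open>The same phases serve all three edge sets; on edges of index zero they equal 1, so this
  operator does not depend on \<theta>.\<close>

sublocale h: schroedinger X "cyl_edges (\<lambda>t. t = (\<lambda>_. 0))" src b \<kappa> inversion D U U_max
  by (intro schroedinger.intro edge_system_cyl schroedinger_axioms.intro U_le U_out card_out_le_D)
    (auto simp: fun_eq_iff)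

sublocale B: schroedinger X "cyl_edges (\<lambda>t. t \<noteq> (\<lambda>_. 0))" src b \<kappa> inversion \<beta> "\<lambda>_. 0" 0
  by (intro schroedinger.intro edge_system_cyl schroedinger_axioms.intro beta_le) (auto simp: fun_eq_iff)

lemma l2_operator_H: "l2_operator H.ham X (opHfib d V src tgt W Q \<theta>)"
proof (intro l2_operator.intro l2_operator_axioms.intro H.symmetric_ham H.ham_csc H.ham_supported)
  fix f :: "pt ell2" assume "f \<in> supported X"
  show "opHfib d V src tgt W Q \<theta> (fun_of f) = fun_of (H.ham f)"
  proof
    fix v
    show "opHfib d V src tgt W Q \<theta> (fun_of f) v = fun_of (H.ham f) v"
    proof (cases "v \<in> X")
      case True
      then show ?thesis unfolding H.fun_of_ham out_X[OF True] by (simp add: opHfib_def phase_def U_def)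
    next
      case False
      then show ?thesis using H.ham_supported[of f] by (simp add: opHfib_def supported_def)
    qed
  qed
qed

lemma l2_operator_h: "l2_operator h.ham X (oph d V src tgt W Q)"
proof (intro l2_operator.intro l2_operator_axioms.intro h.symmetric_ham h.ham_csc h.ham_supported)
  fix f :: "pt ell2" assume "f \<in> supported X"
  show "oph d V src tgt W Q (fun_of f) = fun_of (h.ham f)"
  proof
    fix v
    show "oph d V src tgt W Q (fun_of f) v = fun_of (h.ham f) v"
    proof (cases "v \<in> X")
      case True
      have "(\<Sum>e\<in>{e \<in> cyl_edges (\<lambda>t. t = (\<lambda>_. 0)). src e = v}. fun_of f v - \<kappa> e * fun_of f (b e)) =
          (\<Sum>e | src e = v \<and> \<tau> e = (\<lambda>_. 0). fun_of f v - fun_of f (tgt e))"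
      proof (rule sum.cong)
        fix e assume "e \<in> {e. src e = v \<and> \<tau> e = (\<lambda>_. 0)}"
        then have e: "src e \<in> X" "\<tau> e = (\<lambda>_. 0)" using True by auto
        \<comment> \<open>An edge of index zero that starts in \<open>X\<close> also ends in
          \<open>X\<close>.\<close>
        then have "b e = tgt e" using tau_X[of e] by (simp add: base_eq_shift shift_0)
        then show "fun_of f v - \<kappa> e * fun_of f (b e) = fun_of f v - fun_of f (tgt e)"
          using e by simp
      qed (use True in \<open>auto simp: cyl_edges_def\<close>)
      then show ?thesis using True unfolding h.fun_of_ham by (simp add: oph_def U_def)
    next
      case False
      then show ?thesis using h.ham_supported[of f] by (simp add: oph_def supported_def)
    qed
  qed
qed

lemma H_eq: "H.ham f = h.ham f + B.ham f"
proof (rule ell2_eqI)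
  fix v
  let ?t = "\<lambda>e. fun_of f v - \<kappa> e * fun_of f (b e)"
  have union: "{e \<in> cyl_edges (\<lambda>_. True). src e = v} =
      {e \<in> cyl_edges (\<lambda>t. t = (\<lambda>_. 0)). src e = v} \<union> {e \<in> cyl_edges (\<lambda>t. t \<noteq> (\<lambda>_. 0)). src e = v}"
    by (auto simp: cyl_edges_def)
  have split: "sum ?t {e \<in> cyl_edges (\<lambda>_. True). src e = v} =
      sum ?t {e \<in> cyl_edges (\<lambda>t. t = (\<lambda>_. 0)). src e = v} +
      sum ?t {e \<in> cyl_edges (\<lambda>t. t \<noteq> (\<lambda>_. 0)). src e = v}"
    unfolding union by (rule sum.union_disjoint[OF h.fin B.fin]) (auto simp: cyl_edges_def)
  show "fun_of (H.ham f) v = fun_of (h.ham f + B.ham f) v"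
    unfolding plus_ell2.rep_eq H.fun_of_ham h.fun_of_ham B.fun_of_ham split
    by (simp only: of_real_0 mult_zero_left add_0_left add_0_right ac_simps)
qed

text \<open>The form is the bridge degree form minus the bridge adjacency form, and the latter is
  dominated by the former, itself at most \<open>\<beta> * (f \<bullet> f)\<close>.\<close>

lemma bridge_form: "0 \<le> B.ham f \<bullet> f" "B.ham f \<bullet> f \<le> 2 * real \<beta> * (f \<bullet> f)"
proof -
  have "diag_op (\<lambda>_. 0) f \<bullet> f = 0" by (simp add: B.U.diag_op_form)
  then show "0 \<le> B.ham f \<bullet> f" "B.ham f \<bullet> f \<le> 2 * real \<beta> * (f \<bullet> f)"
    using B.abs_adj_form_le[of f] B.deg_form_le[of f] by (auto simp: B.ham_form abs_le_iff)
qed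

text \<open>A negative essential point would make the form negative on spaces of every dimension.
  One of dimension greater than the number of vertices carrying \<open>Q\<close> contains a
  nontrivial combination vanishing at all of them; there \<open>H.ham\<close> coincides with
  \<open>C.ham\<close>, whose form is nonnegative.\<close>

lemma H_ess_nonneg:
  assumes pos: "\<And>f. 0 \<le> C.ham f \<bullet> f"
    and z: "complex_of_real z \<in> ess_spectrum X (opHfib d V src tgt W Q \<theta>)"
  shows "0 \<le> z"
proof (rule ccontr)
  assume neg: "\<not> 0 \<le> z"
  interpret L: l2_operator H.ham X "opHfib d V src tgt W Q \<theta>" by (rule l2_operator_H)
  define Y where "Y = {v \<in> X. Q v \<noteq> 0}"
  have Y: "finite Y" using Qfin by (simp add: Y_def)
  define j where "j = Suc (card Y)"
  have "L.negdim 0 j" using L.ess_negdim[OF z] neg by simp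
  then obtain g where g: "\<forall>i<j. g i \<in> supported X" "\<And>c. \<exists>i<j. c i \<noteq> 0 \<Longrightarrow>
       H.ham (\<Sum>i<j. csc (c i) (g i)) \<bullet> (\<Sum>i<j. csc (c i) (g i)) < 0"
    unfolding L.negdim_def by auto
  obtain c where c: "\<exists>i\<in>{..<j}. c i \<noteq> 0" "\<And>v. v \<in> Y \<Longrightarrow> (\<Sum>i\<in>{..<j}. fun_of (g i) v * c i) = 0"
    using homogeneous_system_nontrivial_solution[OF Y, of "{..<j}" "\<lambda>v i. fun_of (g i) v"]
    by (auto simp: j_def)
  define f where "f = (\<Sum>i<j. csc (c i) (g i))"
  have f0: "fun_of f v = 0" if "v \<in> Y" for v using c(2)[OF that] by (simp add: f_def mult.commute)
  have "H.ham f = C.ham f"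
  proof (rule ell2_eqI)
    fix v
    have "complex_of_real (U v) * fun_of f v = complex_of_real (if v \<in> X then W v else 0) * fun_of f v"
      using f0[of v] by (auto simp: U_def Y_def)
    then show "fun_of (H.ham f) v = fun_of (C.ham f) v" by (simp only: H.fun_of_ham C.fun_of_ham)
  qed
  moreover have "H.ham f \<bullet> f < 0" unfolding f_def using c(1) by (intro g(2)) auto
  ultimately show False using pos[of f] by simp
qed

text \<open>Levels are carried between the two operators by \<open>negdim_transfer\<close>. If the
  upper bound failed, a level \<open>s\<close> just above \<open>mu\<close> would satisfy
  \<open>s + 2 * \<beta> < lam \<le> 0\<close>, so it would lie below the essential spectrum of the
  fiber operator, where \<open>lam_le\<close> applies.\<close>

lemma lam_bounds:
  assumes pos: "\<And>f. 0 \<le> C.ham f \<bullet> f" and j: "1 \<le> j"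
    and nf: "enat j \<le> num_fin X (opHfib d V src tgt W Q \<theta>)"
    and le0: "lam X (opHfib d V src tgt W Q \<theta>) j \<le> 0"
  shows "mu X (oph d V src tgt W Q) j \<le> lam X (opHfib d V src tgt W Q \<theta>) j"
    and "lam X (opHfib d V src tgt W Q \<theta>) j \<le> mu X (oph d V src tgt W Q) j + 2 * real \<beta>"
proof -
  let ?lam = "lam X (opHfib d V src tgt W Q \<theta>) j" and ?mu = "mu X (oph d V src tgt W Q) j"
  interpret L: l2_operator H.ham X "opHfib d V src tgt W Q \<theta>" by (rule l2_operator_H)
  interpret l: l2_operator h.ham X "oph d V src tgt W Q" by (rule l2_operator_h)
  show "?mu \<le> ?lam"
  proof (rule dense_ge)
    fix s assume "?lam < s"
    then have "L.negdim s j" by (rule L.lam_less[OF nf])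
    moreover have "h.ham f \<bullet> f \<le> H.ham f \<bullet> f + 0 * (f \<bullet> f)" for f
      using bridge_form(1)[of f] by (simp add: H_eq inner_add_left)
    ultimately have "l.negdim (s + 0) j"
      using negdim_transfer[OF l2_operator_H l2_operator_h] by blast
    then show "?mu \<le> s" using l.mu_le[OF _ j] by simp
  qed
  show "?lam \<le> ?mu + 2 * real \<beta>"
  proof (rule ccontr)
    assume "\<not> ?thesis"
    then obtain s where s: "?mu < s" "s < ?lam - 2 * real \<beta>" using dense[of ?mu "?lam - 2 * real \<beta>"] by auto
    have "l.negdim s j" using l.mu_less[OF s(1) X_infinite] .
    moreover have "H.ham f \<bullet> f \<le> h.ham f \<bullet> f + 2 * real \<beta> * (f \<bullet> f)" for f
      using bridge_form(2)[of f] by (simp add: H_eq inner_add_left)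
    ultimately have "L.negdim (s + 2 * real \<beta>) j"
      using negdim_transfer[OF l2_operator_h l2_operator_H] by blast
    then have "?lam \<le> s + 2 * real \<beta>"
    proof (rule L.lam_le[OF _ j])
      fix z assume "complex_of_real z \<in> ess_spectrum X (opHfib d V src tgt W Q \<theta>)"
      then have "0 \<le> z" by (rule H_ess_nonneg[OF pos])
      then show "s + 2 * real \<beta> \<le> z" using s(2) le0 by linarith
    qed
    then show False using s(2) by linarith
  qed
qed

end

theorem theorem2p2:
  fixes dt d :: nat and V :: "pt set" and src tgt :: "'e \<Rightarrow> pt" and rev :: "'e \<Rightarrow> 'e"
    and W Q :: "pt \<Rightarrow> real"
  assumes dims: "2 \<le> dt" "1 \<le> d" "d < dt"
    and pts: "\<forall>v\<in>V. \<forall>i\<ge>dt. v i = 0"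
    and infV: "infinite V"
    and ends: "\<forall>e. src e \<in> V \<and> tgt e \<in> V"
    and revs: "\<forall>e. rev (rev e) = e \<and> rev e \<noteq> e \<and> src (rev e) = tgt e"
    and findeg: "\<forall>v. finite {e. src e = v}"
    and conn: "\<forall>u\<in>V. \<forall>v\<in>V. (u, v) \<in> (range (\<lambda>e. (src e, tgt e)))\<^sup>*"
    and Vper: "\<forall>s<dt. \<forall>v. v \<in> V \<longleftrightarrow> unitshift s v \<in> V"
    and Eper: "\<forall>s<dt. \<exists>T. bij T \<and> (\<forall>e. src (T e) = unitshift s (src e)
                 \<and> tgt (T e) = unitshift s (tgt e) \<and> T (rev e) = rev (T e))"
    and finquot: "finite {v \<in> V. \<forall>i<dt. 0 \<le> v i \<and> v i < 1}"
    and Wper: "\<forall>s<dt. \<forall>v\<in>V. W (unitshift s v) = W v"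
    and norm: "inf_spec V (opH0 V src tgt W) = 0"
    and Qpos: "\<forall>v\<in>V. 0 \<le> Q v"
    and Qper: "\<forall>s<d. \<forall>v\<in>V. Q (unitshift s v) = Q v"
    and Qfin: "finite {v \<in> Vcyl d V. Q v \<noteq> 0}"
  shows "\<forall>j \<in> {1..N_g d V src tgt W Q}.
           guided_band_o d V src tgt W Q j \<subseteq>
             {mu (Vcyl d V) (oph d V src tgt W Q) j ..
              mu (Vcyl d V) (oph d V src tgt W Q) j + 2 * real (beta_plus d V src tgt)}"
proof (intro ballI subsetI)
  fix j x
  assume j: "j \<in> {1..N_g d V src tgt W Q}" and x: "x \<in> guided_band_o d V src tgt W Q j"
  obtain \<theta> where \<theta>: "x = lam (Vcyl d V) (opHfib d V src tgt W Q \<theta>) j"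
    "enat j \<le> num_fin (Vcyl d V) (opHfib d V src tgt W Q \<theta>)" "x \<le> 0"
    using x unfolding guided_band_o_def guided_band_def by blast
  interpret guided dt d V src tgt rev W \<theta> Q
    by unfold_locales (fact dims infV ends revs findeg Vper Eper finquot Wper Qfin)+
  interpret G: l2_operator G.ham V "opH0 V src tgt W" by (rule l2_operator_G)
  \<comment> \<open>The normalization of \<open>W\<close> enters here as nonnegativity of the form
    on the whole graph; \<open>fiber_nonneg\<close> carries it to the fiber, each \<theta> being
    treated separately.\<close>
  have "0 \<le> G.ham F \<bullet> F" if "F \<in> supported V" for F
    using G.inf_spec_le_form[OF that] norm by simp
  then have "0 \<le> C.ham f \<bullet> f" for f by (rule fiber_nonneg)
  then show "x \<in> {mu (Vcyl d V) (oph d V src tgt W Q) j ..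
              mu (Vcyl d V) (oph d V src tgt W Q) j + 2 * real (beta_plus d V src tgt)}"
    using lam_bounds[of j] j \<theta> by auto
qed

end
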